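(* Let $\rho_0$ be a Borel probability measure on $\mathbb{R}$ with $\int_{\mathbb{R}} x^2\,d\rho_0(x)<\infty$ and let $v_0:\mathbb{R}\to\mathbb{R}$ be absolutely continuous. Then there is an absolutely continuous mapping $X:[0,\infty)\to L^2(\rho_0)$, $t\mapsto X(t)$, which satisfies the sticky particle flow equation $$\dot X(t)=\mathbb{E}_{\rho_0}[v_0\,|\,X(t)]\quad\text{for a.e. } t\ge 0$$ ($\rho_0$ almost everywhere) and the initial condition $X(0)=\mathrm{id}_{\mathbb{R}}$ ($\rho_0$ almost everywhere), and which has the following properties. (i) For Lebesgue almost every $t,s\ge 0$ with $s\le t$, $$\int_{\mathbb{R}}\frac12\dot X(t)^2\,d\rho_0\le\int_{\mathbb{R}}\frac12\dot X(s)^2\,d\rho_0\le\int_{\mathbb{R}}\frac12 v_0^2\,d\rho_0 .$$ (ii) For $t\ge 0$ and $y,z\in\mathrm{supp}(\rho_0)$ with $y\le z$, $$0\le X(z,t)-X(y,t)\le z-y+t\int_y^z|v_0'(x)|\,dx .$$ (iii) For each $0<s\le t$ and $y,z\in\mathrm{supp}(\rho_0)$, $$\frac1t|X(y,t)-X(z,t)|\le\frac1s|X(y,s)-X(z,s)| .$$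
   Context: Absolute continuity (of $v_0$ on $\mathbb{R}$ and of $X$ on $[0,\infty)$) is in the usual $\varepsilon$–$\delta$ sense on the whole interval: for every $\varepsilon>0$ there is $\delta>0$ such that for any finite family of disjoint intervals $(a_i,b_i)$ with $\sum(b_i-a_i)<\delta$ one has $\sum\|F(b_i)-F(a_i)\|<\varepsilon$. $v_0'$ is the a.e. derivative of $v_0$. (Such $v_0$ grows at most linearly, so $\int v_0^2\,d\rho_0<\infty$.) For each $t$, $X(t)\in L^2(\rho_0)$ is represented by a Borel function $X(t):\mathbb{R}\to\mathbb{R}$, $y\mapsto X(y,t)$; statements (ii) and (iii) refer to this chosen representative. $\dot X(t)$ is the derivative of $t\mapsto X(t)$ in $L^2(\rho_0)$, which exists for a.e. $t$. $\mathrm{supp}(\rho_0)=\{y\in\mathbb{R}:\rho_0((y-\delta,y+\delta))>0\text{ for all }\delta>0\}$. Conditional expectation: for a Borel probability measure $\mu$ on $\mathbb{R}$, $g\in L^2(\mu)$ and Borel $Y:\mathbb{R}\to\mathbb{R}$, $\mathbb{E}_\mu[g|Y]$ is the ($\mu$-a.e. unique) $L^2(\mu)$ function of the form $f(Y)$ $\mu$-a.e., with $f:\mathbb{R}\to\mathbb{R}$ Borel and $\int f(Y)^2d\mu<\infty$, such that $\int \mathbb{E}_\mu[g|Y]\,h(Y)\,d\mu=\int g\,h(Y)\,d\mu$ for all Borel $h:\mathbb{R}\to\mathbb{R}$ with $\int h(Y)^2\,d\mu<\infty$. *)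

theory Defs
  imports "HOL-Probability.Probability"
begin

text \<open>
  Absolute continuity on \<open>I\<close> in the \<open>\<epsilon>\<close>-\<open>\<delta>\<close> sense, for a map into a space whose distance is \<open>d\<close>.
  A finite family of intervals is a finite set of pairs of endpoints; as \<open>a < b\<close>, distinct
  pairs in a disjoint family are distinct intervals.
\<close>

definition absolutely_continuous_on ::
    "('a \<Rightarrow> 'a \<Rightarrow> real) \<Rightarrow> real set \<Rightarrow> (real \<Rightarrow> 'a) \<Rightarrow> bool" where
  "absolutely_continuous_on d I F \<longleftrightarrow>
     (\<forall>\<epsilon>>0. \<exists>\<delta>>0. \<forall>P :: (real \<times> real) set.
        finite P \<longrightarrow>
        (\<forall>(a, b)\<in>P. a < b \<and> a \<in> I \<and> b \<in> I) \<longrightarrow>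
        disjoint_family_on (\<lambda>(a, b). {a<..<b}) P \<longrightarrow>
        (\<Sum>(a, b)\<in>P. b - a) < \<delta> \<longrightarrow>
        (\<Sum>(a, b)\<in>P. d (F a) (F b)) < \<epsilon>)"

text \<open>
  Elements of \<open>L\<^sup>2(\<mu>)\<close> are handled through representatives, so \<open>L2_dist \<mu>\<close> is a pseudometric
  on \<open>L2 \<mu>\<close>, and equality in \<open>L\<^sup>2(\<mu>)\<close> is equality almost everywhere.
\<close>

definition L2 :: "'a measure \<Rightarrow> ('a \<Rightarrow> real) set" where
  "L2 \<mu> = {f \<in> borel_measurable \<mu>. integrable \<mu> (\<lambda>y. (f y)\<^sup>2)}"

definition L2_dist :: "'a measure \<Rightarrow> ('a \<Rightarrow> real) \<Rightarrow> ('a \<Rightarrow> real) \<Rightarrow> real" where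
  "L2_dist \<mu> f g = sqrt (\<integral>y. (f y - g y)\<^sup>2 \<partial>\<mu>)"

text \<open>
  \<open>V\<close> is the derivative at \<open>t\<close>, relative to \<open>S\<close>, of the \<open>L\<^sup>2(\<mu>)\<close>-valued map \<open>X\<close>.
\<close>

definition has_L2_derivative ::
    "'a measure \<Rightarrow> (real \<Rightarrow> 'a \<Rightarrow> real) \<Rightarrow> ('a \<Rightarrow> real) \<Rightarrow> real \<Rightarrow> real set \<Rightarrow> bool" where
  "has_L2_derivative \<mu> X V t S \<longleftrightarrow>
     V \<in> L2 \<mu> \<and>
     ((\<lambda>s. L2_dist \<mu> (\<lambda>y. (X s y - X t y) / (s - t)) V) \<longlongrightarrow> 0) (at t within S)"

definition supp :: "real measure \<Rightarrow> real set" where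
  "supp \<mu> = {y. \<forall>\<delta>>0. measure \<mu> {y - \<delta><..<y + \<delta>} > 0}"

text \<open>
  \<open>is_cond_exp \<mu> g Y u\<close>: the function \<open>u\<close> is a version of \<open>\<bbbE>\<^sub>\<mu>[g | Y]\<close>.
\<close>

definition is_cond_exp ::
    "real measure \<Rightarrow> (real \<Rightarrow> real) \<Rightarrow> (real \<Rightarrow> real) \<Rightarrow> (real \<Rightarrow> real) \<Rightarrow> bool" where
  "is_cond_exp \<mu> g Y u \<longleftrightarrow>
     u \<in> L2 \<mu> \<and>
     (\<exists>f \<in> borel_measurable borel. integrable \<mu> (\<lambda>y. (f (Y y))\<^sup>2) \<and> (AE y in \<mu>. u y = f (Y y))) \<and>
     (\<forall>h \<in> borel_measurable borel. integrable \<mu> (\<lambda>y. (h (Y y))\<^sup>2) \<longrightarrow>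
        (\<integral>y. u y * h (Y y) \<partial>\<mu>) = (\<integral>y. g y * h (Y y) \<partial>\<mu>))"

text \<open>
  Such a \<open>u\<close> is the library's conditional expectation with respect to the
  \<open>\<sigma>\<close>-algebra generated by \<open>Y\<close>.
\<close>

lemma is_cond_exp_imp_real_cond_exp:
  assumes \<mu>: "real_distribution \<mu>" and Y: "Y \<in> borel_measurable borel"
    and g: "g \<in> L2 \<mu>" and u: "is_cond_exp \<mu> g Y u"
  shows "AE y in \<mu>. u y = real_cond_exp \<mu> (vimage_algebra UNIV Y borel) g y"
proof -
  interpret real_distribution \<mu> by (rule \<mu>)
  let ?F = "vimage_algebra UNIV Y borel"
  have sub: "subalgebra \<mu> ?F"
    unfolding subalgebra_def using Y
    by (auto simp: sets_vimage_algebra2 measurable_def)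
  interpret finite_measure_subalgebra \<mu> ?F
    by unfold_locales (rule sub)
  from u obtain f where f[measurable]: "f \<in> borel_measurable borel"
    and f2: "integrable \<mu> (\<lambda>y. (f (Y y))\<^sup>2)" and uf: "AE y in \<mu>. u y = f (Y y)"
    unfolding is_cond_exp_def by blast
  have [measurable]: "Y \<in> borel_measurable \<mu>" using Y by simp
  have [measurable]: "u \<in> borel_measurable \<mu>" "g \<in> borel_measurable \<mu>"
    using u g unfolding is_cond_exp_def L2_def by auto
  have int_g: "integrable \<mu> g" and int_f: "integrable \<mu> (\<lambda>y. f (Y y))"
    using g f2 unfolding L2_def by (auto intro: square_integrable_imp_integrable)
  have "AE y in \<mu>. real_cond_exp \<mu> ?F g y = f (Y y)"
  proof (rule real_cond_exp_charact)
    fix A assume "A \<in> sets ?F"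
    then obtain B where B[measurable]: "B \<in> sets borel" and A: "A = Y -` B"
      by (auto simp: sets_vimage_algebra2)
    have ind: "integrable \<mu> (\<lambda>y. (indicator B (Y y) :: real)\<^sup>2)"
      by (rule integrable_const_bound[where B = 1]) (auto simp: indicator_def)
    have "(\<integral>y. g y * indicator B (Y y) \<partial>\<mu>) = (\<integral>y. u y * indicator B (Y y) \<partial>\<mu>)"
      using u ind unfolding is_cond_exp_def by (auto simp: borel_measurable_indicator)
    also have "\<dots> = (\<integral>y. f (Y y) * indicator B (Y y) \<partial>\<mu>)"
      by (rule integral_cong_AE) (use uf in auto)
    finally show "(\<integral>y\<in>A. g y \<partial>\<mu>) = (\<integral>y\<in>A. f (Y y) \<partial>\<mu>)"
      by (simp add: A set_lebesgue_integral_def indicator_vimage mult.commute)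
  qed (use int_g int_f in \<open>auto intro!: measurable_compose[OF measurable_vimage_algebra1 f]\<close>)
  with uf show ?thesis by eventually_elim simp
qed

end

theory Submission
  imports Defs
begin

text \<open>
  The flow is given by a formula: \<open>X t\<close> is the metric projection, in \<open>L\<^sup>2(\<rho>\<^sub>0)\<close>, of the free motion
  \<open>y + t * v\<^sub>0 y\<close> onto the closed convex cone of nondecreasing functions. Particles keep their order,
  and the projection averages the free motion over each cluster that has formed.

  The projection is characterised by its variational inequality (\<open>isotonic_projection\<close>). Since
  \<open>X t \<plusminus> \<epsilon> * h (X t)\<close> is nondecreasing for Lipschitz \<open>h\<close> and small \<open>\<epsilon>\<close>, testing with these functions
  shows that \<open>X t\<close> is the conditional expectation of \<open>y + t * v\<^sub>0 y\<close> given \<open>X t\<close>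
  (\<open>isotonic_projection_orthogonal\<close>). Let \<open>V t\<close> be the conditional expectation of \<open>v\<^sub>0\<close> given \<open>X t\<close>.

  The properties (ii) and (iii) are two cases of one principle: adding a nondecreasing function to
  the data adds a nondecreasing function to the projection. For (ii) the function added to
  \<open>y + t * v\<^sub>0 y\<close> is \<open>t * (W - v\<^sub>0)\<close>, where \<open>W\<close> is a primitive of \<open>\<bar>v\<^sub>0'\<bar>\<close>: the sum \<open>y + t * W y\<close> is its own
  projection. For (iii) one divides by the time: \<open>X t / t\<close> is the projection of \<open>y / t + v\<^sub>0 y\<close>, and
  passing from \<open>t\<close> to an earlier time \<open>s\<close> adds the nondecreasing function \<open>(1 / s - 1 / t) * y\<close>. The
  principle has a short combinatorial proof for weighted isotonic regression on a finite set
  (\<open>isotonic_fit_increment_mono\<close>). It passes to the limit because rounding to a finite grid turns the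
  projection into such a regression, and projections are contractions
  (\<open>step_fit_converges\<close>, \<open>step_fit_limit_increment_le\<close>).

  By (iii), particles that have met stay together, so that \<open>X t\<close> is a Borel function of \<open>X s\<close> for
  \<open>s \<le> t\<close>. Hence \<open>V t\<close> is the projection of \<open>V s\<close> onto a smaller space, which gives (i) and
  \<open>\<parallel>V s - V t\<parallel>\<^sup>2 = \<parallel>V s\<parallel>\<^sup>2 - \<parallel>V t\<parallel>\<^sup>2\<close>. Comparing \<open>X s\<close> with its conditional expectation given \<open>X t\<close>, and testing
  the variational inequality for \<open>X t\<close> with \<open>X s\<close>, one finds
  \<open>\<parallel>X t - X s - (t - s) * V t\<parallel> \<le> (t - s) * \<parallel>V s - V t\<parallel>\<close> (\<open>sticky_increment_estimate\<close>). The decreasing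
  function \<open>\<parallel>V t\<parallel>\<^sup>2\<close> is continuous outside a countable set, and at each of its points of continuity
  the right-hand side is \<open>o(t - s)\<close>: there \<open>V t\<close> is the derivative of \<open>X\<close>.

  What remains is the calculus of the absolutely continuous function \<open>v\<^sub>0\<close>. Its variation function
  is absolutely continuous too, so that \<open>v\<^sub>0\<close> is a difference of two nondecreasing absolutely
  continuous functions; their Stieltjes measures have densities by the Radon-Nikodym theorem, and
  these densities are the derivatives almost everywhere
  (\<open>absolutely_continuous_variation_integral\<close>).
\<close>

section \<open>Absolutely continuous functions of one real variable\<close>

text \<open>
  The \<open>\<delta>\<close>-part of absolute continuity for one \<open>\<epsilon> = e\<close>; naming it lets one \<open>d\<close> be carried from a function
  to its variation.
\<close>

definition small_increments :: "(real \<Rightarrow> real) \<Rightarrow> real \<Rightarrow> real \<Rightarrow> bool" where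
  "small_increments v d e \<longleftrightarrow> (\<forall>P. finite P \<longrightarrow> (\<forall>(a, b)\<in>P. a < b) \<longrightarrow>
     disjoint_family_on (\<lambda>(a, b). {a<..<b}) P \<longrightarrow> (\<Sum>(a, b)\<in>P. b - a) < d \<longrightarrow>
     (\<Sum>(a, b)\<in>P. \<bar>v b - v a\<bar>) < e)"

lemma small_incrementsD:
  assumes "small_increments v d e" "finite P" "\<And>a b. (a, b) \<in> P \<Longrightarrow> a < b"
    "disjoint_family_on (\<lambda>(a, b). {a<..<b}) P" "(\<Sum>(a, b)\<in>P. b - a) < d"
  shows "(\<Sum>(a, b)\<in>P. \<bar>v b - v a\<bar>) < e"
  using assms unfolding small_increments_def by blast

lemma absolutely_continuous_on_iff_small_increments:
  "absolutely_continuous_on dist UNIV v \<longleftrightarrow> (\<forall>e>0. \<exists>d>0. small_increments v d e)"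
proof -
  have "(\<Sum>(a, b)\<in>P. dist (v a) (v b)) = (\<Sum>(a, b)\<in>P. \<bar>v b - v a\<bar>)" for P
    by (intro sum.cong) (auto simp: dist_real_def)
  then show ?thesis
    by (simp add: absolutely_continuous_on_def small_increments_def)
qed

lemma absolutely_continuous_onD:
  assumes "absolutely_continuous_on dist UNIV v" "e > 0"
  obtains d where "d > 0" "small_increments v d e"
  using assms unfolding absolutely_continuous_on_iff_small_increments by blast

lemma absolutely_continuous_on_add:
  assumes "absolutely_continuous_on dist UNIV v" "absolutely_continuous_on dist UNIV w"
  shows "absolutely_continuous_on dist UNIV (\<lambda>x. v x + w x :: real)"
  unfolding absolutely_continuous_on_iff_small_increments
proof (intro allI impI)
  fix e :: real assume "e > 0"
  then have e2: "e / 2 > 0" by simp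
  obtain d1 where d1: "d1 > 0" "small_increments v d1 (e / 2)"
    using absolutely_continuous_onD[OF assms(1) e2] by blast
  obtain d2 where d2: "d2 > 0" "small_increments w d2 (e / 2)"
    using absolutely_continuous_onD[OF assms(2) e2] by blast
  have "small_increments (\<lambda>x. v x + w x) (min d1 d2) e"
    unfolding small_increments_def
  proof (intro allI impI)
    fix P :: "(real \<times> real) set"
    assume P: "finite P" "\<forall>(a, b)\<in>P. a < b"
      "disjoint_family_on (\<lambda>(a, b). {a<..<b}) P" "(\<Sum>(a, b)\<in>P. b - a) < min d1 d2"
    have "(\<Sum>(a, b)\<in>P. \<bar>v b + w b - (v a + w a)\<bar>) \<le> (\<Sum>(a, b)\<in>P. \<bar>v b - v a\<bar>) + (\<Sum>(a, b)\<in>P. \<bar>w b - w a\<bar>)"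
      unfolding sum.distrib[symmetric] by (intro sum_mono) auto
    also have "\<dots> < e / 2 + e / 2"
      using P by (intro add_strict_mono small_incrementsD[OF d1(2)] small_incrementsD[OF d2(2)]) auto
    finally show "(\<Sum>(a, b)\<in>P. \<bar>v b + w b - (v a + w a)\<bar>) < e" by simp
  qed
  with d1(1) d2(1) show "\<exists>d>0. small_increments (\<lambda>x. v x + w x) d e"
    by (intro exI[of _ "min d1 d2"]) simp
qed

lemma absolutely_continuous_on_imp_uniform:
  assumes "absolutely_continuous_on dist UNIV (v :: real \<Rightarrow> real)" "e > 0"
  obtains d where "d > 0" "\<And>x y. \<bar>x - y\<bar> < d \<Longrightarrow> \<bar>v x - v y\<bar> < e"
proof -
  obtain d where d: "d > 0" "small_increments v d e"
    using absolutely_continuous_onD[OF assms] by blast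
  have lt: "\<bar>v y - v x\<bar> < e" if "x < y" "y - x < d" for x y
    using small_incrementsD[OF d(2), of "{(x, y)}"] that by (auto simp: disjoint_family_on_def)
  show ?thesis
  proof
    fix x y :: real assume "\<bar>x - y\<bar> < d"
    then show "\<bar>v x - v y\<bar> < e"
      using lt[of x y] lt[of y x] \<open>e > 0\<close> by (cases x y rule: linorder_cases) auto
  qed (rule d(1))
qed

lemma absolutely_continuous_on_imp_continuous:
  assumes "absolutely_continuous_on dist UNIV (v :: real \<Rightarrow> real)"
  shows "continuous_on UNIV v"
  unfolding continuous_on_iff dist_real_def
  using absolutely_continuous_on_imp_uniform[OF assms] by (metis UNIV_I)

text \<open>
  An interval of length less than \<open>d\<close> changes \<open>v\<close> by less than \<open>1\<close>, and \<open>[0, x]\<close> is covered by about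
  \<open>2 * \<bar>x\<bar> / d\<close> intervals of length \<open>d / 2\<close>.
\<close>

lemma absolutely_continuous_on_linear_growth:
  assumes "absolutely_continuous_on dist UNIV (v :: real \<Rightarrow> real)"
  obtains C where "\<And>x. \<bar>v x\<bar> \<le> C * (1 + \<bar>x\<bar>)"
proof -
  obtain d where d: "d > 0" "\<And>x y. \<bar>x - y\<bar> < d \<Longrightarrow> \<bar>v x - v y\<bar> < 1"
    using absolutely_continuous_on_imp_uniform[OF assms, of 1] by auto
  have step: "\<bar>v x - v 0\<bar> \<le> real n" if "\<bar>x\<bar> \<le> real n * (d / 2)" for n x
    using that
  proof (induction n arbitrary: x)
    case (Suc n)
    \<comment> \<open>The last of \<open>Suc n\<close> equal steps from \<open>0\<close> to \<open>x\<close>.\<close>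
    define y where "y = x * (real n / real (Suc n))"
    have xy: "x - y = x / real (Suc n)" by (simp add: y_def field_simps)
    have "\<bar>x\<bar> / real (Suc n) \<le> d / 2"
      using Suc.prems by (simp add: field_simps)
    then have "\<bar>x - y\<bar> \<le> d / 2" unfolding xy abs_divide by simp
    then have "\<bar>x - y\<bar> < d" using d(1) by linarith
    moreover have "\<bar>y\<bar> \<le> real n * (d / 2)"
    proof -
      have "\<bar>y\<bar> = (\<bar>x\<bar> / real (Suc n)) * real n" by (simp add: y_def abs_mult)
      also have "\<dots> \<le> (d / 2) * real n" by (intro mult_right_mono \<open>\<bar>x\<bar> / real (Suc n) \<le> d / 2\<close>) simp
      finally show ?thesis by (simp add: mult.commute)
    qed
    ultimately show ?case using Suc.IH[of y] d(2)[of x y] by simp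
  qed simp
  show ?thesis
  proof
    fix x
    define n where "n = nat \<lceil>\<bar>x\<bar> / (d / 2)\<rceil>"
    have "\<bar>x\<bar> / (d / 2) \<le> real n" unfolding n_def by linarith
    then have "\<bar>x\<bar> \<le> real n * (d / 2)" using d(1) by (simp add: field_simps)
    from step[OF this] have "\<bar>v x\<bar> \<le> \<bar>v 0\<bar> + real n" by simp
    also have "real n \<le> \<bar>x\<bar> / (d / 2) + 1" unfolding n_def using d(1) by (simp add: of_nat_nat)
    also have "\<bar>v 0\<bar> + (\<bar>x\<bar> / (d / 2) + 1) \<le> (\<bar>v 0\<bar> + 1 + 2 / d) * (1 + \<bar>x\<bar>)"
      using d(1) by (simp add: field_simps)
    finally show "\<bar>v x\<bar> \<le> (\<bar>v 0\<bar> + 1 + 2 / d) * (1 + \<bar>x\<bar>)" by simp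
  qed
qed

text \<open>
  Partitions are sampled by nondecreasing sequences rather than by finite sets: such sequences can be
  truncated and concatenated without any bookkeeping of points.
\<close>

definition path_variation :: "(real \<Rightarrow> real) \<Rightarrow> nat \<Rightarrow> (nat \<Rightarrow> real) \<Rightarrow> real" where
  "path_variation v n s = (\<Sum>i<n. \<bar>v (s (Suc i)) - v (s i)\<bar>)"

definition variation :: "(real \<Rightarrow> real) \<Rightarrow> real \<Rightarrow> real \<Rightarrow> real" where
  "variation v a b = Sup {path_variation v n s |n s. mono s \<and> range s \<subseteq> {a..b}}"

text \<open>
  Refining every interval of a disjoint family by a path inside it gives a disjoint family of no
  larger total length, to which the same \<open>d\<close> applies. Constant steps of the paths are dropped, as they
  are no intervals.
\<close>

lemma path_variation_small:
  assumes Q: "finite Q" "\<And>a b. (a, b) \<in> Q \<Longrightarrow> a < b" "disjoint_family_on (\<lambda>(a, b). {a<..<b}) Q"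
      "(\<Sum>(a, b)\<in>Q. b - a) < d"
    and s: "\<And>a b. (a, b) \<in> Q \<Longrightarrow> mono (s (a, b)) \<and> range (s (a, b)) \<subseteq> {a..b}"
    and d: "small_increments v d e"
  shows "(\<Sum>q\<in>Q. path_variation v (n q) (s q)) < e"
proof -
  define I where "I q = {i. i < n q \<and> s q i < s q (Suc i)}" for q
  define \<iota> where "\<iota> = (\<lambda>(q, i). (s q i, s q (Suc i)))"
  define P where "P = \<iota> ` Sigma Q I"
  have ms: "mono (s q)" and rs: "\<And>i. fst q \<le> s q i \<and> s q i \<le> snd q" if "q \<in> Q" for q
    using s[of "fst q" "snd q"] that by (auto simp: image_subset_iff)
  have fin: "finite (Sigma Q I)" using Q(1) by (auto simp: I_def)
  have disj: "{s q i <..< s q (Suc i)} \<inter> {s q' j <..< s q' (Suc j)} = {}"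
    if q: "q \<in> Q" "q' \<in> Q" "(q, i) \<noteq> (q', j)" for q i q' j
  proof (cases "q = q'")
    case True
    then have "i < j \<or> j < i" using q by auto
    then have "s q (Suc i) \<le> s q j \<or> s q (Suc j) \<le> s q i" using ms[OF q(1)] by (auto intro: monoD)
    then show ?thesis using True by auto
  next
    case False
    have "{s q i <..< s q (Suc i)} \<subseteq> {fst q <..< snd q}" "{s q' j <..< s q' (Suc j)} \<subseteq> {fst q' <..< snd q'}"
      using rs[OF q(1), of i] rs[OF q(1), of "Suc i"] rs[OF q(2), of j] rs[OF q(2), of "Suc j"] by auto
    moreover have "{fst q <..< snd q} \<inter> {fst q' <..< snd q'} = {}"
      using Q(3) q False unfolding disjoint_family_on_def case_prod_unfold by blast
    ultimately show ?thesis by blast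
  qed
  have inj: "inj_on \<iota> (Sigma Q I)"
  proof (rule inj_onI)
    fix x y assume xy: "x \<in> Sigma Q I" "y \<in> Sigma Q I" "\<iota> x = \<iota> y"
    obtain q i q' j where e: "x = (q, i)" "y = (q', j)" by (metis surj_pair)
    show "x = y"
    proof (rule ccontr)
      assume "x \<noteq> y"
      then have "{s q i <..< s q (Suc i)} \<inter> {s q' j <..< s q' (Suc j)} = {}"
        using xy e by (intro disj) auto
      then have "{s q i <..< s q (Suc i)} = {}" using xy e by (auto simp: \<iota>_def)
      moreover have "s q i < s q (Suc i)" using xy e by (auto simp: I_def)
      ultimately show False using dense by fastforce
    qed
  qed
  have "(\<Sum>(a, b)\<in>P. \<bar>v b - v a\<bar>) < e"
  proof (rule small_incrementsD[OF d])
    show "finite P" using fin by (simp add: P_def)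
    show "a < b" if "(a, b) \<in> P" for a b using that by (auto simp: P_def \<iota>_def I_def)
    show "disjoint_family_on (\<lambda>(a, b). {a<..<b}) P"
      unfolding disjoint_family_on_def
    proof (intro ballI impI)
      fix x y assume xy: "x \<in> P" "y \<in> P" "x \<noteq> y"
      obtain q i q' j where e: "x = \<iota> (q, i)" "y = \<iota> (q', j)" "q \<in> Q" "q' \<in> Q"
        using xy by (auto simp: P_def)
      then have "(q, i) \<noteq> (q', j)" using xy by auto
      from disj[OF e(3,4) this] show "(case x of (a, b) \<Rightarrow> {a<..<b}) \<inter> (case y of (a, b) \<Rightarrow> {a<..<b}) = {}"
        by (simp add: e \<iota>_def)
    qed
    have "(\<Sum>(a, b)\<in>P. b - a) = (\<Sum>q\<in>Q. \<Sum>i\<in>I q. s q (Suc i) - s q i)"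
      unfolding P_def sum.reindex[OF inj] using Q(1)
      by (subst sum.Sigma) (auto simp: I_def \<iota>_def comp_def case_prod_unfold)
    also have "\<dots> \<le> (\<Sum>q\<in>Q. \<Sum>i<n q. s q (Suc i) - s q i)"
    proof (intro sum_mono sum_mono2)
      fix q i assume "q \<in> Q" then show "0 \<le> s q (Suc i) - s q i" using ms by (simp add: monoD)
    qed (auto simp: I_def)
    also have "\<dots> = (\<Sum>q\<in>Q. s q (n q) - s q 0)" by (simp add: sum_lessThan_telescope)
    also have "\<dots> \<le> (\<Sum>(a, b)\<in>Q. b - a)"
      unfolding case_prod_unfold
      by (intro sum_mono diff_mono) (use rs in auto)
    also have "\<dots> < d" by fact
    finally show "(\<Sum>(a, b)\<in>P. b - a) < d" .
  qed
  also have "(\<Sum>(a, b)\<in>P. \<bar>v b - v a\<bar>) = (\<Sum>q\<in>Q. \<Sum>i\<in>I q. \<bar>v (s q (Suc i)) - v (s q i)\<bar>)"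
    unfolding P_def sum.reindex[OF inj] using Q(1)
    by (subst sum.Sigma) (auto simp: I_def \<iota>_def comp_def case_prod_unfold)
  also have "\<dots> = (\<Sum>q\<in>Q. path_variation v (n q) (s q))"
    unfolding path_variation_def
  proof (rule sum.cong[OF refl])
    fix q assume q: "q \<in> Q"
    have "\<bar>v (s q (Suc i)) - v (s q i)\<bar> = 0" if "i \<in> {..<n q} - I q" for i
    proof -
      have "s q (Suc i) \<le> s q i" using that by (auto simp: I_def)
      then have "s q (Suc i) = s q i" by (rule antisym) (rule monoD[OF ms[OF q]], simp)
      then show ?thesis by simp
    qed
    then show "(\<Sum>i\<in>I q. \<bar>v (s q (Suc i)) - v (s q i)\<bar>) = (\<Sum>i<n q. \<bar>v (s q (Suc i)) - v (s q i)\<bar>)"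
      by (intro sum.mono_neutral_left ballI) (simp_all add: I_def subset_eq)
  qed
  finally show ?thesis .
qed

lemma mono_truncate:
  assumes "mono (s :: nat \<Rightarrow> real)"
  shows "mono (\<lambda>i. min (s i) c)" "mono (\<lambda>i. max (s i) c)"
proof -
  have s: "s i \<le> s j" if "i \<le> j" for i j using assms that by (rule monoD)
  show "mono (\<lambda>i. min (s i) c)" by (rule monoI, rule min.mono[OF s order_refl])
  show "mono (\<lambda>i. max (s i) c)" by (rule monoI, rule max.mono[OF s order_refl])
qed

text \<open>
  Truncating a path at \<open>c\<close> from above and from below inserts \<open>c\<close> into the only step that crosses it.
\<close>

lemma path_variation_split:
  assumes "mono s"
  shows "path_variation v n s
     \<le> path_variation v n (\<lambda>i. min (s i) c) + path_variation v n (\<lambda>i. max (s i) c)"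
  unfolding path_variation_def sum.distrib[symmetric]
proof (rule sum_mono)
  fix i
  have "s i \<le> s (Suc i)" using assms by (simp add: monoD)
  then show "\<bar>v (s (Suc i)) - v (s i)\<bar>
      \<le> \<bar>v (min (s (Suc i)) c) - v (min (s i) c)\<bar> + \<bar>v (max (s (Suc i)) c) - v (max (s i) c)\<bar>"
    by (cases "s (Suc i) \<le> c"; cases "c \<le> s i") (auto simp: min_def max_def)
qed

text \<open>
  Induction on the number of intervals of length \<open>d / 2\<close> that are needed to cover \<open>[a, b]\<close>.
\<close>

lemma path_variation_bounded:
  assumes "absolutely_continuous_on dist UNIV v"
  shows "bdd_above {path_variation v n s |n s. mono s \<and> range s \<subseteq> {a..b}}"
proof -
  obtain d where d: "d > 0" "small_increments v d 1"
    using absolutely_continuous_onD[OF assms, of 1] by auto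
  have short: "path_variation v n s \<le> 1" if "mono s" "range s \<subseteq> {a..a + d / 2}" for n s a
    using path_variation_small[of "{(a, a + d / 2)}" d "\<lambda>_. s" v 1 "\<lambda>_. n"] d that
    by (auto simp: disjoint_family_on_def)
  have "path_variation v n s \<le> real k" if "mono s" "range s \<subseteq> {a..a + real k * (d / 2)}" for k n s a
    using that
  proof (induction k arbitrary: a s)
    case 0
    then have "s i = a" for i by (auto simp: image_subset_iff)
    then show ?case by (simp add: path_variation_def)
  next
    case (Suc k)
    let ?c = "a + d / 2"
    have "path_variation v n (\<lambda>i. min (s i) ?c) \<le> 1"
      by (rule short[where a = a])
         (use Suc.prems d(1) in \<open>auto simp: image_subset_iff mono_truncate\<close>)
    moreover have "path_variation v n (\<lambda>i. max (s i) ?c) \<le> real k"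
    proof (rule Suc.IH)
      show "mono (\<lambda>i. max (s i) ?c)" using Suc.prems(1) by (rule mono_truncate)
      have "s i \<le> ?c + real k * (d / 2)" for i
      proof -
        have "s i \<in> {a..a + real (Suc k) * (d / 2)}" using Suc.prems(2) by blast
        then have "s i \<le> a + real (Suc k) * (d / 2)" by simp
        also have "\<dots> = ?c + real k * (d / 2)" by (simp add: algebra_simps add_divide_distrib)
        finally show ?thesis .
      qed
      then show "range (\<lambda>i. max (s i) ?c) \<subseteq> {?c..?c + real k * (d / 2)}"
        using d(1) by auto
    qed
    ultimately show ?case using path_variation_split[OF Suc.prems(1), of v n ?c] by simp
  qed
  moreover obtain k :: nat where k: "(b - a) / (d / 2) \<le> real k" using real_arch_simple by blast
  then have "b \<le> a + real k * (d / 2)" using d(1) by (simp add: field_simps)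
  then have "{a..b} \<subseteq> {a..a + real k * (d / 2)}" by auto
  ultimately show ?thesis by (intro bdd_aboveI[of _ "real k"]) blast
qed

lemma variation_upper:
  assumes "absolutely_continuous_on dist UNIV v" "mono s" "range s \<subseteq> {a..b}"
  shows "path_variation v n s \<le> variation v a b"
  unfolding variation_def by (intro cSup_upper path_variation_bounded assms) (use assms in blast)

lemma variation_least:
  assumes "a \<le> b" "\<And>n s. mono s \<Longrightarrow> range s \<subseteq> {a..b} \<Longrightarrow> path_variation v n s \<le> c"
  shows "variation v a b \<le> c"
proof -
  have "path_variation v 0 (\<lambda>_. a) \<in> {path_variation v n s |n s. mono s \<and> range s \<subseteq> {a..b}}"
    using assms(1) by (intro CollectI exI conjI refl) (auto simp: mono_def)
  then show ?thesis
    unfolding variation_def using assms(2) by (intro cSup_least) auto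
qed

lemma abs_diff_le_variation:
  assumes "absolutely_continuous_on dist UNIV v" "a \<le> b"
  shows "\<bar>v b - v a\<bar> \<le> variation v a b"
proof -
  have "path_variation v 1 (\<lambda>i. if i = 0 then a else b) \<le> variation v a b"
    by (rule variation_upper[OF assms(1)]) (use assms(2) in \<open>auto simp: mono_def\<close>)
  then show ?thesis by (simp add: path_variation_def)
qed

text \<open>
  Truncation gives \<open>\<le>\<close>; for \<open>\<ge>\<close> two paths are joined, where the extra step between them can only
  increase the variation.
\<close>

lemma variation_additive:
  assumes v: "absolutely_continuous_on dist UNIV v" and abc: "a \<le> b" "b \<le> c"
  shows "variation v a c = variation v a b + variation v b c"
proof (rule antisym)
  show "variation v a c \<le> variation v a b + variation v b c"
  proof (rule variation_least)
    fix n s assume s: "mono (s :: nat \<Rightarrow> real)" "range s \<subseteq> {a..c}"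
    have sb: "a \<le> s i" "s i \<le> c" for i using subsetD[OF s(2) rangeI[of s i]] by simp_all
    have "path_variation v n (\<lambda>i. min (s i) b) \<le> variation v a b"
      by (rule variation_upper[OF v mono_truncate(1)[OF s(1)]]) (simp add: image_subset_iff sb(1) abc)
    moreover have "path_variation v n (\<lambda>i. max (s i) b) \<le> variation v b c"
      by (rule variation_upper[OF v mono_truncate(2)[OF s(1)]]) (simp add: image_subset_iff sb(2) abc)
    ultimately show "path_variation v n s \<le> variation v a b + variation v b c"
      using path_variation_split[OF s(1), of v n b] by simp
  qed (use abc in simp)
next
  have cat: "path_variation v n s + path_variation v m r \<le> variation v a c"
    if s: "mono s" "range s \<subseteq> {a..b}" and r: "mono r" "range r \<subseteq> {b..c}" for n m s r
  proof -
    have sb: "a \<le> s i" "s i \<le> b" "b \<le> r i" "r i \<le> c" for i using s(2) r(2) by (auto simp: image_subset_iff)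
    define q where "q i = (if i \<le> n then s i else r (i - Suc n))" for i
    have "mono q"
    proof (rule monoI)
      fix i j :: nat assume ij: "i \<le> j"
      show "q i \<le> q j"
      proof (cases "i \<le> n \<and> \<not> j \<le> n")
        case True
        then show ?thesis using sb(2)[of i] sb(3)[of "j - Suc n"] by (simp add: q_def)
      next
        case False
        then consider "i \<le> n" "j \<le> n" | "\<not> i \<le> n" "\<not> j \<le> n" using ij by linarith
        then show ?thesis
        proof cases
          case 1
          then show ?thesis using monoD[OF s(1) ij] by (simp only: q_def if_True)
        next
          case 2
          then show ?thesis using monoD[OF r(1) diff_le_mono[OF ij]] by (simp only: q_def if_False)
        qed
      qed
    qed
    moreover have "range q \<subseteq> {a..c}"
    proof -
      have "a \<le> q i \<and> q i \<le> c" for i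
        using sb(1)[of i] sb(2)[of i] sb(3)[of "i - Suc n"] sb(4)[of "i - Suc n"] abc by (auto simp: q_def)
      then show ?thesis by auto
    qed
    ultimately have "path_variation v (n + Suc m) q \<le> variation v a c"
      by (rule variation_upper[OF v])
    moreover have "path_variation v (n + Suc m) q
       = path_variation v n s + \<bar>v (q (Suc n)) - v (q n)\<bar> + path_variation v m r"
    proof -
      have split: "{..<n + Suc m} = {..<n} \<union> {n..<n + Suc m}" by auto
      have "path_variation v (n + Suc m) q
         = (\<Sum>i<n. \<bar>v (q (Suc i)) - v (q i)\<bar>) + (\<Sum>i\<in>{n..<n + Suc m}. \<bar>v (q (Suc i)) - v (q i)\<bar>)"
        unfolding path_variation_def split by (rule sum.union_disjoint) auto
      also have "(\<Sum>i<n. \<bar>v (q (Suc i)) - v (q i)\<bar>) = path_variation v n s"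
        unfolding path_variation_def by (intro sum.cong) (auto simp: q_def)
      also have "(\<Sum>i\<in>{n..<n + Suc m}. \<bar>v (q (Suc i)) - v (q i)\<bar>)
          = \<bar>v (q (Suc n)) - v (q n)\<bar> + (\<Sum>i\<in>{Suc n..<n + Suc m}. \<bar>v (q (Suc i)) - v (q i)\<bar>)"
        by (rule sum.atLeast_Suc_lessThan) simp
      also have "(\<Sum>i\<in>{Suc n..<n + Suc m}. \<bar>v (q (Suc i)) - v (q i)\<bar>) = path_variation v m r"
      proof -
        have "(\<Sum>i\<in>{Suc n..<n + Suc m}. \<bar>v (q (Suc i)) - v (q i)\<bar>)
            = (\<Sum>i\<in>{0..<m}. \<bar>v (q (Suc (i + Suc n))) - v (q (i + Suc n))\<bar>)"
          using sum.shift_bounds_nat_ivl[of "\<lambda>i. \<bar>v (q (Suc i)) - v (q i)\<bar>" 0 "Suc n" m]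
          by (simp add: add.commute)
        also have "\<dots> = (\<Sum>i<m. \<bar>v (r (Suc i)) - v (r i)\<bar>)"
          by (rule sum.cong) (simp_all add: q_def atLeast0LessThan)
        finally show ?thesis by (simp only: path_variation_def)
      qed
      finally show ?thesis by simp
    qed
    ultimately show ?thesis by simp
  qed
  have "variation v a b \<le> variation v a c - variation v b c"
  proof (rule variation_least[OF abc(1)])
    fix n s assume s: "mono (s :: nat \<Rightarrow> real)" "range s \<subseteq> {a..b}"
    have "variation v b c \<le> variation v a c - path_variation v n s"
    proof (rule variation_least[OF abc(2)])
      fix m r assume "mono (r :: nat \<Rightarrow> real)" "range r \<subseteq> {b..c}"
      from cat[OF s this, of n m] show "path_variation v m r \<le> variation v a c - path_variation v n s" by simp
    qed
    then show "path_variation v n s \<le> variation v a c - variation v b c" by simp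
  qed
  then show "variation v a b + variation v b c \<le> variation v a c" by simp
qed

text \<open>
  The supremum defining each variation is approached up to \<open>\<theta>\<close>, with \<open>\<theta> * card Q \<le> \<eta>\<close>, so that the
  error over the whole family stays below \<open>\<eta>\<close>.
\<close>

lemma variation_sum_le:
  assumes v: "absolutely_continuous_on dist UNIV v"
    and Q: "finite Q" "\<And>a b. (a, b) \<in> Q \<Longrightarrow> a < b" "disjoint_family_on (\<lambda>(a, b). {a<..<b}) Q"
      "(\<Sum>(a, b)\<in>Q. b - a) < d"
    and d: "small_increments v d e"
  shows "(\<Sum>(a, b)\<in>Q. variation v a b) \<le> e"
proof (rule field_le_epsilon)
  fix \<eta> :: real assume "\<eta> > 0"
  define \<theta> where "\<theta> = \<eta> / (real (card Q) + 1)"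
  have "\<theta> > 0" using \<open>\<eta> > 0\<close> by (simp add: \<theta>_def add_pos_nonneg)
  have "\<forall>q\<in>Q. \<exists>ns. mono (snd ns) \<and> range (snd ns) \<subseteq> {fst q..snd q}
      \<and> variation v (fst q) (snd q) - \<theta> < path_variation v (fst ns) (snd ns)"
  proof
    fix q assume "q \<in> Q"
    then have "fst q \<le> snd q" using Q(2)[of "fst q" "snd q"] by simp
    have "\<not> variation v (fst q) (snd q) \<le> variation v (fst q) (snd q) - \<theta>" using \<open>\<theta> > 0\<close> by simp
    then have "\<not> (\<forall>n s. mono s \<longrightarrow> range s \<subseteq> {fst q..snd q} \<longrightarrow> path_variation v n s \<le> variation v (fst q) (snd q) - \<theta>)"
      using variation_least[OF \<open>fst q \<le> snd q\<close>, of v "variation v (fst q) (snd q) - \<theta>"] by blast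
    then obtain n s where "mono s" "range s \<subseteq> {fst q..snd q}"
      "variation v (fst q) (snd q) - \<theta> < path_variation v n s"
      by (auto simp: not_le)
    then show "\<exists>ns. mono (snd ns) \<and> range (snd ns) \<subseteq> {fst q..snd q}
      \<and> variation v (fst q) (snd q) - \<theta> < path_variation v (fst ns) (snd ns)"
      by (intro exI[of _ "(n, s)"]) simp
  qed
  then obtain ns where ns: "\<And>q. q \<in> Q \<Longrightarrow> mono (snd (ns q)) \<and> range (snd (ns q)) \<subseteq> {fst q..snd q}
      \<and> variation v (fst q) (snd q) - \<theta> < path_variation v (fst (ns q)) (snd (ns q))"
    by metis
  have "(\<Sum>q\<in>Q. path_variation v (fst (ns q)) (snd (ns q))) < e"
    by (rule path_variation_small[OF Q _ d]) (use ns in fastforce)+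
  moreover have "(\<Sum>q\<in>Q. variation v (fst q) (snd q)) - real (card Q) * \<theta>
     \<le> (\<Sum>q\<in>Q. path_variation v (fst (ns q)) (snd (ns q)))"
  proof -
    have "(\<Sum>q\<in>Q. variation v (fst q) (snd q)) - real (card Q) * \<theta> = (\<Sum>q\<in>Q. variation v (fst q) (snd q) - \<theta>)"
      by (simp add: sum_subtractf)
    also have "\<dots> \<le> (\<Sum>q\<in>Q. path_variation v (fst (ns q)) (snd (ns q)))"
      using ns by (intro sum_mono) (auto intro: less_imp_le)
    finally show ?thesis .
  qed
  moreover have "real (card Q) * \<theta> \<le> \<eta>" using \<open>\<eta> > 0\<close> by (simp add: \<theta>_def field_simps)
  ultimately show "(\<Sum>(a, b)\<in>Q. variation v a b) \<le> e + \<eta>" by (simp add: case_prod_unfold)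
qed

text \<open>
  The signed variation from the origin serves as \<open>T\<close>; additivity turns its increments into
  variations.
\<close>

lemma absolutely_continuous_variation_function:
  assumes v: "absolutely_continuous_on dist UNIV (v :: real \<Rightarrow> real)"
  obtains T where "absolutely_continuous_on dist UNIV T" "\<And>x y. x \<le> y \<Longrightarrow> \<bar>v y - v x\<bar> \<le> T y - T x"
proof
  define T where "T x = (if 0 \<le> x then variation v 0 x else - variation v x 0)" for x
  have T: "T y - T x = variation v x y" if "x \<le> y" for x y
    using variation_additive[OF v, of 0 x y] variation_additive[OF v, of x 0 y]
      variation_additive[OF v, of x y 0] that by (auto simp: T_def)
  show inc: "\<bar>v y - v x\<bar> \<le> T y - T x" if "x \<le> y" for x y
    using T[OF that] abs_diff_le_variation[OF v that] by simp
  show "absolutely_continuous_on dist UNIV T"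
    unfolding absolutely_continuous_on_iff_small_increments
  proof (intro allI impI)
    fix e :: real assume "e > 0"
    obtain d where d: "d > 0" "small_increments v d (e / 2)"
      using absolutely_continuous_onD[OF v, of "e / 2"] \<open>e > 0\<close> by auto
    have "small_increments T d e"
      unfolding small_increments_def
    proof (intro allI impI)
      fix P :: "(real \<times> real) set"
      assume P: "finite P" "\<forall>(a, b)\<in>P. a < b"
        "disjoint_family_on (\<lambda>(a, b). {a<..<b}) P" "(\<Sum>(a, b)\<in>P. b - a) < d"
      have "(\<Sum>(a, b)\<in>P. \<bar>T b - T a\<bar>) = (\<Sum>(a, b)\<in>P. variation v a b)"
      proof (intro sum.cong refl, clarify)
        fix a b assume "(a, b) \<in> P"
        then have "a \<le> b" using P(2) by auto
        then show "\<bar>T b - T a\<bar> = variation v a b" using T[of a b] inc[of a b] by simp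
      qed
      also have "\<dots> \<le> e / 2" by (rule variation_sum_le[OF v _ _ _ _ d(2)]) (use P in auto)
      also have "\<dots> < e" using \<open>e > 0\<close> by simp
      finally show "(\<Sum>(a, b)\<in>P. \<bar>T b - T a\<bar>) < e" .
    qed
    with d(1) show "\<exists>d>0. small_increments T d e" by blast
  qed
qed

text \<open>
  A gauge that assigns the open set to each of its points makes the covering lemma produce
  intervals inside that set.
\<close>

lemma open_cover_intervals:
  assumes N: "(N :: real set) \<subseteq> O'" and O': "open O'" and bd: "N \<subseteq> {-r<..<r}"
  obtains D :: "(real \<times> real) set" where "countable D" "\<And>a b. (a, b) \<in> D \<Longrightarrow> a < b"
    "disjoint_family_on (\<lambda>(a, b). {a<..<b}) D" "\<And>a b. (a, b) \<in> D \<Longrightarrow> {a<..<b} \<subseteq> O'"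
    "N \<subseteq> (\<Union>(a, b)\<in>D. {a..b})"
proof (cases "r > 0")
  case False
  then have "N = {}" using bd by auto
  then show ?thesis using that[of "{}"] by (auto simp: disjoint_family_on_def)
next
  case True
  define g where "g x = (if x \<in> O' then O' else UNIV)" for x
  have "gauge g" using O' by (auto simp: gauge_def g_def)
  have cb: "N \<subseteq> cbox (-r) r" using bd by auto
  have bx: "box (-r) r \<noteq> {}" using True by simp
  obtain \<D> where \<D>: "countable \<D>"
    "\<And>K. K \<in> \<D> \<Longrightarrow> interior K \<noteq> {} \<and> (\<exists>c d. K = cbox c d)"
    "pairwise (\<lambda>A B. interior A \<inter> interior B = {}) \<D>"
    "\<And>K. K \<in> \<D> \<Longrightarrow> \<exists>x \<in> N \<inter> K. K \<subseteq> g x" "N \<subseteq> \<Union>\<D>"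
    by (rule covering_lemma[OF cb bx \<open>gauge g\<close>]) blast
  define D where "D = (\<lambda>K. (Inf K, Sup K)) ` \<D>"
  have K: "Inf K < Sup K \<and> K = {Inf K..Sup K} \<and> interior K = {Inf K<..<Sup K} \<and> K \<subseteq> O'" if KD: "K \<in> \<D>" for K
  proof -
    obtain c d where cd: "K = {c..d}" "c < d" using \<D>(2)[OF KD] by auto
    moreover have "K \<subseteq> O'"
    proof -
      obtain x where "x \<in> N" "K \<subseteq> g x" using \<D>(4)[OF KD] by blast
      moreover from this(1) have "x \<in> O'" using N by blast
      ultimately show ?thesis by (simp add: g_def)
    qed
    ultimately show ?thesis by simp
  qed
  show ?thesis
  proof
    show "countable D" unfolding D_def using \<D>(1) by (rule countable_image)
    show "a < b" if "(a, b) \<in> D" for a b using that K by (auto simp: D_def)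
    show "{a<..<b} \<subseteq> O'" if "(a, b) \<in> D" for a b
      using that K by (force simp: D_def)
    show "disjoint_family_on (\<lambda>(a, b). {a<..<b}) D"
      unfolding disjoint_family_on_def
    proof (intro ballI impI)
      fix x y assume xy: "x \<in> D" "y \<in> D" "x \<noteq> y"
      then obtain A B where AB: "A \<in> \<D>" "B \<in> \<D>" "x = (Inf A, Sup A)" "y = (Inf B, Sup B)"
        by (auto simp: D_def)
      with xy have "A \<noteq> B" by auto
      then have "interior A \<inter> interior B = {}" using \<D>(3) AB by (auto simp: pairwise_def)
      then show "(case x of (a, b) \<Rightarrow> {a<..<b}) \<inter> (case y of (a, b) \<Rightarrow> {a<..<b}) = {}"
        using K AB by simp
    qed
    show "N \<subseteq> (\<Union>(a, b)\<in>D. {a..b})"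
    proof
      fix x assume "x \<in> N"
      then obtain A where A: "A \<in> \<D>" "x \<in> A" using \<D>(5) by blast
      then have "x \<in> {Inf A..Sup A}" using K by blast
      then show "x \<in> (\<Union>(a, b)\<in>D. {a..b})" using A by (force simp: D_def)
    qed
  qed
qed

text \<open>
  A null set lies in an open set of small length, hence is covered by nonoverlapping intervals of small
  total length, on which \<open>F\<close> increases little. The hypothesis on \<open>d\<close> concerns finite families, so the
  countable cover is exhausted by finite ones.
\<close>

lemma monotone_AC_measure_null:
  assumes F: "absolutely_continuous_on dist UNIV F" "mono (F :: real \<Rightarrow> real)"
    and N: "N \<in> null_sets lborel" "N \<subseteq> {-r<..<r}"
  shows "emeasure (interval_measure F) N = 0"
proof -
  have contF: "continuous_on UNIV F" by (rule absolutely_continuous_on_imp_continuous[OF F(1)])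
  let ?\<nu> = "interval_measure F"
  have Icc: "emeasure ?\<nu> {a..b} = ennreal (F b - F a)" if "a < b" for a b
    using emeasure_interval_measure_Icc[of a b F] that F(2) contF by (simp add: monoD)
  have le_e: "emeasure ?\<nu> N \<le> ennreal e" if e: "e > 0" for e
  proof -
    obtain d where d: "d > 0" "small_increments F d e"
      using absolutely_continuous_onD[OF F(1) e] by blast
    have Nb: "N \<in> sets borel" using N(1) by auto
    obtain U where U: "open U" "N \<subseteq> U" "emeasure lborel (U - N) < ennreal d"
      using outer_regular_lborel[OF Nb d(1)] by blast
    have "emeasure lborel U \<le> emeasure lborel (U - N) + emeasure lborel N"
      using emeasure_subadditive[of "U - N" lborel N] U Nb by (simp add: Un_absorb2)
    then have Ud: "emeasure lborel U < ennreal d" using U(3) N(1) by (simp add: null_sets_def)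
    obtain D where D: "countable D" "\<And>a b. (a, b) \<in> D \<Longrightarrow> a < b"
      "disjoint_family_on (\<lambda>(a, b). {a<..<b}) D" "\<And>a b. (a, b) \<in> D \<Longrightarrow> {a<..<b} \<subseteq> U"
      "N \<subseteq> (\<Union>(a, b)\<in>D. {a..b})"
      using open_cover_intervals[OF U(2,1) N(2)] by blast
    have fin: "emeasure ?\<nu> (\<Union>(a, b)\<in>Q. {a..b}) \<le> ennreal e" if Q: "Q \<subseteq> D" "finite Q" for Q
    proof -
      have dQ: "disjoint_family_on (\<lambda>(a, b). {a<..<b}) Q"
        by (rule disjoint_family_on_mono[OF Q(1) D(3)])
      have "ennreal (\<Sum>(a, b)\<in>Q. b - a) = (\<Sum>(a, b)\<in>Q. emeasure lborel {a<..<b})"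
        unfolding case_prod_unfold using D(2) Q(1)
        by (subst sum_ennreal[symmetric]) (fastforce intro!: sum.cong simp: less_imp_le)+
      also have "\<dots> = emeasure lborel (\<Union>(a, b)\<in>Q. {a<..<b})"
        using sum_emeasure[OF _ dQ Q(2), of lborel] by (simp add: case_prod_unfold image_subset_iff)
      also have "\<dots> \<le> emeasure lborel U"
        using D(4) Q(1) U(1) by (intro emeasure_mono) auto
      also have "\<dots> < ennreal d" by (rule Ud)
      finally have "(\<Sum>(a, b)\<in>Q. b - a) < d" using d(1) by (metis ennreal_leI not_le)
      then have sm: "(\<Sum>(a, b)\<in>Q. \<bar>F b - F a\<bar>) < e" using small_incrementsD[OF d(2) Q(2) _ dQ] D(2) Q(1) by blast
      have "emeasure ?\<nu> (\<Union>(a, b)\<in>Q. {a..b}) \<le> (\<Sum>(a, b)\<in>Q. emeasure ?\<nu> {a..b})"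
        using emeasure_subadditive_finite[OF Q(2), of "\<lambda>(a, b). {a..b}" ?\<nu>]
        by (simp add: case_prod_unfold image_subset_iff)
      also have "\<dots> = (\<Sum>(a, b)\<in>Q. ennreal \<bar>F b - F a\<bar>)"
        unfolding case_prod_unfold
      proof (rule sum.cong[OF refl])
        fix q assume "q \<in> Q"
        then have "fst q < snd q" using D(2)[of "fst q" "snd q"] Q(1) by auto
        then show "emeasure ?\<nu> {fst q..snd q} = ennreal \<bar>F (snd q) - F (fst q)\<bar>"
          using Icc monoD[OF F(2), of "fst q" "snd q"] by simp
      qed
      also have "\<dots> = ennreal (\<Sum>(a, b)\<in>Q. \<bar>F b - F a\<bar>)"
        unfolding case_prod_unfold by simp
      also have "\<dots> \<le> ennreal e" using sm by (intro ennreal_leI) simp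
      finally show ?thesis .
    qed
    show ?thesis
    proof (cases "D = {}")
      case True then show ?thesis using D(5) by simp
    next
      case False
      define A where "A n = (\<Union>(a, b)\<in>from_nat_into D ` {..<n}. {a..b})" for n
      have mA: "range A \<subseteq> sets ?\<nu>" unfolding A_def case_prod_unfold by auto
      have "incseq A"
      proof (rule monoI)
        fix m n :: nat assume "m \<le> n"
        then have "from_nat_into D ` {..<m} \<subseteq> from_nat_into D ` {..<n}" by auto
        then show "A m \<subseteq> A n" unfolding A_def by (rule UN_mono) auto
      qed
      have UA: "(\<Union>(a, b)\<in>D. {a..b}) \<subseteq> (\<Union>n. A n)"
      proof clarify
        fix x a b assume ab: "(a, b) \<in> D" "x \<in> {a..b}"
        then obtain n where n: "from_nat_into D n = (a, b)" using from_nat_into_surj[OF D(1) ab(1)] by blast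
        have "(a, b) \<in> from_nat_into D ` {..<Suc n}" using n by (intro image_eqI[of _ _ n]) auto
        then have "x \<in> A (Suc n)" unfolding A_def by (rule UN_I) (use ab(2) in simp)
        then show "x \<in> (\<Union>n. A n)" by blast
      qed
      have "emeasure ?\<nu> N \<le> emeasure ?\<nu> (\<Union>n. A n)"
        using D(5) UA mA by (intro emeasure_mono sets.countable_UN) auto
      also have "\<dots> = (SUP n. emeasure ?\<nu> (A n))"
        using SUP_emeasure_incseq[OF mA \<open>incseq A\<close>] by simp
      also have "\<dots> \<le> ennreal e"
      proof (rule SUP_least)
        fix n
        have "from_nat_into D ` {..<n} \<subseteq> D" using from_nat_into[OF False] by blast
        then show "emeasure ?\<nu> (A n) \<le> ennreal e" unfolding A_def by (rule fin) simp
      qed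
      finally show ?thesis .
    qed
  qed
  have "emeasure ?\<nu> N \<le> 0"
    by (rule ennreal_le_epsilon) (simp add: le_e)
  then show ?thesis by simp
qed

text \<open>
  The Radon-Nikodym density of the Stieltjes measure of \<open>F\<close>. It is finite almost everywhere because
  the measure of each bounded interval is finite.
\<close>

lemma monotone_AC_density:
  assumes F: "absolutely_continuous_on dist UNIV F" "mono (F :: real \<Rightarrow> real)"
  obtains g where "\<And>x. 0 \<le> g x" "\<And>a b. a \<le> b \<Longrightarrow> (g has_integral F b - F a) {a..b}"
proof -
  have contF: "continuous_on UNIV F" by (rule absolutely_continuous_on_imp_continuous[OF F(1)])
  let ?\<nu> = "interval_measure F"
  have "absolutely_continuous lborel ?\<nu>"
    unfolding absolutely_continuous_def
  proof
    fix N :: "real set" assume N: "N \<in> null_sets lborel"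
    have Nb: "N \<in> sets borel" using N by auto
    have "N \<inter> {- real n<..<real n} \<in> null_sets ?\<nu>" for n :: nat
    proof (rule null_setsI)
      have "N \<inter> {- real n<..<real n} \<in> null_sets lborel"
        by (rule null_set_Int2[OF N]) simp
      then show "emeasure ?\<nu> (N \<inter> {- real n<..<real n}) = 0"
        by (rule monotone_AC_measure_null[OF F, where r = "real n"]) auto
    qed (use Nb in auto)
    then have "(\<Union>n. N \<inter> {- real n<..<real n}) \<in> null_sets ?\<nu>" by (rule null_sets_UN)
    also have "(\<Union>n. N \<inter> {- real n<..<real n}) = N"
    proof -
      have "\<exists>n. x \<in> {- real n<..<real n}" for x
      proof -
        obtain n where "\<bar>x\<bar> < real n" using reals_Archimedean2 by blast
        then show ?thesis by (intro exI[of _ n]) (simp add: abs_less_iff)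
      qed
      then show ?thesis by fastforce
    qed
    finally show "N \<in> null_sets ?\<nu>" .
  qed
  from sigma_finite_measure.Radon_Nikodym[OF sigma_finite_lborel this] obtain f where
    f[measurable]: "f \<in> borel_measurable borel" and dens: "density lborel f = ?\<nu>" by auto
  have Icc: "(\<integral>\<^sup>+x. f x * indicator {a..b} x \<partial>lborel) = ennreal (F b - F a)" if "a \<le> b" for a b
    using emeasure_interval_measure_Icc[of a b F] that F(2) contF emeasure_density[of f lborel "{a..b}"]
    by (simp add: dens monoD)
  have fin: "AE x in lborel. f x \<noteq> \<infinity>"
  proof -
    have "AE x in lborel. f x * indicator {- real n..real n} x \<noteq> \<infinity>" for n :: nat
      by (rule nn_integral_PInf_AE) (use Icc[of "- real n" "real n"] in auto)
    then have "AE x in lborel. \<forall>n::nat. f x * indicator {- real n..real n} x \<noteq> \<infinity>"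
      by (simp add: AE_all_countable)
    then show ?thesis
    proof eventually_elim
      fix x assume x: "\<forall>n::nat. f x * indicator {- real n..real n} x \<noteq> \<infinity>"
      obtain n :: nat where "\<bar>x\<bar> \<le> real n" using real_arch_simple by blast
      then show "f x \<noteq> \<infinity>" using x[rule_format, of n] by (auto simp: abs_le_iff indicator_def split: if_splits)
    qed
  qed
  define g where "g x = enn2real (f x)" for x
  have [measurable]: "g \<in> borel_measurable borel" unfolding g_def by measurable
  show ?thesis
  proof
    show "0 \<le> g x" for x by (simp add: g_def)
    fix a b :: real assume ab: "a \<le> b"
    have "(\<integral>\<^sup>+x. ennreal (g x * indicator {a..b} x) \<partial>lborel) = (\<integral>\<^sup>+x. f x * indicator {a..b} x \<partial>lborel)"
      by (rule nn_integral_cong_AE, use fin in eventually_elim)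
         (auto simp: g_def indicator_def less_top[symmetric] ennreal_enn2real)
    also have "\<dots> = ennreal (F b - F a)" by (rule Icc[OF ab])
    finally have "((\<lambda>x. g x * indicator {a..b} x) has_integral F b - F a) UNIV"
      using monoD[OF F(2) ab] by (intro nn_integral_has_integral) (auto simp: g_def)
    also have "(\<lambda>x. g x * indicator {a..b} x) = (\<lambda>x. if x \<in> {a..b} then g x else 0)"
      by (auto simp: indicator_def)
    finally show "(g has_integral F b - F a) {a..b}" by (simp only: has_integral_restrict_UNIV)
  qed
qed

lemma AE_right_derivative_of_integral:
  fixes F g :: "real \<Rightarrow> real"
  assumes g: "\<And>a b. a \<le> b \<Longrightarrow> (g has_integral F b - F a) {a..b}"
  obtains N where "negligible N" "\<And>x. x \<notin> N \<Longrightarrow> ((\<lambda>h. (F (x + h) - F x) / h) \<longlongrightarrow> g x) (at_right 0)"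
proof -
  have "g integrable_on cbox a b" for a b
    using g[of a b] by (cases "a \<le> b") (auto simp: integrable_on_def)
  from integrable_ccontinuous_explicit[OF this]
  obtain N where N: "negligible N"
    "\<And>x e. \<lbrakk>x \<notin> N; 0 < e\<rbrakk> \<Longrightarrow> \<exists>d>0. \<forall>h. 0 < h \<and> h < d \<longrightarrow>
       norm (integral (cbox x (x + h *\<^sub>R One)) g /\<^sub>R h ^ DIM(real) - g x) < e" by blast
  show ?thesis
  proof
    fix x assume x: "x \<notin> N"
    show "((\<lambda>h. (F (x + h) - F x) / h) \<longlongrightarrow> g x) (at_right 0)"
    proof (rule tendstoI)
      fix e :: real assume "e > 0"
      from N(2)[OF x this] obtain d where d: "d > 0" "\<And>h. 0 < h \<Longrightarrow> h < d \<Longrightarrow>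
         norm (integral (cbox x (x + h *\<^sub>R One)) g /\<^sub>R h ^ DIM(real) - g x) < e" by blast
      have "dist ((F (x + h) - F x) / h) (g x) < e" if h: "0 < h" "h < d" for h
        using d(2)[OF h] integral_unique[OF g[of x "x + h"]] h
        by (simp add: dist_real_def divide_inverse mult.commute)
      then show "\<forall>\<^sub>F h in at_right 0. dist ((F (x + h) - F x) / h) (g x) < e"
        using d(1) by (auto simp: eventually_at_right_field)
    qed
  qed (rule N(1))
qed

text \<open>
  Right derivatives exist almost everywhere by Lebesgue differentiation over intervals
  \<open>[x, x + h]\<close>; reflecting the line turns them into left derivatives.
\<close>

lemma AE_derivative_of_integral:
  fixes F g :: "real \<Rightarrow> real"
  assumes g: "\<And>a b. a \<le> b \<Longrightarrow> (g has_integral F b - F a) {a..b}"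
  obtains N where "negligible N" "\<And>x. x \<notin> N \<Longrightarrow> (F has_real_derivative g x) (at x)"
proof -
  obtain N1 where N1: "negligible N1" "\<And>x. x \<notin> N1 \<Longrightarrow> ((\<lambda>h. (F (x + h) - F x) / h) \<longlongrightarrow> g x) (at_right 0)"
    using AE_right_derivative_of_integral[OF g] by blast
  have "((\<lambda>x. g (- x)) has_integral (- F (- b)) - (- F (- a))) {a..b}" if "a \<le> b" for a b
    using has_integral_reflect_lemma_real[OF g[of "-b" "-a"]] that by simp
  from AE_right_derivative_of_integral[OF this]
  obtain N2 where N2: "negligible N2"
    "\<And>x. x \<notin> N2 \<Longrightarrow> ((\<lambda>h. (- F (- (x + h)) - - F (- x)) / h) \<longlongrightarrow> g (- x)) (at_right 0)" by blast
  show ?thesis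
  proof
    have "negligible (uminus ` N2)"
      by (rule negligible_differentiable_image_negligible[OF _ N2(1)])
         (auto intro!: derivative_intros simp: differentiable_on_def)
    then show "negligible (N1 \<union> uminus ` N2)" using N1(1) by simp
    fix x assume x: "x \<notin> N1 \<union> uminus ` N2"
    then have "- x \<notin> N2" by (metis UnCI add.inverse_inverse imageI)
    from N2(2)[OF this] have "((\<lambda>h. (- F (x - h) + F x) / h) \<longlongrightarrow> g x) (at_right 0)"
      by simp
    moreover have "(\<lambda>h. (- F (x - h) + F x) / h) = (\<lambda>h. (F (x + - h) - F x) / (- h))"
      by (auto simp: divide_simps)
    ultimately have "((\<lambda>h. (F (x + h) - F x) / h) \<longlongrightarrow> g x) (at_left 0)"
      by (simp add: filterlim_at_left_to_right)
    with N1(2)[of x] x show "(F has_real_derivative g x) (at x)"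
      unfolding DERIV_def by (intro filterlim_split_at) auto
  qed
qed

text \<open>
  With \<open>T\<close> the variation function, both \<open>T\<close> and \<open>T + v\<close> are nondecreasing and absolutely continuous,
  hence integrals of their derivatives \<open>g2\<close> and \<open>g1\<close>. Thus \<open>deriv v = g1 - g2\<close> almost everywhere, which
  makes \<open>\<bar>deriv v\<bar>\<close> locally integrable and its primitive \<open>W\<close> at least as steep as \<open>v\<close>.
\<close>

lemma absolutely_continuous_variation_integral:
  assumes v: "absolutely_continuous_on dist UNIV (v :: real \<Rightarrow> real)"
  obtains W where "continuous_on UNIV W" "mono W" "mono (\<lambda>x. W x - v x)"
    "\<And>y z. y \<le> z \<Longrightarrow> W z - W y = (LINT x:{y..z}|lebesgue. \<bar>deriv v x\<bar>)"
proof -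
  obtain T where T: "absolutely_continuous_on dist UNIV T" "\<And>x y. x \<le> y \<Longrightarrow> \<bar>v y - v x\<bar> \<le> T y - T x"
    using absolutely_continuous_variation_function[OF v] by blast
  define F where "F x = T x + v x" for x
  have F: "absolutely_continuous_on dist UNIV F"
    unfolding F_def by (rule absolutely_continuous_on_add[OF T(1) v])
  have mT: "mono T" by (rule monoI) (use T(2) in fastforce)
  have mF: "mono F" by (rule monoI) (use T(2) in \<open>fastforce simp: F_def\<close>)
  obtain g1 where g1: "\<And>x. 0 \<le> g1 x" "\<And>a b. a \<le> b \<Longrightarrow> (g1 has_integral F b - F a) {a..b}"
    using monotone_AC_density[OF F mF] by blast
  obtain g2 where g2: "\<And>x. 0 \<le> g2 x" "\<And>a b. a \<le> b \<Longrightarrow> (g2 has_integral T b - T a) {a..b}"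
    using monotone_AC_density[OF T(1) mT] by blast
  obtain N1 where N1: "negligible N1" "\<And>x. x \<notin> N1 \<Longrightarrow> (F has_real_derivative g1 x) (at x)"
    using AE_derivative_of_integral[OF g1(2)] by blast
  obtain N2 where N2: "negligible N2" "\<And>x. x \<notin> N2 \<Longrightarrow> (T has_real_derivative g2 x) (at x)"
    using AE_derivative_of_integral[OF g2(2)] by blast
  define N where "N = N1 \<union> N2"
  have N: "negligible N" using N1 N2 by (simp add: N_def)
  have dv: "deriv v x = g1 x - g2 x" if "x \<notin> N" for x
  proof -
    have "((\<lambda>x. F x - T x) has_real_derivative g1 x - g2 x) (at x)"
      using that N1(2) N2(2) by (intro DERIV_diff) (auto simp: N_def)
    then show ?thesis by (intro DERIV_imp_deriv) (simp add: F_def)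
  qed
  have ai: "(\<lambda>x. g1 x - g2 x) absolutely_integrable_on {a..b}" for a b
  proof (cases "a \<le> b")
    case True
    have "g1 integrable_on {a..b}" "g2 integrable_on {a..b}"
      using g1(2)[OF True] g2(2)[OF True] unfolding integrable_on_def by blast+
    then show ?thesis
      using g1(1) g2(1) by (intro set_integral_diff nonnegative_absolutely_integrable_1)
  qed simp
  have aiv: "(\<lambda>x. \<bar>deriv v x\<bar>) absolutely_integrable_on {a..b}" for a b
    by (rule absolutely_integrable_spike[OF set_integrable_abs[OF ai] N]) (auto simp: dv)
  have int_eq: "(LINT x:{y..z}|lebesgue. \<bar>deriv v x\<bar>) = integral {y..z} (\<lambda>x. \<bar>deriv v x\<bar>)" for y z
    by (rule set_lebesgue_integral_eq_integral(2)[OF aiv])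
  have intv: "(\<lambda>x. \<bar>deriv v x\<bar>) integrable_on {a..b}" for a b
    by (rule set_lebesgue_integral_eq_integral(1)[OF aiv])
  define W where "W x = (if 0 \<le> x then integral {0..x} (\<lambda>x. \<bar>deriv v x\<bar>) else - integral {x..0} (\<lambda>x. \<bar>deriv v x\<bar>))" for x
  have W: "W z - W y = integral {y..z} (\<lambda>x. \<bar>deriv v x\<bar>)" if "y \<le> z" for y z
    using that Henstock_Kurzweil_Integration.integral_combine[of 0 y z "\<lambda>x. \<bar>deriv v x\<bar>", OF _ _ intv]
      Henstock_Kurzweil_Integration.integral_combine[of y 0 z "\<lambda>x. \<bar>deriv v x\<bar>", OF _ _ intv]
      Henstock_Kurzweil_Integration.integral_combine[of y z 0 "\<lambda>x. \<bar>deriv v x\<bar>", OF _ _ intv]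
    by (auto simp: W_def)
  have W_nonneg: "0 \<le> W z - W y" if "y \<le> z" for y z
    unfolding W[OF that] by (rule Henstock_Kurzweil_Integration.integral_nonneg[OF intv]) simp
  have v_le: "v z - v y \<le> W z - W y" if yz: "y \<le> z" for y z
  proof -
    have "((\<lambda>x. g1 x - g2 x) has_integral (F z - F y) - (T z - T y)) {y..z}"
      using g1(2)[OF yz] g2(2)[OF yz] by (rule has_integral_diff)
    then have "(deriv v has_integral v z - v y) {y..z}"
      by (intro has_integral_spike[OF N, of _ "deriv v" "\<lambda>x. g1 x - g2 x"]) (auto simp: dv F_def algebra_simps)
    then show ?thesis
      unfolding W[OF yz] by (rule has_integral_le[OF _ integrable_integral[OF intv]]) simp
  qed
  have W_le: "W z - W y \<le> (F z - F y) + (T z - T y)" if yz: "y \<le> z" for y z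
  proof -
    have "((\<lambda>x. g1 x + g2 x) has_integral (F z - F y) + (T z - T y)) {y..z}"
      using g1(2)[OF yz] g2(2)[OF yz] by (rule has_integral_add)
    moreover have "((\<lambda>x. \<bar>g1 x - g2 x\<bar>) has_integral W z - W y) {y..z}"
      by (rule has_integral_spike[OF N, of _ _ "\<lambda>x. \<bar>deriv v x\<bar>"])
         (use integrable_integral[OF intv, of y z] W[OF yz] in \<open>auto simp: dv\<close>)
    moreover have "\<bar>g1 x - g2 x\<bar> \<le> g1 x + g2 x" for x using g1(1)[of x] g2(1)[of x] by (simp add: abs_le_iff)
    ultimately show ?thesis using has_integral_le by blast
  qed
  show ?thesis
  proof
    show "mono W" by (rule monoI) (use W_nonneg in fastforce)
    show "mono (\<lambda>x. W x - v x)" by (rule monoI) (use v_le in fastforce)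
    show "W z - W y = (LINT x:{y..z}|lebesgue. \<bar>deriv v x\<bar>)" if "y \<le> z" for y z
      using W[OF that] int_eq by simp
    show "continuous_on UNIV W"
      unfolding continuous_on_eq_continuous_at[OF open_UNIV] 
    proof
      fix x
      define H where "H y = F y + T y" for y
      have "continuous_on UNIV H" unfolding H_def
        by (intro continuous_on_add absolutely_continuous_on_imp_continuous F T)
      then have "isCont H x" by (simp add: continuous_on_eq_continuous_at)
      then have "((\<lambda>y. \<bar>H y - H x\<bar>) \<longlongrightarrow> \<bar>H x - H x\<bar>) (at x)"
        unfolding isCont_def by (intro tendsto_intros)
      then have lim: "((\<lambda>y. \<bar>H y - H x\<bar>) \<longlongrightarrow> 0) (at x)" by simp
      have "\<bar>W y - W x\<bar> \<le> \<bar>H y - H x\<bar>" for y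
        using W_le[of x y] W_nonneg[of x y] W_le[of y x] W_nonneg[of y x]
        by (cases "x \<le> y") (auto simp: H_def)
      then have "((\<lambda>y. W y - W x) \<longlongrightarrow> 0) (at x)"
        by (intro Lim_null_comparison[OF _ lim]) (auto intro: always_eventually)
      then show "isCont W x" by (simp add: isCont_def LIM_zero_iff)
    qed
  qed
qed

section \<open>The space of square integrable functions\<close>

definition L2_norm :: "'a measure \<Rightarrow> ('a \<Rightarrow> real) \<Rightarrow> real" where
  "L2_norm \<mu> f = sqrt (\<integral>y. (f y)\<^sup>2 \<partial>\<mu>)"

lemma L2_dist_eq_norm: "L2_dist \<mu> f g = L2_norm \<mu> (\<lambda>y. f y - g y)"
  by (simp add: L2_dist_def L2_norm_def)

lemma L2_norm_nonneg: "0 \<le> L2_norm \<mu> f"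
  by (simp add: L2_norm_def)

lemma L2_norm_power2: "(L2_norm \<mu> f)\<^sup>2 = (\<integral>y. (f y)\<^sup>2 \<partial>\<mu>)"
  by (simp add: L2_norm_def)

lemma L2_measurable: "f \<in> L2 \<mu> \<Longrightarrow> f \<in> borel_measurable \<mu>"
  by (simp add: L2_def)

lemma L2_square_integrable: "f \<in> L2 \<mu> \<Longrightarrow> integrable \<mu> (\<lambda>y. (f y)\<^sup>2)"
  by (simp add: L2_def)

lemma L2_mult_integrable:
  assumes "f \<in> L2 \<mu>" "g \<in> L2 \<mu>"
  shows "integrable \<mu> (\<lambda>y. f y * g y)"
proof (rule Bochner_Integration.integrable_bound)
  show "integrable \<mu> (\<lambda>y. (f y)\<^sup>2 + (g y)\<^sup>2)"
    using assms by (auto dest: L2_square_integrable)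
  have [measurable]: "f \<in> borel_measurable \<mu>" "g \<in> borel_measurable \<mu>"
    using assms by (auto dest: L2_measurable)
  show "(\<lambda>y. f y * g y) \<in> borel_measurable \<mu>" by measurable
  have "\<bar>a * b\<bar> \<le> a\<^sup>2 + b\<^sup>2" for a b :: real
  proof -
    have "0 \<le> \<bar>a\<bar> * \<bar>b\<bar>" by simp
    moreover have "2 * (\<bar>a\<bar> * \<bar>b\<bar>) \<le> a\<^sup>2 + b\<^sup>2"
      using sum_squares_bound[of "\<bar>a\<bar>" "\<bar>b\<bar>"] by (simp add: mult.assoc)
    ultimately show ?thesis unfolding abs_mult by linarith
  qed
  then show "AE y in \<mu>. norm (f y * g y) \<le> norm ((f y)\<^sup>2 + (g y)\<^sup>2)"
    by simp
qed

lemma L2_add: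
  assumes "f \<in> L2 \<mu>" "g \<in> L2 \<mu>" shows "(\<lambda>y. f y + g y) \<in> L2 \<mu>"
proof -
  have "integrable \<mu> (\<lambda>y. (f y)\<^sup>2 + (g y)\<^sup>2 + 2 * (f y * g y))"
    using assms by (intro Bochner_Integration.integrable_add integrable_mult_right L2_mult_integrable L2_square_integrable)
  then show ?thesis using assms by (auto simp: L2_def power2_sum mult.assoc)
qed

lemma L2_cmult: "f \<in> L2 \<mu> \<Longrightarrow> (\<lambda>y. c * f y) \<in> L2 \<mu>"
  by (auto simp: L2_def power_mult_distrib)

lemma L2_diff:
  assumes "f \<in> L2 \<mu>" "g \<in> L2 \<mu>" shows "(\<lambda>y. f y - g y) \<in> L2 \<mu>"
  using L2_add[OF assms(1) L2_cmult[OF assms(2), of "-1"]] by simp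

lemma L2_const: "finite_measure \<mu> \<Longrightarrow> (\<lambda>_. c) \<in> L2 \<mu>"
  by (simp add: L2_def finite_measure.integrable_const)

lemma L2_bound:
  assumes "g \<in> L2 \<mu>" "f \<in> borel_measurable \<mu>" "AE y in \<mu>. \<bar>f y\<bar> \<le> \<bar>g y\<bar>"
  shows "f \<in> L2 \<mu>"
proof -
  have "integrable \<mu> (\<lambda>y. (f y)\<^sup>2)"
  proof (rule Bochner_Integration.integrable_bound[OF L2_square_integrable[OF assms(1)]])
    show "AE y in \<mu>. norm ((f y)\<^sup>2) \<le> norm ((g y)\<^sup>2)"
      using assms(3) by eventually_elim (simp flip: abs_le_square_iff)
  qed (use assms(2) in measurable)
  with assms(2) show ?thesis by (simp add: L2_def)
qed

lemma L2_integrable: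
  assumes "finite_measure \<mu>" "f \<in> L2 \<mu>" shows "integrable \<mu> f"
  using L2_mult_integrable[OF assms(2) L2_const[OF assms(1), of 1]] by simp

lemma L2_Cauchy_Schwarz:
  assumes "f \<in> L2 \<mu>" "g \<in> L2 \<mu>"
  shows "\<bar>\<integral>y. f y * g y \<partial>\<mu>\<bar> \<le> L2_norm \<mu> f * L2_norm \<mu> g"
proof -
  define a where "a = (\<integral>y. (f y)\<^sup>2 \<partial>\<mu>)"
  define b where "b = (\<integral>y. f y * g y \<partial>\<mu>)"
  define c where "c = (\<integral>y. (g y)\<^sup>2 \<partial>\<mu>)"
  have q: "0 \<le> a + 2 * x * b + x\<^sup>2 * c" for x
  proof -
    have "0 \<le> (\<integral>y. (f y + x * g y)\<^sup>2 \<partial>\<mu>)" by simp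
    also have "(\<lambda>y. (f y + x * g y)\<^sup>2) = (\<lambda>y. (f y)\<^sup>2 + 2 * x * (f y * g y) + x\<^sup>2 * (g y)\<^sup>2)"
      by (auto simp: power2_eq_square algebra_simps)
    also have "(\<integral>y. (f y)\<^sup>2 + 2 * x * (f y * g y) + x\<^sup>2 * (g y)\<^sup>2 \<partial>\<mu>) = a + 2 * x * b + x\<^sup>2 * c"
      using L2_mult_integrable[OF assms] assms[THEN L2_square_integrable]
      by (simp add: a_def b_def c_def)
    finally show ?thesis .
  qed
  have ac: "0 \<le> a" "0 \<le> c" by (simp_all add: a_def c_def)
  have "b\<^sup>2 \<le> a * c"
  proof (cases "c = 0")
    case True
    have "b = 0"
    proof (rule ccontr)
      assume "b \<noteq> 0"
      then show False using q[of "-(a + 1) / (2 * b)"] True by (simp add: field_simps)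
    qed
    then show ?thesis using True by simp
  next
    case False
    then show ?thesis using q[of "-b / c"] ac
      by (simp add: field_simps power2_eq_square split: if_splits)
  qed
  then have "\<bar>b\<bar> \<le> sqrt (a * c)" by (simp add: real_le_rsqrt)
  then show ?thesis by (simp add: L2_norm_def a_def b_def c_def real_sqrt_mult)
qed

lemma L2_norm_cmult: "L2_norm \<mu> (\<lambda>y. c * f y) = \<bar>c\<bar> * L2_norm \<mu> f"
  by (simp add: L2_norm_def power_mult_distrib real_sqrt_mult)

lemma L2_norm_triangle:
  assumes "f \<in> L2 \<mu>" "g \<in> L2 \<mu>"
  shows "L2_norm \<mu> (\<lambda>y. f y + g y) \<le> L2_norm \<mu> f + L2_norm \<mu> g"
proof (rule power2_le_imp_le)
  have "(L2_norm \<mu> (\<lambda>y. f y + g y))\<^sup>2 = (\<integral>y. (f y)\<^sup>2 + (g y)\<^sup>2 + 2 * (f y * g y) \<partial>\<mu>)"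
    by (simp add: L2_norm_power2 power2_sum mult.assoc)
  also have "\<dots> = (L2_norm \<mu> f)\<^sup>2 + (L2_norm \<mu> g)\<^sup>2 + 2 * (\<integral>y. f y * g y \<partial>\<mu>)"
    using L2_mult_integrable[OF assms] assms[THEN L2_square_integrable]
    by (simp add: L2_norm_power2)
  also have "\<dots> \<le> (L2_norm \<mu> f + L2_norm \<mu> g)\<^sup>2"
    using L2_Cauchy_Schwarz[OF assms] by (simp add: power2_sum)
  finally show "(L2_norm \<mu> (\<lambda>y. f y + g y))\<^sup>2 \<le> (L2_norm \<mu> f + L2_norm \<mu> g)\<^sup>2" .
qed (simp add: L2_norm_nonneg)

lemma L2_dist_triangle:
  assumes "f \<in> L2 \<mu>" "g \<in> L2 \<mu>" "h \<in> L2 \<mu>"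
  shows "L2_dist \<mu> f h \<le> L2_dist \<mu> f g + L2_dist \<mu> g h"
  using L2_norm_triangle[OF L2_diff[OF assms(1,2)] L2_diff[OF assms(2,3)]]
  by (simp add: L2_dist_eq_norm)

lemma L2_dist_commute: "L2_dist \<mu> f g = L2_dist \<mu> g f"
  by (simp add: L2_dist_def power2_commute)

lemma L2_dist_nonneg: "0 \<le> L2_dist \<mu> f g"
  by (simp add: L2_dist_def)

lemma L2_L1_le:
  assumes "prob_space \<mu>" "f \<in> L2 \<mu>"
  shows "(\<integral>y. \<bar>f y\<bar> \<partial>\<mu>) \<le> L2_norm \<mu> f"
proof -
  interpret prob_space \<mu> by fact
  have "(\<lambda>y. \<bar>f y\<bar>) \<in> L2 \<mu>" using assms(2) by (auto simp: L2_def)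
  from L2_Cauchy_Schwarz[OF this L2_const[OF finite_measure_axioms, of 1]]
  show ?thesis by (simp add: L2_norm_def prob_space)
qed

lemma L2_convergent_inner:
  assumes "\<And>n. u n \<in> L2 \<mu>" "f \<in> L2 \<mu>" "(\<lambda>n. L2_dist \<mu> (u n) f) \<longlonglongrightarrow> 0"
    and "\<And>n. w n \<in> L2 \<mu>" "g \<in> L2 \<mu>" "(\<lambda>n. L2_dist \<mu> (w n) g) \<longlonglongrightarrow> 0"
  shows "(\<lambda>n. \<integral>y. u n y * w n y \<partial>\<mu>) \<longlonglongrightarrow> (\<integral>y. f y * g y \<partial>\<mu>)"
proof (rule LIM_zero_cancel, rule Lim_null_comparison)
  have "(\<lambda>n. L2_dist \<mu> (u n) f * (L2_norm \<mu> g + L2_dist \<mu> (w n) g)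
             + L2_norm \<mu> f * L2_dist \<mu> (w n) g) \<longlonglongrightarrow> 0 * (L2_norm \<mu> g + 0) + L2_norm \<mu> f * 0"
    using assms by (intro tendsto_intros)
  then show "(\<lambda>n. L2_dist \<mu> (u n) f * (L2_norm \<mu> g + L2_dist \<mu> (w n) g)
             + L2_norm \<mu> f * L2_dist \<mu> (w n) g) \<longlonglongrightarrow> 0" by simp
  show "\<forall>\<^sub>F n in sequentially. norm ((\<integral>y. u n y * w n y \<partial>\<mu>) - (\<integral>y. f y * g y \<partial>\<mu>))
     \<le> L2_dist \<mu> (u n) f * (L2_norm \<mu> g + L2_dist \<mu> (w n) g) + L2_norm \<mu> f * L2_dist \<mu> (w n) g"
  proof (rule always_eventually, rule allI)
    fix n
    have d1: "(\<lambda>y. u n y - f y) \<in> L2 \<mu>" and d2: "(\<lambda>y. w n y - g y) \<in> L2 \<mu>"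
      using assms by (auto intro: L2_diff)
    have "(\<integral>y. u n y * w n y \<partial>\<mu>) - (\<integral>y. f y * g y \<partial>\<mu>)
        = (\<integral>y. (u n y - f y) * w n y + f y * (w n y - g y) \<partial>\<mu>)"
      using assms by (subst Bochner_Integration.integral_diff[symmetric])
         (auto intro!: L2_mult_integrable Bochner_Integration.integral_cong simp: algebra_simps)
    also have "\<dots> = (\<integral>y. (u n y - f y) * w n y \<partial>\<mu>) + (\<integral>y. f y * (w n y - g y) \<partial>\<mu>)"
      using assms d1 d2 by (intro Bochner_Integration.integral_add L2_mult_integrable)
    also have "norm \<dots> \<le> \<bar>\<integral>y. (u n y - f y) * w n y \<partial>\<mu>\<bar> + \<bar>\<integral>y. f y * (w n y - g y) \<partial>\<mu>\<bar>"
      by (simp add: abs_triangle_ineq)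
    also have "\<dots> \<le> L2_dist \<mu> (u n) f * L2_norm \<mu> (w n) + L2_norm \<mu> f * L2_dist \<mu> (w n) g"
      using L2_Cauchy_Schwarz[OF d1 assms(4)] L2_Cauchy_Schwarz[OF assms(2) d2]
      unfolding L2_dist_eq_norm by (intro add_mono)
    also have "L2_norm \<mu> (w n) \<le> L2_norm \<mu> g + L2_dist \<mu> (w n) g"
      using L2_norm_triangle[OF assms(5) d2] by (simp add: L2_dist_eq_norm)
    finally show "norm ((\<integral>y. u n y * w n y \<partial>\<mu>) - (\<integral>y. f y * g y \<partial>\<mu>))
       \<le> L2_dist \<mu> (u n) f * (L2_norm \<mu> g + L2_dist \<mu> (w n) g) + L2_norm \<mu> f * L2_dist \<mu> (w n) g"
      by (simp add: L2_dist_nonneg mult_left_mono)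
  qed
qed

lemma L2_convergent_AE_subseq:
  assumes "prob_space \<mu>" "\<And>n. u n \<in> L2 \<mu>" "f \<in> L2 \<mu>" "(\<lambda>n. L2_dist \<mu> (u n) f) \<longlonglongrightarrow> 0"
  obtains r :: "nat \<Rightarrow> nat" where "strict_mono r" "AE y in \<mu>. (\<lambda>n. u (r n) y) \<longlonglongrightarrow> f y"
proof -
  interpret prob_space \<mu> by fact
  have d: "(\<lambda>y. u n y - f y) \<in> L2 \<mu>" for n using assms by (auto intro: L2_diff)
  have "(\<lambda>n. \<integral>y. norm (u n y - f y) \<partial>\<mu>) \<longlonglongrightarrow> 0"
  proof (rule tendsto_sandwich[OF _ _ tendsto_const assms(4)])
    show "\<forall>\<^sub>F n in sequentially. (\<integral>y. norm (u n y - f y) \<partial>\<mu>) \<le> L2_dist \<mu> (u n) f"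
      using L2_L1_le[OF assms(1) d] by (simp add: L2_dist_eq_norm)
  qed auto
  from tendsto_L1_AE_subseq[OF L2_integrable[OF finite_measure_axioms d] this]
  obtain r :: "nat \<Rightarrow> nat" where "strict_mono r" "AE y in \<mu>. (\<lambda>n. u (r n) y - f y) \<longlonglongrightarrow> 0"
    by blast
  then show ?thesis using that by (auto simp: LIM_zero_iff)
qed

text \<open>
  A subsequence converges almost everywhere, since the sequence is also Cauchy in \<open>L\<^sup>1\<close>; Fatou's lemma
  identifies its limit as the \<open>L\<^sup>2\<close> limit of the whole sequence.
\<close>

lemma L2_complete:
  assumes "prob_space \<mu>" and u: "\<And>n. u n \<in> L2 \<mu>"
    and cau: "\<And>e. e > 0 \<Longrightarrow> \<exists>N. \<forall>i\<ge>N. \<forall>j\<ge>N. L2_dist \<mu> (u i) (u j) < e"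
  obtains f where "f \<in> L2 \<mu>" "(\<lambda>n. L2_dist \<mu> (u n) f) \<longlonglongrightarrow> 0"
proof -
  interpret prob_space \<mu> by fact
  have [measurable]: "u n \<in> borel_measurable \<mu>" for n using u by (rule L2_measurable)
  have d: "(\<lambda>y. u i y - u j y) \<in> L2 \<mu>" for i j using u by (auto intro: L2_diff)
  have "\<exists>N. \<forall>i\<ge>N. \<forall>j\<ge>N. (\<integral>y. norm (u i y - u j y) \<partial>\<mu>) < e" if "e > 0" for e
    using cau[OF that] L2_L1_le[OF assms(1) d] unfolding L2_dist_eq_norm real_norm_def
    by (meson le_less_trans)
  from cauchy_L1_AE_cauchy_subseq[OF L2_integrable[OF finite_measure_axioms u] this]
  obtain r where r: "strict_mono r" and ae: "AE y in \<mu>. Cauchy (\<lambda>i. u (r i) y)"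
    by blast
  define f where "f y = lim (\<lambda>i. u (r i) y)" for y
  have [measurable]: "f \<in> borel_measurable \<mu>"
    unfolding f_def by measurable
  have lim: "AE y in \<mu>. (\<lambda>i. u (r i) y) \<longlonglongrightarrow> f y"
    using ae by (auto simp: f_def Cauchy_convergent_iff convergent_LIMSEQ_iff)
  \<comment> \<open>Fatou's lemma turns the Cauchy estimate into an estimate for the limit.\<close>
  have fatou: "(\<integral>\<^sup>+y. ennreal ((u n y - f y)\<^sup>2) \<partial>\<mu>) \<le> ennreal (e\<^sup>2)"
    if "e > 0" and N: "\<forall>i\<ge>N. \<forall>j\<ge>N. L2_dist \<mu> (u i) (u j) < e" and "n \<ge> N" for e N n
  proof -
    have "(\<integral>\<^sup>+y. ennreal ((u n y - f y)\<^sup>2) \<partial>\<mu>)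
        = (\<integral>\<^sup>+y. liminf (\<lambda>i. ennreal ((u n y - u (r i) y)\<^sup>2)) \<partial>\<mu>)"
    proof (rule nn_integral_cong_AE, use lim in eventually_elim)
      fix y assume "(\<lambda>i. u (r i) y) \<longlonglongrightarrow> f y"
      then have "(\<lambda>i. ennreal ((u n y - u (r i) y)\<^sup>2)) \<longlonglongrightarrow> ennreal ((u n y - f y)\<^sup>2)"
        by (intro tendsto_intros)
      from lim_imp_Liminf[OF _ this]
      show "ennreal ((u n y - f y)\<^sup>2) = liminf (\<lambda>i. ennreal ((u n y - u (r i) y)\<^sup>2))"
        by simp
    qed
    also have "\<dots> \<le> liminf (\<lambda>i. \<integral>\<^sup>+y. ennreal ((u n y - u (r i) y)\<^sup>2) \<partial>\<mu>)"
      by (rule nn_integral_liminf) measurable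
    also have "\<dots> \<le> ennreal (e\<^sup>2)"
    proof (rule Liminf_le)
      show "\<forall>\<^sub>F i in sequentially. (\<integral>\<^sup>+y. ennreal ((u n y - u (r i) y)\<^sup>2) \<partial>\<mu>) \<le> ennreal (e\<^sup>2)"
      proof (rule eventually_sequentiallyI[of N])
        fix i assume "N \<le> i"
        then have "L2_dist \<mu> (u n) (u (r i)) < e"
          using N \<open>n \<ge> N\<close> seq_suble[OF r, of i] by auto
        then have "(L2_norm \<mu> (\<lambda>y. u n y - u (r i) y))\<^sup>2 \<le> e\<^sup>2"
          unfolding L2_dist_eq_norm by (intro power_mono) (auto simp: L2_norm_nonneg)
        then show "(\<integral>\<^sup>+y. ennreal ((u n y - u (r i) y)\<^sup>2) \<partial>\<mu>) \<le> ennreal (e\<^sup>2)"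
          by (subst nn_integral_eq_integral)
             (auto simp: L2_norm_power2 L2_square_integrable[OF d])
      qed
    qed simp
    finally show ?thesis .
  qed
  have L: "(\<lambda>y. u n y - f y) \<in> L2 \<mu> \<and> L2_dist \<mu> (u n) f \<le> e"
    if "e > 0" and N: "\<forall>i\<ge>N. \<forall>j\<ge>N. L2_dist \<mu> (u i) (u j) < e" and "n \<ge> N" for e N n
  proof -
    have fin: "(\<integral>\<^sup>+y. ennreal ((u n y - f y)\<^sup>2) \<partial>\<mu>) \<le> ennreal (e\<^sup>2)"
      by (rule fatou[OF that])
    then have int: "integrable \<mu> (\<lambda>y. (u n y - f y)\<^sup>2)"
      by (intro integrableI_bounded) (auto intro: le_less_trans)
    then have "(\<integral>y. (u n y - f y)\<^sup>2 \<partial>\<mu>) \<le> e\<^sup>2"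
      using fin by (subst (asm) nn_integral_eq_integral) auto
    then show ?thesis
      using int \<open>e > 0\<close> by (auto simp: L2_def L2_dist_def intro: real_le_lsqrt)
  qed
  obtain N where N: "\<forall>i\<ge>N. \<forall>j\<ge>N. L2_dist \<mu> (u i) (u j) < 1" using cau[of 1] by auto
  have "(\<lambda>y. u N y - f y) \<in> L2 \<mu>" using L[OF _ N, of N] by simp
  from L2_diff[OF u[of N] this] have "f \<in> L2 \<mu>" by simp
  moreover have "(\<lambda>n. L2_dist \<mu> (u n) f) \<longlonglongrightarrow> 0"
  proof (rule LIMSEQ_I)
    fix e :: real assume "e > 0"
    then obtain N where N: "\<forall>i\<ge>N. \<forall>j\<ge>N. L2_dist \<mu> (u i) (u j) < e / 2"
      using cau[of "e / 2"] by auto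
    show "\<exists>N. \<forall>n\<ge>N. norm (L2_dist \<mu> (u n) f - 0) < e"
      using L[OF _ N] \<open>e > 0\<close> L2_dist_nonneg[of \<mu>] by (intro exI[of _ N]) force
  qed
  ultimately show ?thesis using that by blast
qed

section \<open>Isotonic regression on finite sets\<close>

text \<open>
  The optimality conditions for minimising \<open>\<Sum>a\<in>A. m a * (f a - p a)\<^sup>2\<close> over nondecreasing \<open>p\<close>: the
  primitive of \<open>p\<close> with respect to the weights is the greatest convex minorant of the primitive of
  \<open>f\<close>. The two agree at the right end of \<open>A\<close> and wherever the slope \<open>p\<close> increases. The last clause
  says that \<open>p\<close> is orthogonal to the residual. The function \<open>p\<close> is defined and nondecreasing on the
  whole line, so that it can be composed with a rounding map.
\<close>

definition isotonic_fit :: "real set \<Rightarrow> (real \<Rightarrow> real) \<Rightarrow> (real \<Rightarrow> real) \<Rightarrow> (real \<Rightarrow> real) \<Rightarrow> bool" where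
  "isotonic_fit A m f p \<longleftrightarrow>
     mono p
   \<and> (\<forall>x\<in>A. 0 \<le> (\<Sum>a | a \<in> A \<and> a \<le> x. m a * (f a - p a)))
   \<and> (\<Sum>a\<in>A. m a * (f a - p a)) = 0
   \<and> (\<forall>x\<in>A. 0 < (\<Sum>a | a \<in> A \<and> a \<le> x. m a * (f a - p a)) \<longrightarrow> (\<exists>y\<in>A. x < y \<and> p y = p x))
   \<and> (\<Sum>a\<in>A. m a * (f a - p a) * p a) = 0"

lemma isotonic_fit_mono: "mono f \<Longrightarrow> isotonic_fit A m f f"
  by (simp add: isotonic_fit_def)

text \<open>
  The first slope of the convex minorant is the least average of \<open>f\<close> over an initial segment of \<open>A\<close>.
  If \<open>l\<close> is the end of a minimising segment, then \<open>p\<close> is this average up to \<open>l\<close> and a fit of the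
  remaining points after \<open>l\<close>. The slopes do not decrease at \<open>l\<close>: a smaller slope on the first
  block after \<open>l\<close> would give an initial segment with smaller average.
\<close>

lemma isotonic_fit_exists:
  assumes "finite A" "\<And>a. a \<in> A \<Longrightarrow> 0 < m a"
  shows "\<exists>p. isotonic_fit A m f p"
  using assms
proof (induction A rule: finite_psubset_induct)
  case (psubset A)
  show ?case
  proof (cases "A = {}")
    case True
    then show ?thesis by (auto simp: isotonic_fit_def mono_def intro: exI[of _ "\<lambda>_. 0"])
  next
    case False
    define F where "F x = (\<Sum>a | a \<in> A \<and> a \<le> x. m a * f a)" for x
    define M where "M x = (\<Sum>a | a \<in> A \<and> a \<le> x. m a)" for x
    have Mpos: "0 < M x" if "x \<in> A" for x
      unfolding M_def using that psubset by (intro sum_pos) auto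
    define c where "c = Min ((\<lambda>x. F x / M x) ` A)"
    have "c \<in> (\<lambda>x. F x / M x) ` A"
      unfolding c_def using False psubset by (intro Min_in) auto
    then obtain l where l: "l \<in> A" "c = F l / M l" by auto
    have Fl: "F l = c * M l" using l Mpos[OF l(1)] by simp
    have Fge: "c * M x \<le> F x" if "x \<in> A" for x
    proof -
      have "c \<le> F x / M x" unfolding c_def using psubset that by (intro Min_le) auto
      then show ?thesis using Mpos[OF that] by (simp add: field_simps)
    qed
    define A' where "A' = {a \<in> A. l < a}"
    have "A' \<subset> A" using l by (auto simp: A'_def)
    with psubset obtain p' where p': "isotonic_fit A' m f p'"
      by (metis psubset_imp_subset subsetD)
    have fin: "finite A" "finite A'" using psubset by (auto simp: A'_def)
    have mp: "mono p'" using p' by (simp add: isotonic_fit_def)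
    have p'_ge: "c \<le> p' x" if "x \<in> A'" for x
    proof -
      define a0 where "a0 = Min A'"
      have a0: "a0 \<in> A'" "\<And>a. a \<in> A' \<Longrightarrow> a0 \<le> a"
        using that Min_in[OF fin(2)] Min_le[OF fin(2)] unfolding a0_def by blast+
      \<comment> \<open>The first block of \<open>p'\<close> ends at \<open>y\<close>, and the cumulative residual vanishes there.\<close>
      define y where "y = Max {y \<in> A'. p' y = p' a0}"
      have y: "y \<in> A'" "p' y = p' a0" "\<And>a. a \<in> A' \<Longrightarrow> p' a = p' a0 \<Longrightarrow> a \<le> y"
        using Max_in[of "{y \<in> A'. p' y = p' a0}"] a0 fin by (auto simp: y_def)
      have cst: "p' a = p' a0" if "a \<in> A'" "a \<le> y" for a
        using a0(2)[OF that(1)] that(2) mp y(2) by (metis antisym monoD)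
      have "\<not> 0 < (\<Sum>a | a \<in> A' \<and> a \<le> y. m a * (f a - p' a))"
        using p' y unfolding isotonic_fit_def by fastforce
      moreover have "0 \<le> (\<Sum>a | a \<in> A' \<and> a \<le> y. m a * (f a - p' a))"
        using p' y unfolding isotonic_fit_def by blast
      ultimately have "(\<Sum>a | a \<in> A' \<and> a \<le> y. m a * (f a - p' a)) = 0" by linarith
      moreover have "(\<Sum>a | a \<in> A' \<and> a \<le> y. m a * (f a - p' a))
        = (\<Sum>a | a \<in> A' \<and> a \<le> y. m a * f a) - p' a0 * (\<Sum>a | a \<in> A' \<and> a \<le> y. m a)"
        unfolding sum_distrib_left sum_subtractf[symmetric]
        by (intro sum.cong) (auto simp: cst algebra_simps)
      ultimately have F': "(\<Sum>a | a \<in> A' \<and> a \<le> y. m a * f a) = p' a0 * (\<Sum>a | a \<in> A' \<and> a \<le> y. m a)"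
        by simp
      have yA: "y \<in> A" "l < y" using y by (auto simp: A'_def)
      have spl: "{a. a \<in> A \<and> a \<le> y} = {a. a \<in> A \<and> a \<le> l} \<union> {a. a \<in> A' \<and> a \<le> y}"
        using yA by (auto simp: A'_def)
      have "F y = F l + (\<Sum>a | a \<in> A' \<and> a \<le> y. m a * f a)"
        unfolding F_def spl using fin by (intro sum.union_disjoint) (auto simp: A'_def)
      moreover have "M y = M l + (\<Sum>a | a \<in> A' \<and> a \<le> y. m a)"
        unfolding M_def spl using fin by (intro sum.union_disjoint) (auto simp: A'_def)
      ultimately have "c * (\<Sum>a | a \<in> A' \<and> a \<le> y. m a) \<le> p' a0 * (\<Sum>a | a \<in> A' \<and> a \<le> y. m a)"
        using Fge[OF yA(1)] Fl F' by (simp add: algebra_simps)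
      moreover have "0 < (\<Sum>a | a \<in> A' \<and> a \<le> y. m a)"
        using y fin psubset.prems by (intro sum_pos) (auto simp: A'_def)
      ultimately have "c \<le> p' a0" by simp
      also have "\<dots> \<le> p' x" using a0(2)[OF that] mp by (rule monoD[rotated])
      finally show ?thesis .
    qed
    \<comment> \<open>The maximum matters only in the gap between \<open>l\<close> and the next point of \<open>A\<close>.\<close>
    define p where "p x = (if x \<le> l then c else max c (p' x))" for x
    have pA': "p a = p' a" if "a \<in> A'" for a
      using that p'_ge[OF that] by (auto simp: p_def A'_def)
    have "mono p" using mp by (auto simp: p_def mono_def max_def) (metis order_trans)+
    have low: "(\<Sum>a | a \<in> A \<and> a \<le> x. m a * (f a - p a)) = F x - c * M x" if "x \<le> l" for x
      unfolding F_def M_def sum_distrib_left sum_subtractf[symmetric]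
      using that by (intro sum.cong) (auto simp: p_def algebra_simps)
    have l0: "(\<Sum>a | a \<in> A \<and> a \<le> l. m a * (f a - p a)) = 0"
      using low[of l] Fl by simp
    have high: "(\<Sum>a | a \<in> A \<and> a \<le> x. m a * (f a - p a)) = (\<Sum>a | a \<in> A' \<and> a \<le> x. m a * (f a - p' a))"
      if "l < x" for x
    proof -
      have spl: "{a. a \<in> A \<and> a \<le> x} = {a. a \<in> A \<and> a \<le> l} \<union> {a. a \<in> A' \<and> a \<le> x}"
        using that by (auto simp: A'_def)
      have "(\<Sum>a | a \<in> A \<and> a \<le> x. m a * (f a - p a))
          = (\<Sum>a | a \<in> A \<and> a \<le> l. m a * (f a - p a)) + (\<Sum>a | a \<in> A' \<and> a \<le> x. m a * (f a - p a))"
        unfolding spl using fin by (intro sum.union_disjoint) (auto simp: A'_def)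
      then show ?thesis by (simp add: l0 pA')
    qed
    have spl: "A = {a. a \<in> A \<and> a \<le> l} \<union> A'" by (auto simp: A'_def)
    have tot: "(\<Sum>a\<in>A. g a) = (\<Sum>a | a \<in> A \<and> a \<le> l. g a) + (\<Sum>a\<in>A'. g a)" for g :: "real \<Rightarrow> real"
      by (subst spl, rule sum.union_disjoint) (use fin in \<open>auto simp: A'_def\<close>)
    have "isotonic_fit A m f p"
      unfolding isotonic_fit_def
    proof (intro conjI ballI impI)
      show "mono p" by fact
    next
      fix x assume x: "x \<in> A"
      show "0 \<le> (\<Sum>a | a \<in> A \<and> a \<le> x. m a * (f a - p a))"
      proof (cases "x \<le> l")
        case True then show ?thesis using low Fge x by simp
      next
        case False
        then have "x \<in> A'" using x by (auto simp: A'_def)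
        then show ?thesis using high[of x] False p' by (simp add: isotonic_fit_def)
      qed
    next
      show "(\<Sum>a\<in>A. m a * (f a - p a)) = 0"
        using p' by (simp add: tot l0 pA' isotonic_fit_def)
    next
      fix x assume x: "x \<in> A" and D: "0 < (\<Sum>a | a \<in> A \<and> a \<le> x. m a * (f a - p a))"
      consider "x < l" | "x = l" | "l < x" by linarith
      then show "\<exists>y\<in>A. x < y \<and> p y = p x"
      proof cases
        case 1 then show ?thesis using l by (intro bexI[of _ l]) (auto simp: p_def)
      next
        case 2 then show ?thesis using D l0 by simp
      next
        case 3
        then have "x \<in> A'" using x by (auto simp: A'_def)
        moreover have "0 < (\<Sum>a | a \<in> A' \<and> a \<le> x. m a * (f a - p' a))" using D high[OF 3] by simp
        ultimately obtain y where "y \<in> A'" "x < y" "p' y = p' x"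
          using p' unfolding isotonic_fit_def by blast
        then show ?thesis using \<open>x \<in> A'\<close> pA' by (intro bexI[of _ y]) (auto simp: A'_def)
      qed
    next
      have "(\<Sum>a | a \<in> A \<and> a \<le> l. m a * (f a - p a) * p a) = c * (\<Sum>a | a \<in> A \<and> a \<le> l. m a * (f a - p a))"
        unfolding sum_distrib_left by (intro sum.cong) (auto simp: p_def)
      then show "(\<Sum>a\<in>A. m a * (f a - p a) * p a) = 0"
        using p' by (simp add: tot l0 pA' isotonic_fit_def)
    qed
    then show ?thesis by blast
  qed
qed

text \<open>
  Summation by parts against a nondecreasing \<open>w\<close>, arranged as an induction that adds the largest point.
\<close>

lemma sum_prefix_nonneg_le:
  fixes g w :: "real \<Rightarrow> real"
  assumes "finite A" "\<And>x. x \<in> A \<Longrightarrow> 0 \<le> (\<Sum>a | a \<in> A \<and> a \<le> x. g a)"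
    and "mono_on A w" "\<And>a. a \<in> A \<Longrightarrow> w a \<le> c"
  shows "(\<Sum>a\<in>A. g a * w a) \<le> c * (\<Sum>a\<in>A. g a)"
  using assms
proof (induction A arbitrary: c rule: finite_linorder_max_induct)
  case empty
  then show ?case by simp
next
  case (insert b A)
  have e: "{a. a \<in> insert b A \<and> a \<le> x} = {a. a \<in> A \<and> a \<le> x}" if "x \<in> A" for x
    using insert.hyps that by fastforce
  have e': "{a. a \<in> insert b A \<and> a \<le> b} = insert b A"
    using insert.hyps by (auto intro: less_imp_le)
  have nb: "b \<notin> A" using insert.hyps by auto
  have "(\<Sum>a\<in>A. g a * w a) \<le> w b * (\<Sum>a\<in>A. g a)"
  proof (rule insert.IH)
    fix x assume "x \<in> A"
    with insert.prems(1)[of x] e[of x] show "0 \<le> (\<Sum>a | a \<in> A \<and> a \<le> x. g a)" by simp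
  next
    show "mono_on A w" using insert.prems(2) by (auto simp: mono_on_def)
  next
    fix a assume "a \<in> A"
    then show "w a \<le> w b" using insert.prems(2) insert.hyps by (auto simp: mono_on_def less_imp_le)
  qed
  then have "(\<Sum>a\<in>insert b A. g a * w a) \<le> w b * (\<Sum>a\<in>insert b A. g a)"
    using insert.hyps nb by (simp add: algebra_simps)
  also have "\<dots> \<le> c * (\<Sum>a\<in>insert b A. g a)"
    using insert.prems(1)[of b] insert.prems(3)[of b] unfolding e'
    by (intro mult_right_mono) auto
  finally show ?case .
qed

lemma isotonic_fit_variational:
  assumes "finite A" "isotonic_fit A m f p" "mono_on A w"
  shows "(\<Sum>a\<in>A. m a * (f a - p a) * w a) \<le> 0"
proof (cases "A = {}")
  case False
  have "w a \<le> Max (w ` A)" if "a \<in> A" for a using assms that by (intro Max_ge) auto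
  from sum_prefix_nonneg_le[OF assms(1) _ assms(3) this, of "\<lambda>a. m a * (f a - p a)"]
  show ?thesis using assms(2) by (simp add: isotonic_fit_def)
qed simp

lemma mono_on_finite_consecutive:
  fixes r :: "real \<Rightarrow> real"
  assumes "finite A"
    and "\<And>x y. x \<in> A \<Longrightarrow> y \<in> A \<Longrightarrow> x < y \<Longrightarrow> (\<And>z. z \<in> A \<Longrightarrow> z \<le> x \<or> y \<le> z) \<Longrightarrow> r x \<le> r y"
  shows "mono_on A r"
proof -
  have "r x \<le> r y" if "x \<in> A" "y \<in> A" "x < y" for x y
    using that
  proof (induction "card {z \<in> A. x < z \<and> z < y}" arbitrary: y rule: less_induct)
    case less
    show ?case
    proof (cases "\<exists>z\<in>A. x < z \<and> z < y")
      case False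
      then show ?thesis using less.prems by (intro assms(2)) (auto simp: not_less)
    next
      case True
      define z where "z = Max {z \<in> A. x < z \<and> z < y}"
      have z: "z \<in> {z \<in> A. x < z \<and> z < y}"
        unfolding z_def using True assms(1) by (intro Max_in) auto
      have zm: "u \<le> z" if "u \<in> A" "x < u" "u < y" for u
        unfolding z_def using that assms(1) by (intro Max_ge) auto
      have "{u \<in> A. x < u \<and> u < z} \<subset> {u \<in> A. x < u \<and> u < y}" using z by auto
      then have "card {u \<in> A. x < u \<and> u < z} < card {u \<in> A. x < u \<and> u < y}"
        using assms(1) by (intro psubset_card_mono) auto
      then have "r x \<le> r z" using less z by auto
      also have "r z \<le> r y"
      proof (rule assms(2))
        fix u assume "u \<in> A"
        then show "u \<le> z \<or> y \<le> u" using zm[of u] z by fastforce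
      qed (use z less.prems in auto)
      finally show ?thesis .
    qed
  qed
  then show ?thesis by (auto simp: mono_on_def le_less)
qed

text \<open>
  Let \<open>D\<close> and \<open>E\<close> be the cumulative residuals of the two fits and \<open>r = q - p\<close>. Then \<open>U = E - D\<close> is the
  cumulative sum of \<open>k - r\<close>. Where \<open>q\<close> increases, \<open>E = 0\<close> and so \<open>U \<le> 0\<close>; where \<open>p\<close> increases, \<open>D = 0\<close>
  and so \<open>U \<ge> 0\<close>. A positive maximum of \<open>U\<close> would force \<open>r\<close>, and with it \<open>q\<close>, to increase there, so that
  \<open>U \<le> 0\<close> everywhere. If \<open>r\<close> decreases between neighbours \<open>x\<close> and \<open>y\<close>, then \<open>p\<close> increases there, so that
  \<open>U x = 0\<close> is a maximum of \<open>U\<close>; but then \<open>r x \<le> k x \<le> k y \<le> r y\<close>.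
\<close>

lemma isotonic_fit_increment_mono:
  assumes fin: "finite A" and mpos: "\<And>a. a \<in> A \<Longrightarrow> 0 < m a"
    and p: "isotonic_fit A m f p" and q: "isotonic_fit A m (\<lambda>x. f x + k x) q"
    and k: "mono_on A k"
  shows "mono_on A (\<lambda>x. q x - p x)"
proof -
  define D where "D x = (\<Sum>a | a \<in> A \<and> a \<le> x. m a * (f a - p a))" for x
  define E where "E x = (\<Sum>a | a \<in> A \<and> a \<le> x. m a * (f a + k a - q a))" for x
  define r where "r x = q x - p x" for x
  define U where "U x = (\<Sum>a | a \<in> A \<and> a \<le> x. m a * (k a - r a))" for x
  have UED: "U x = E x - D x" for x
    unfolding U_def E_def D_def r_def sum_subtractf[symmetric]
    by (intro sum.cong) (auto simp: algebra_simps)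
  have D0: "0 \<le> D x" "0 < D x \<Longrightarrow> \<exists>y\<in>A. x < y \<and> p y = p x" if "x \<in> A" for x
    using p that by (auto simp: isotonic_fit_def D_def)
  have E0: "0 \<le> E x" "0 < E x \<Longrightarrow> \<exists>y\<in>A. x < y \<and> q y = q x" if "x \<in> A" for x
    using q that by (auto simp: isotonic_fit_def E_def)
  have mp: "mono p" and mq: "mono q" using p q by (auto simp: isotonic_fit_def)
  have step: "U x = (\<Sum>a | a \<in> A \<and> a < x. m a * (k a - r a)) + m x * (k x - r x)" if "x \<in> A" for x
  proof -
    have "{a. a \<in> A \<and> a \<le> x} = insert x {a. a \<in> A \<and> a < x}" using that by auto
    then show ?thesis using fin by (simp add: U_def)
  qed
  have before: "(\<Sum>a | a \<in> A \<and> a < x. m a * (k a - r a)) = 0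
      \<or> (\<exists>x'\<in>A. x' < x \<and> (\<Sum>a | a \<in> A \<and> a < x. m a * (k a - r a)) = U x')" for x
  proof (cases "{a \<in> A. a < x} = {}")
    case True
    then have e: "{a. a \<in> A \<and> a < x} = {}" by simp
    show ?thesis unfolding e by simp
  next
    case False
    define x' where "x' = Max {a \<in> A. a < x}"
    have x': "x' \<in> {a \<in> A. a < x}" using False fin unfolding x'_def by (intro Max_in) auto
    have "{a. a \<in> A \<and> a < x} = {a. a \<in> A \<and> a \<le> x'}"
      using x' fin by (auto simp: x'_def)
    then show ?thesis using x' by (auto simp: U_def)
  qed
  have succ: "U y = U x + m y * (k y - r y)"
    if "x \<in> A" "y \<in> A" "x < y" "\<And>z. z \<in> A \<Longrightarrow> z \<le> x \<or> y \<le> z" for x y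
  proof -
    have "{a. a \<in> A \<and> a < y} = {a. a \<in> A \<and> a \<le> x}" using that by fastforce
    then show ?thesis using step[OF that(2)] by (simp add: U_def)
  qed
  have U_le: "U x \<le> 0" if "x \<in> A" for x
  proof (rule ccontr)
    assume "\<not> U x \<le> 0"
    define u where "u = Max (U ` A)"
    have u_max: "U z \<le> u" if "z \<in> A" for z unfolding u_def using fin that by simp
    then have "0 < u" using \<open>\<not> U x \<le> 0\<close> \<open>x \<in> A\<close> by fastforce
    have "u \<in> U ` A" unfolding u_def using fin that by (intro Max_in) auto
    \<comment> \<open>At the leftmost maximum the last summand of \<open>U\<close> is strictly positive.\<close>
    define b where "b = Min {z \<in> A. U z = u}"
    have b: "b \<in> {z \<in> A. U z = u}" unfolding b_def using fin \<open>u \<in> U ` A\<close> by (intro Min_in) auto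
    have b_min: "b \<le> z" if "z \<in> A" "U z = u" for z unfolding b_def using fin that by (intro Min_le) auto
    have "(\<Sum>a | a \<in> A \<and> a < b. m a * (k a - r a)) < u"
      using before[of b] \<open>0 < u\<close> b_min u_max by fastforce
    then have "0 < m b * (k b - r b)" using step[of b] b by simp
    then have rb: "r b < k b" using mpos[of b] b by (simp add: zero_less_mult_iff)
    have "0 < E b" using UED[of b] D0(1)[of b] b \<open>0 < u\<close> by simp
    then obtain y' where y': "y' \<in> A" "b < y'" "q y' = q b" using E0(2) b by blast
    define y where "y = Min {y \<in> A. b < y}"
    have y: "y \<in> {y \<in> A. b < y}" unfolding y_def using fin y' by (intro Min_in) auto
    have ymin: "y \<le> z" if "z \<in> A" "b < z" for z unfolding y_def using fin that by (intro Min_le) auto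
    have qy: "q y = q b" using mq y y' ymin[of y'] by (metis (no_types, lifting) antisym less_imp_le mem_Collect_eq monoD)
    have "U y = u + m y * (k y - r y)"
      using succ[of b y] b y ymin by (auto simp: not_le) (meson not_le)
    then have "m y * (k y - r y) \<le> 0" using u_max[of y] y by simp
    then have "k y \<le> r y" using mpos[of y] y by (simp add: mult_le_0_iff)
    also have "r y \<le> r b" using qy mp y by (simp add: r_def monoD)
    also have "r b < k b" by fact
    also have "k b \<le> k y" using k b y by (auto simp: mono_on_def)
    finally show False by simp
  qed
  have "mono_on A r"
  proof (rule mono_on_finite_consecutive[OF fin])
    fix x y assume xy: "x \<in> A" "y \<in> A" "x < y" "\<And>z. z \<in> A \<Longrightarrow> z \<le> x \<or> y \<le> z"
    show "r x \<le> r y"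
    proof (rule ccontr)
      assume "\<not> r x \<le> r y"
      then have "p x < p y" using mq xy by (simp add: r_def) (smt (verit) monoD)
      have "\<not> 0 < D x"
      proof
        assume "0 < D x"
        then obtain y' where y': "y' \<in> A" "x < y'" "p y' = p x" using D0 xy by blast
        then have "p y \<le> p y'" using xy(4)[of y'] monoD[OF mp, of y y'] by linarith
        then show False using y' \<open>p x < p y\<close> by simp
      qed
      then have "0 \<le> U x" using UED[of x] D0(1) E0(1) xy by fastforce
      then have U0: "U x = 0" using U_le xy by (simp add: antisym)
      have "(\<Sum>a | a \<in> A \<and> a < x. m a * (k a - r a)) \<le> 0" using before[of x] U_le by auto
      then have "0 \<le> m x * (k x - r x)" using step xy U0 by simp
      then have "r x \<le> k x" using mpos[of x] xy by (simp add: zero_le_mult_iff)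
      also have "k x \<le> k y" using k xy by (auto simp: mono_on_def)
      also have "k y \<le> r y"
      proof -
        have "m y * (k y - r y) \<le> 0" using succ[OF xy] U0 U_le[OF xy(2)] by simp
        then show ?thesis using mpos[of y] xy by (simp add: mult_le_0_iff)
      qed
      finally show False using \<open>\<not> r x \<le> r y\<close> by simp
    qed
  qed
  then show ?thesis by (simp add: r_def[abs_def])
qed

section \<open>Projection onto the nondecreasing functions\<close>

text \<open>
  The variational characterisation of the metric projection of \<open>f\<close> onto the convex cone of
  nondecreasing functions in \<open>L\<^sup>2(\<mu>)\<close>.
\<close>

definition isotonic_projection :: "real measure \<Rightarrow> (real \<Rightarrow> real) \<Rightarrow> (real \<Rightarrow> real) \<Rightarrow> bool" where
  "isotonic_projection \<mu> f X \<longleftrightarrow>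
     mono X \<and> X \<in> L2 \<mu> \<and> (\<integral>y. (f y - X y) * X y \<partial>\<mu>) = 0
   \<and> (\<forall>w. mono w \<longrightarrow> w \<in> L2 \<mu> \<longrightarrow> (\<integral>y. (f y - X y) * w y \<partial>\<mu>) \<le> 0)"

text \<open>
  Each projection is tested with the other one, and the two inequalities are added.
\<close>

lemma isotonic_projection_contraction:
  assumes f: "f \<in> L2 \<mu>" and g: "g \<in> L2 \<mu>"
    and X: "isotonic_projection \<mu> f X" and Y: "isotonic_projection \<mu> g Y"
  shows "L2_dist \<mu> X Y \<le> L2_dist \<mu> f g"
proof -
  have XY: "X \<in> L2 \<mu>" "Y \<in> L2 \<mu>" using X Y by (auto simp: isotonic_projection_def)
  note i = L2_mult_integrable L2_diff
  have "(\<integral>y. (X y - Y y)\<^sup>2 \<partial>\<mu>)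
      = (\<integral>y. (f y - g y) * (X y - Y y) - ((f y - X y) * X y - (f y - X y) * Y y)
             - ((g y - Y y) * Y y - (g y - Y y) * X y) \<partial>\<mu>)"
    by (intro Bochner_Integration.integral_cong) (auto simp: power2_eq_square algebra_simps)
  also have "\<dots> = (\<integral>y. (f y - g y) * (X y - Y y) \<partial>\<mu>)
     - ((\<integral>y. (f y - X y) * X y \<partial>\<mu>) - (\<integral>y. (f y - X y) * Y y \<partial>\<mu>))
     - ((\<integral>y. (g y - Y y) * Y y \<partial>\<mu>) - (\<integral>y. (g y - Y y) * X y \<partial>\<mu>))"
    using f g XY by (simp add: L2_mult_integrable L2_diff)
  also have "\<dots> \<le> (\<integral>y. (f y - g y) * (X y - Y y) \<partial>\<mu>)"
  proof -
    have "(\<integral>y. (f y - X y) * Y y \<partial>\<mu>) \<le> 0" "(\<integral>y. (g y - Y y) * X y \<partial>\<mu>) \<le> 0"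
         "(\<integral>y. (f y - X y) * X y \<partial>\<mu>) = 0" "(\<integral>y. (g y - Y y) * Y y \<partial>\<mu>) = 0"
      using X Y by (auto simp: isotonic_projection_def)
    then show ?thesis by linarith
  qed
  also have "\<dots> \<le> L2_dist \<mu> f g * L2_dist \<mu> X Y"
    using L2_Cauchy_Schwarz[OF L2_diff[OF f g] L2_diff[OF XY]] by (simp add: L2_dist_eq_norm)
  finally have "(L2_dist \<mu> X Y)\<^sup>2 \<le> L2_dist \<mu> f g * L2_dist \<mu> X Y"
    by (simp add: L2_dist_eq_norm L2_norm_power2)
  then show ?thesis
    using L2_dist_nonneg[of \<mu> X Y] L2_dist_nonneg[of \<mu> f g]
    by (cases "L2_dist \<mu> X Y = 0") (auto simp: power2_eq_square)
qed

lemma isotonic_projection_limit: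
  assumes f: "\<And>n. f n \<in> L2 \<mu>" "g \<in> L2 \<mu>" "(\<lambda>n. L2_dist \<mu> (f n) g) \<longlonglongrightarrow> 0"
    and X: "\<And>n. isotonic_projection \<mu> (f n) (X n)" "(\<lambda>n. L2_dist \<mu> (X n) Y) \<longlonglongrightarrow> 0"
    and Y: "mono Y" "Y \<in> L2 \<mu>"
  shows "isotonic_projection \<mu> g Y"
proof -
  have XL: "X n \<in> L2 \<mu>" for n using X by (auto simp: isotonic_projection_def)
  have split: "(\<integral>y. (f n y - X n y) * w y \<partial>\<mu>) = (\<integral>y. f n y * w y \<partial>\<mu>) - (\<integral>y. X n y * w y \<partial>\<mu>)"
    if "w \<in> L2 \<mu>" for n w
    using that f(1) XL by (simp add: left_diff_distrib L2_mult_integrable)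
  have split': "(\<integral>y. (g y - Y y) * w y \<partial>\<mu>) = (\<integral>y. g y * w y \<partial>\<mu>) - (\<integral>y. Y y * w y \<partial>\<mu>)"
    if "w \<in> L2 \<mu>" for w
    using that f(2) Y(2) by (simp add: left_diff_distrib L2_mult_integrable)
  have L: "(\<lambda>n. \<integral>y. (f n y - X n y) * w n y \<partial>\<mu>) \<longlonglongrightarrow> (\<integral>y. (g y - Y y) * v y \<partial>\<mu>)"
    if "\<And>n. w n \<in> L2 \<mu>" "v \<in> L2 \<mu>" "(\<lambda>n. L2_dist \<mu> (w n) v) \<longlonglongrightarrow> 0" for w v
    unfolding split[OF that(1)] split'[OF that(2)]
    by (intro tendsto_diff L2_convergent_inner f XL X Y that)
  show ?thesis
    unfolding isotonic_projection_def
  proof (intro conjI allI impI)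
    have "(\<lambda>n. \<integral>y. (f n y - X n y) * X n y \<partial>\<mu>) = (\<lambda>n. 0)"
      using X by (auto simp: isotonic_projection_def)
    with L[OF XL Y(2) X(2)] show "(\<integral>y. (g y - Y y) * Y y \<partial>\<mu>) = 0"
      by (simp add: LIMSEQ_const_iff)
  next
    fix w assume w: "mono w" "w \<in> L2 \<mu>"
    have "L2_dist \<mu> w w = 0" by (simp add: L2_dist_def)
    then have "(\<lambda>n. \<integral>y. (f n y - X n y) * w y \<partial>\<mu>) \<longlonglongrightarrow> (\<integral>y. (g y - Y y) * w y \<partial>\<mu>)"
      using w by (intro L) auto
    then show "(\<integral>y. (g y - Y y) * w y \<partial>\<mu>) \<le> 0"
      by (rule LIMSEQ_le_const2) (use w X in \<open>auto simp: isotonic_projection_def\<close>)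
  qed (use Y in auto)
qed

definition cell_mass :: "real measure \<Rightarrow> (real \<Rightarrow> real) \<Rightarrow> real \<Rightarrow> real" where
  "cell_mass \<mu> \<pi> a = measure \<mu> (\<pi> -` {a})"

text \<open>
  Values taken only on a null set are left out, because a finite fit needs positive weights.
\<close>

definition cells :: "real measure \<Rightarrow> (real \<Rightarrow> real) \<Rightarrow> real set" where
  "cells \<mu> \<pi> = {a \<in> range \<pi>. 0 < cell_mass \<mu> \<pi> a}"

lemma finite_cells: "finite (range \<pi>) \<Longrightarrow> finite (cells \<mu> \<pi>)"
  by (simp add: cells_def)

lemma monotone_cell_measurable:
  assumes "mono (\<pi> :: real \<Rightarrow> real)" shows "\<pi> -` {a} \<in> sets borel"
  using measurable_sets_borel[OF borel_measurable_mono[OF assms], of "{a}"] by simp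

lemma AE_in_cells:
  assumes "real_distribution \<mu>" "mono \<pi>" "finite (range \<pi>)"
  shows "AE y in \<mu>. \<pi> y \<in> cells \<mu> \<pi>"
proof -
  interpret real_distribution \<mu> by fact
  have "AE y in \<mu>. \<forall>a\<in>range \<pi> - cells \<mu> \<pi>. \<pi> y \<noteq> a"
  proof (rule AE_finite_allI)
    show "finite (range \<pi> - cells \<mu> \<pi>)" using assms by simp
    fix a assume "a \<in> range \<pi> - cells \<mu> \<pi>"
    then have "measure \<mu> (\<pi> -` {a}) = 0"
      by (auto simp: cells_def cell_mass_def zero_less_measure_iff)
    moreover have "\<pi> -` {a} \<in> sets \<mu>" using monotone_cell_measurable[OF assms(2)] by simp
    ultimately have "\<pi> -` {a} \<in> null_sets \<mu>"
      by (simp add: null_sets_def emeasure_eq_measure)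
    from AE_not_in[OF this] show "AE y in \<mu>. \<pi> y \<noteq> a" by simp
  qed
  then show ?thesis by eventually_elim auto
qed

lemma step_function_L2:
  fixes \<pi> \<phi> :: "real \<Rightarrow> real"
  assumes "real_distribution \<mu>" "mono \<pi>" "finite (range \<pi>)"
  shows "(\<lambda>y. \<phi> (\<pi> y)) \<in> L2 \<mu>"
proof -
  interpret real_distribution \<mu> by fact
  have e: "(\<lambda>y. \<phi> (\<pi> y)) = (\<lambda>y. \<Sum>a\<in>range \<pi>. \<phi> a * indicator (\<pi> -` {a}) y)"
  proof
    fix y
    have "(\<Sum>a\<in>range \<pi>. \<phi> a * indicator (\<pi> -` {a}) y) = (\<Sum>a\<in>range \<pi>. if a = \<pi> y then \<phi> a else 0)"
      by (intro sum.cong) (auto simp: indicator_def)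
    then show "\<phi> (\<pi> y) = (\<Sum>a\<in>range \<pi>. \<phi> a * indicator (\<pi> -` {a}) y)"
      using assms(3) by simp
  qed
  have m: "(\<lambda>y. \<phi> (\<pi> y)) \<in> borel_measurable \<mu>"
    unfolding e using monotone_cell_measurable[OF assms(2)]
    by (intro borel_measurable_sum borel_measurable_times borel_measurable_indicator) auto
  have "\<bar>\<phi> (\<pi> y)\<bar> \<le> Max ((\<lambda>a. \<bar>\<phi> a\<bar>) ` range \<pi>)" for y
    using assms(3) by (intro Max_ge) auto
  then have "AE y in \<mu>. \<bar>\<phi> (\<pi> y)\<bar> \<le> \<bar>Max ((\<lambda>a. \<bar>\<phi> a\<bar>) ` range \<pi>)\<bar>"
    by (intro always_eventually) (meson abs_ge_self order_trans)
  from L2_bound[OF L2_const[OF finite_measure_axioms] m this] show ?thesis .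
qed

lemma integral_step_function_mult:
  fixes \<pi> \<phi> w :: "real \<Rightarrow> real"
  assumes "real_distribution \<mu>" "mono \<pi>" "finite (range \<pi>)" "integrable \<mu> w"
  shows "(\<integral>y. \<phi> (\<pi> y) * w y \<partial>\<mu>) = (\<Sum>a\<in>cells \<mu> \<pi>. \<phi> a * (\<integral>y. indicator (\<pi> -` {a}) y * w y \<partial>\<mu>))"
proof -
  interpret real_distribution \<mu> by fact
  have [measurable]: "\<pi> -` {a} \<in> sets \<mu>" for a using monotone_cell_measurable[OF assms(2)] by simp
  have int: "integrable \<mu> (\<lambda>y. indicator (\<pi> -` {a}) y * w y)" for a
    using integrable_real_mult_indicator[of "\<pi> -` {a}" \<mu> w] assms(4) monotone_cell_measurable[OF assms(2)]
    by (simp add: mult.commute)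
  have "(\<integral>y. \<phi> (\<pi> y) * w y \<partial>\<mu>) = (\<integral>y. (\<Sum>a\<in>cells \<mu> \<pi>. \<phi> a * (indicator (\<pi> -` {a}) y * w y)) \<partial>\<mu>)"
  proof (rule integral_cong_AE)
    have "(\<lambda>y. \<phi> (\<pi> y)) \<in> borel_measurable \<mu>" "w \<in> borel_measurable \<mu>"
      using step_function_L2[OF assms(1-3), of \<phi>] assms(4) by (auto dest: L2_measurable)
    then show "(\<lambda>y. \<phi> (\<pi> y) * w y) \<in> borel_measurable \<mu>" by measurable
    show "(\<lambda>y. \<Sum>a\<in>cells \<mu> \<pi>. \<phi> a * (indicator (\<pi> -` {a}) y * w y)) \<in> borel_measurable \<mu>"
      using borel_measurable_integrable[OF int]
      by (intro borel_measurable_sum borel_measurable_times[OF borel_measurable_const]) simp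
    show "AE y in \<mu>. \<phi> (\<pi> y) * w y = (\<Sum>a\<in>cells \<mu> \<pi>. \<phi> a * (indicator (\<pi> -` {a}) y * w y))"
      using AE_in_cells[OF assms(1-3)]
    proof eventually_elim
      fix y assume y: "\<pi> y \<in> cells \<mu> \<pi>"
      have "(\<Sum>a\<in>cells \<mu> \<pi>. \<phi> a * (indicator (\<pi> -` {a}) y * w y))
          = (\<Sum>a\<in>cells \<mu> \<pi>. if a = \<pi> y then \<phi> a * w y else 0)"
        by (intro sum.cong) (auto simp: indicator_def)
      also have "\<dots> = \<phi> (\<pi> y) * w y" using y finite_cells[OF assms(3)] by simp
      finally show "\<phi> (\<pi> y) * w y = (\<Sum>a\<in>cells \<mu> \<pi>. \<phi> a * (indicator (\<pi> -` {a}) y * w y))" by simp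
    qed
  qed
  also have "\<dots> = (\<Sum>a\<in>cells \<mu> \<pi>. \<phi> a * (\<integral>y. indicator (\<pi> -` {a}) y * w y \<partial>\<mu>))"
    using int by (subst Bochner_Integration.integral_sum) auto
  finally show ?thesis .
qed

text \<open>
  The cells of a nondecreasing map are ordered like its values, so that every value of \<open>w\<close> on an
  earlier cell is below every value on a later one.
\<close>

lemma cell_average_mono:
  assumes "real_distribution \<mu>" "mono \<pi>" "mono w" "integrable \<mu> w"
  shows "mono_on (cells \<mu> \<pi>) (\<lambda>a. (\<integral>y. indicator (\<pi> -` {a}) y * w y \<partial>\<mu>) / cell_mass \<mu> \<pi> a)"
proof (rule mono_onI)
  interpret real_distribution \<mu> by fact
  have [measurable]: "\<pi> -` {a} \<in> sets \<mu>" for a using monotone_cell_measurable[OF assms(2)] by simp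
  have int: "integrable \<mu> (\<lambda>y. indicator (\<pi> -` {a}) y * w y)" for a
    using integrable_real_mult_indicator[of "\<pi> -` {a}" \<mu> w] assms(4) monotone_cell_measurable[OF assms(2)]
    by (simp add: mult.commute)
  have intc: "integrable \<mu> (\<lambda>y. indicator (\<pi> -` {a}) y * c)" for a and c :: real
    using monotone_cell_measurable[OF assms(2), of a]
    by (intro integrable_mult_left integrable_real_indicator) (auto simp: emeasure_eq_measure)
  have cst: "(\<integral>y. indicator (\<pi> -` {a}) y * c \<partial>\<mu>) = cell_mass \<mu> \<pi> a * c" for a c
    by (simp add: cell_mass_def)
  fix a b assume ab: "a \<in> cells \<mu> \<pi>" "b \<in> cells \<mu> \<pi>" "a \<le> b"
  show "(\<integral>y. indicator (\<pi> -` {a}) y * w y \<partial>\<mu>) / cell_mass \<mu> \<pi> a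
      \<le> (\<integral>y. indicator (\<pi> -` {b}) y * w y \<partial>\<mu>) / cell_mass \<mu> \<pi> b"
  proof (cases "a = b")
    case False
    have pos: "0 < cell_mass \<mu> \<pi> a" "0 < cell_mass \<mu> \<pi> b" using ab by (auto simp: cells_def)
    have le: "w x \<le> w y" if "\<pi> x = a" "\<pi> y = b" for x y
    proof -
      have "x \<le> y" using that ab False monoD[OF assms(2), of y x] by (cases "x \<le> y") auto
      then show ?thesis using assms(3) by (rule monoD[rotated])
    qed
    have "(\<integral>y. indicator (\<pi> -` {a}) y * w y \<partial>\<mu>) / cell_mass \<mu> \<pi> a \<le> w y" if "\<pi> y = b" for y
    proof -
      have "(\<integral>x. indicator (\<pi> -` {a}) x * w x \<partial>\<mu>) \<le> (\<integral>x. indicator (\<pi> -` {a}) x * w y \<partial>\<mu>)"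
        using int intc le that by (intro integral_mono) (auto simp: indicator_def)
      then show ?thesis using pos unfolding cst by (simp add: field_simps)
    qed
    then have "(\<integral>y. indicator (\<pi> -` {b}) y * ((\<integral>y. indicator (\<pi> -` {a}) y * w y \<partial>\<mu>) / cell_mass \<mu> \<pi> a) \<partial>\<mu>)
        \<le> (\<integral>y. indicator (\<pi> -` {b}) y * w y \<partial>\<mu>)"
      using int intc by (intro integral_mono) (auto simp: indicator_def)
    then show ?thesis using pos unfolding cst by (simp add: field_simps)
  qed simp
qed

text \<open>
  For a step function on the left, testing with \<open>w\<close> amounts to testing with the cell averages of \<open>w\<close>,
  which are again nondecreasing.
\<close>

lemma isotonic_fit_imp_projection:
  assumes \<mu>: "real_distribution \<mu>" and \<pi>: "mono \<pi>" "finite (range \<pi>)"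
    and fit: "isotonic_fit (cells \<mu> \<pi>) (cell_mass \<mu> \<pi>) f p"
  shows "isotonic_projection \<mu> (\<lambda>y. f (\<pi> y)) (\<lambda>y. p (\<pi> y))"
proof -
  interpret real_distribution \<mu> by fact
  note L = step_function_L2[OF \<mu> \<pi>]
  have [measurable]: "\<pi> -` {a} \<in> sets \<mu>" for a using monotone_cell_measurable[OF \<pi>(1)] by simp
  have "(\<integral>y. (f (\<pi> y) - p (\<pi> y)) * p (\<pi> y) \<partial>\<mu>) = (\<integral>y. ((f (\<pi> y) - p (\<pi> y)) * p (\<pi> y)) * 1 \<partial>\<mu>)"
    by simp
  also have "\<dots> = (\<Sum>a\<in>cells \<mu> \<pi>. (f a - p a) * p a * (\<integral>y. indicator (\<pi> -` {a}) y * 1 \<partial>\<mu>))"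
    by (rule integral_step_function_mult[OF \<mu> \<pi>, of "\<lambda>_. 1" "\<lambda>a. (f a - p a) * p a"]) simp
  also have "\<dots> = (\<Sum>a\<in>cells \<mu> \<pi>. cell_mass \<mu> \<pi> a * (f a - p a) * p a)"
    by (intro sum.cong) (auto simp: cell_mass_def)
  also have "\<dots> = 0" using fit by (simp add: isotonic_fit_def)
  finally have 1: "(\<integral>y. (f (\<pi> y) - p (\<pi> y)) * p (\<pi> y) \<partial>\<mu>) = 0" .
  have 2: "(\<integral>y. (f (\<pi> y) - p (\<pi> y)) * w y \<partial>\<mu>) \<le> 0" if w: "mono w" "w \<in> L2 \<mu>" for w
  proof -
    have wi: "integrable \<mu> w" using w L2_integrable finite_measure_axioms by blast
    let ?w = "\<lambda>a. (\<integral>y. indicator (\<pi> -` {a}) y * w y \<partial>\<mu>) / cell_mass \<mu> \<pi> a"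
    have "(\<integral>y. (f (\<pi> y) - p (\<pi> y)) * w y \<partial>\<mu>)
       = (\<Sum>a\<in>cells \<mu> \<pi>. (f a - p a) * (\<integral>y. indicator (\<pi> -` {a}) y * w y \<partial>\<mu>))"
      by (rule integral_step_function_mult[OF \<mu> \<pi> wi, of "\<lambda>a. f a - p a"])
    also have "\<dots> = (\<Sum>a\<in>cells \<mu> \<pi>. cell_mass \<mu> \<pi> a * (f a - p a) * ?w a)"
      by (intro sum.cong) (auto simp: cells_def)
    also have "\<dots> \<le> 0"
      by (intro isotonic_fit_variational finite_cells \<pi> fit cell_average_mono \<mu> w wi)
    finally show ?thesis .
  qed
  have "mono p" using fit by (simp add: isotonic_fit_def)
  then have "mono (\<lambda>y. p (\<pi> y))" using \<pi>(1) by (simp add: mono_def)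
  then show ?thesis using 1 2 L[of p] by (simp add: isotonic_projection_def)
qed

text \<open>
  Rounding down to multiples of \<open>1 / (n + 1)\<close>, truncated to \<open>[-n, n]\<close>. Being nondecreasing with finite
  range, it reduces projections to finite fits.
\<close>

definition grid_round :: "nat \<Rightarrow> real \<Rightarrow> real" where
  "grid_round n x = real_of_int (max (- int (n * Suc n)) (min (int (n * Suc n)) \<lfloor>real (Suc n) * x\<rfloor>)) / real (Suc n)"

lemma grid_round_mono: "mono (grid_round n)"
  unfolding grid_round_def
  by (intro monoI divide_right_mono of_int_le_iff[THEN iffD2] max.mono min.mono floor_mono mult_left_mono) auto

lemma grid_round_finite_range: "finite (range (grid_round n))"
proof (rule finite_subset)
  show "range (grid_round n) \<subseteq> (\<lambda>k. real_of_int k / real (Suc n)) ` {- int (n * Suc n) .. int (n * Suc n)}"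
    unfolding grid_round_def by (auto simp del: of_nat_Suc of_nat_mult intro!: image_eqI[OF refl])
qed simp

lemma grid_round_abs_le: "\<bar>grid_round n x\<bar> \<le> \<bar>x\<bar> + 1"
proof -
  have "\<bar>max (- N) (min N k)\<bar> \<le> \<bar>k\<bar>" if "0 \<le> N" for N k :: int using that by auto
  from this[of "int (n * Suc n)" "\<lfloor>real (Suc n) * x\<rfloor>"]
  have "\<bar>grid_round n x\<bar> \<le> \<bar>real_of_int \<lfloor>real (Suc n) * x\<rfloor>\<bar> / real (Suc n)"
    unfolding grid_round_def abs_divide
    by (intro divide_mono) (auto simp del: of_nat_Suc of_nat_mult simp flip: of_int_abs)
  also have "\<dots> \<le> (real (Suc n) * \<bar>x\<bar> + 1) / real (Suc n)"
  proof (intro divide_right_mono)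
    have "\<bar>real_of_int \<lfloor>z\<rfloor>\<bar> \<le> \<bar>z\<bar> + 1" for z :: real by linarith
    from this[of "real (Suc n) * x"]
    show "\<bar>real_of_int \<lfloor>real (Suc n) * x\<rfloor>\<bar> \<le> real (Suc n) * \<bar>x\<bar> + 1" by (simp add: abs_mult)
  qed simp
  also have "\<dots> \<le> \<bar>x\<bar> + 1" by (simp add: field_simps)
  finally show ?thesis .
qed

lemma grid_round_tendsto: "(\<lambda>n. grid_round n x) \<longlonglongrightarrow> x"
proof -
  have "(\<lambda>n. grid_round n x - x) \<longlonglongrightarrow> 0"
  proof (rule Lim_null_comparison)
    show "(\<lambda>n. 1 / real (Suc n)) \<longlonglongrightarrow> 0" using LIMSEQ_inverse_real_of_nat by (simp add: inverse_eq_divide)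
    show "\<forall>\<^sub>F n in sequentially. norm (grid_round n x - x) \<le> 1 / real (Suc n)"
    proof (rule eventually_sequentiallyI)
      fix n assume n: "nat \<lceil>\<bar>x\<bar>\<rceil> \<le> n"
      then have xn: "\<bar>x\<bar> \<le> real n" by linarith
      have "real (Suc n) * \<bar>x\<bar> \<le> real (Suc n) * real n" using xn by (intro mult_left_mono) auto
      then have "\<bar>real (Suc n) * x\<bar> \<le> real (n * Suc n)"
        unfolding abs_mult of_nat_mult by (simp only: abs_of_nat mult.commute)
      then have "- int (n * Suc n) \<le> \<lfloor>real (Suc n) * x\<rfloor>" "\<lfloor>real (Suc n) * x\<rfloor> \<le> int (n * Suc n)"
        by linarith+
      then have "grid_round n x = real_of_int \<lfloor>real (Suc n) * x\<rfloor> / real (Suc n)"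
        unfolding grid_round_def by (simp del: of_nat_Suc of_nat_mult)
      then have "grid_round n x - x = (real_of_int \<lfloor>real (Suc n) * x\<rfloor> - real (Suc n) * x) / real (Suc n)"
        by (simp add: field_simps)
      also have "\<bar>\<dots>\<bar> \<le> 1 / real (Suc n)"
        unfolding abs_divide by (intro divide_mono) (auto simp del: of_nat_Suc, linarith)
      finally show "norm (grid_round n x - x) \<le> 1 / real (Suc n)" by simp
    qed
  qed
  then show ?thesis by (simp add: LIM_zero_iff)
qed

lemma grid_round_L2_tendsto:
  assumes \<mu>: "real_distribution \<mu>" and m2: "integrable \<mu> (\<lambda>x. x\<^sup>2)"
    and f: "continuous_on UNIV f" and C: "\<And>x. \<bar>f x\<bar> \<le> C * (1 + \<bar>x\<bar>)"
  shows "f \<in> L2 \<mu>" "(\<lambda>n. L2_dist \<mu> (\<lambda>y. f (grid_round n y)) f) \<longlonglongrightarrow> 0"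
proof -
  interpret real_distribution \<mu> by fact
  have idL: "(\<lambda>x. \<bar>x\<bar>) \<in> L2 \<mu>" using m2 by (auto simp: L2_def)
  have lin: "(\<lambda>x. a + b * \<bar>x\<bar>) \<in> L2 \<mu>" for a b :: real
    by (intro L2_add L2_const L2_cmult idL finite_measure_axioms)
  have fm[measurable]: "f \<in> borel_measurable \<mu>" using borel_measurable_continuous_onI[OF f] by simp
  have C0: "0 \<le> C" using C[of 0] by simp
  show fL: "f \<in> L2 \<mu>"
  proof (rule L2_bound[OF lin[of C C] fm], rule AE_I2)
    fix x show "\<bar>f x\<bar> \<le> \<bar>C + C * \<bar>x\<bar>\<bar>"
      using C[of x] by (simp add: distrib_left)
  qed
  have rL: "(\<lambda>y. f (grid_round n y)) \<in> L2 \<mu>" for n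
    by (rule step_function_L2[OF \<mu> grid_round_mono grid_round_finite_range])
  have "(\<lambda>n. \<integral>y. (f (grid_round n y) - f y)\<^sup>2 \<partial>\<mu>) \<longlonglongrightarrow> (\<integral>y. 0 \<partial>\<mu>)"
  proof (rule integral_dominated_convergence)
    show "integrable \<mu> (\<lambda>y. (3 * C + 2 * C * \<bar>y\<bar>)\<^sup>2)"
      by (rule L2_square_integrable[OF lin])
    show "(\<lambda>y. (f (grid_round n y) - f y)\<^sup>2) \<in> borel_measurable \<mu>" for n
      using L2_measurable[OF rL[of n]] by measurable
    show "AE y in \<mu>. (\<lambda>n. (f (grid_round n y) - f y)\<^sup>2) \<longlonglongrightarrow> 0"
    proof (rule AE_I2)
      fix y
      have "(\<lambda>n. f (grid_round n y)) \<longlonglongrightarrow> f y"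
        by (rule continuous_on_tendsto_compose[OF f grid_round_tendsto]) auto
      then have "(\<lambda>n. (f (grid_round n y) - f y)\<^sup>2) \<longlonglongrightarrow> (f y - f y)\<^sup>2"
        by (intro tendsto_intros)
      then show "(\<lambda>n. (f (grid_round n y) - f y)\<^sup>2) \<longlonglongrightarrow> 0" by simp
    qed
    show "AE y in \<mu>. norm ((f (grid_round n y) - f y)\<^sup>2) \<le> (3 * C + 2 * C * \<bar>y\<bar>)\<^sup>2" for n
    proof (rule AE_I2)
      fix y
      have "\<bar>f (grid_round n y)\<bar> \<le> C * (1 + (\<bar>y\<bar> + 1))"
        using C[of "grid_round n y"] mult_left_mono[OF _ C0, of "1 + \<bar>grid_round n y\<bar>" "1 + (\<bar>y\<bar> + 1)"]
          grid_round_abs_le[of n y] by linarith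
      then have "\<bar>f (grid_round n y) - f y\<bar> \<le> 3 * C + 2 * C * \<bar>y\<bar>"
        using C[of y] by (simp add: algebra_simps)
      then show "norm ((f (grid_round n y) - f y)\<^sup>2) \<le> (3 * C + 2 * C * \<bar>y\<bar>)\<^sup>2"
        by (simp add: abs_le_square_iff[symmetric])
    qed
  qed simp
  then have "(\<lambda>n. sqrt (\<integral>y. (f (grid_round n y) - f y)\<^sup>2 \<partial>\<mu>)) \<longlonglongrightarrow> sqrt 0"
    by (intro tendsto_real_sqrt) simp
  then show "(\<lambda>n. L2_dist \<mu> (\<lambda>y. f (grid_round n y)) f) \<longlonglongrightarrow> 0"
    by (simp add: L2_dist_def)
qed

text \<open>
  If \<open>a\<close> is a nondecreasing contraction of \<open>b\<close> on \<open>S\<close>, it extends to one defined on the whole line, by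
  the one-sided McShane formula \<open>INF e\<in>S. a e + max 0 (x - b e)\<close>. It serves twice: to replace an almost
  everywhere defined projection by a continuous function, and to write a later position as a
  function of an earlier one.
\<close>

lemma monotone_lipschitz_factor:
  fixes a b :: "'a \<Rightarrow> real"
  assumes "S \<noteq> {}"
    and ab: "\<And>y z. y \<in> S \<Longrightarrow> z \<in> S \<Longrightarrow> b y \<le> b z \<Longrightarrow> 0 \<le> a z - a y \<and> a z - a y \<le> b z - b y"
  obtains \<phi> :: "real \<Rightarrow> real"
  where "\<And>x y. x \<le> y \<Longrightarrow> 0 \<le> \<phi> y - \<phi> x \<and> \<phi> y - \<phi> x \<le> y - x" "\<And>y. y \<in> S \<Longrightarrow> \<phi> (b y) = a y"
proof -
  define g where "g x e = a e + max 0 (x - b e)" for x e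
  define \<phi> where "\<phi> x = (INF e\<in>S. g x e)" for x
  obtain e0 where e0: "e0 \<in> S" using assms(1) by blast
  have bdd: "bdd_below (g x ` S)" for x
  proof (rule bdd_belowI2)
    fix e assume "e \<in> S"
    then show "min (a e0) (a e0 - b e0 + x) \<le> g x e"
      using ab[OF e0, of e] ab[OF _ e0, of e] by (cases "b e0 \<le> b e") (auto simp: g_def)
  qed
  show ?thesis
  proof
    fix x y :: real assume xy: "x \<le> y"
    have "\<phi> x \<le> \<phi> y"
      unfolding \<phi>_def
    proof (rule cINF_mono[OF assms(1) bdd])
      fix e assume "e \<in> S"
      moreover have "g x e \<le> g y e" using xy by (auto simp: g_def)
      ultimately show "\<exists>e'\<in>S. g x e' \<le> g y e" by blast
    qed
    moreover have "\<phi> y - (y - x) \<le> \<phi> x"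
      unfolding \<phi>_def[of x]
    proof (rule cINF_greatest[OF assms(1)])
      fix e assume e: "e \<in> S"
      have "\<phi> y \<le> g y e" unfolding \<phi>_def by (rule cINF_lower[OF bdd e])
      also have "\<dots> \<le> g x e + (y - x)" using xy by (auto simp: g_def)
      finally show "\<phi> y - (y - x) \<le> g x e" by simp
    qed
    ultimately show "0 \<le> \<phi> y - \<phi> x \<and> \<phi> y - \<phi> x \<le> y - x" by simp
  next
    fix y assume y: "y \<in> S"
    have "\<phi> (b y) \<le> g (b y) y" unfolding \<phi>_def by (rule cINF_lower[OF bdd y])
    moreover have "a y \<le> \<phi> (b y)"
      unfolding \<phi>_def
    proof (rule cINF_greatest[OF assms(1)])
      fix e assume "e \<in> S"
      then show "a y \<le> g (b y) e"
        using ab[OF y, of e] ab[OF _ y, of e] by (cases "b y \<le> b e") (auto simp: g_def)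
    qed
    ultimately show "\<phi> (b y) = a y" by (simp add: g_def)
  qed
qed

text \<open>
  A fixed choice of fit, so that the limits for different data can be taken along the same sequence.
\<close>

definition step_fit :: "real measure \<Rightarrow> nat \<Rightarrow> (real \<Rightarrow> real) \<Rightarrow> real \<Rightarrow> real" where
  "step_fit \<mu> n f = (SOME p. isotonic_fit (cells \<mu> (grid_round n)) (cell_mass \<mu> (grid_round n)) f p)"

lemma step_fit:
  "isotonic_fit (cells \<mu> (grid_round n)) (cell_mass \<mu> (grid_round n)) f (step_fit \<mu> n f)"
proof -
  have "\<exists>p. isotonic_fit (cells \<mu> (grid_round n)) (cell_mass \<mu> (grid_round n)) f p"
    by (rule isotonic_fit_exists) (auto simp: cells_def grid_round_finite_range)
  then show ?thesis unfolding step_fit_def by (rule someI_ex)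
qed

text \<open>
  Rounded points that carry mass inherit the comparison of the finite fits.
\<close>

lemma step_fit_increment_le:
  assumes "mono (\<lambda>x. g x - f x)" "y \<le> z"
    and "grid_round n y \<in> cells \<mu> (grid_round n)" "grid_round n z \<in> cells \<mu> (grid_round n)"
    and "isotonic_fit (cells \<mu> (grid_round n)) (cell_mass \<mu> (grid_round n)) g q"
  shows "step_fit \<mu> n f (grid_round n z) - step_fit \<mu> n f (grid_round n y)
       \<le> q (grid_round n z) - q (grid_round n y)"
proof -
  have "mono_on (cells \<mu> (grid_round n)) (\<lambda>x. q x - step_fit \<mu> n f x)"
  proof (rule isotonic_fit_increment_mono[OF _ _ step_fit])
    show "finite (cells \<mu> (grid_round n))" by (intro finite_cells grid_round_finite_range)
    show "isotonic_fit (cells \<mu> (grid_round n)) (cell_mass \<mu> (grid_round n)) (\<lambda>x. f x + (g x - f x)) q"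
      using assms(5) by simp
    show "mono_on (cells \<mu> (grid_round n)) (\<lambda>x. g x - f x)"
      using assms(1) by (auto simp: mono_def mono_on_def)
  qed (auto simp: cells_def)
  from mono_onD[OF this assms(3,4) monoD[OF grid_round_mono assms(2)]] show ?thesis by simp
qed

text \<open>
  The rounded data converge in \<open>L\<^sup>2(\<mu>)\<close>, so their projections form a Cauchy sequence. The bound on
  increments by those of \<open>G\<close>, which is its own fit, survives in the limit on a set of full measure; there
  the limit is a nondecreasing contraction of \<open>G\<close>, and extending it as such gives a representative with the
  bound everywhere.
\<close>

lemma step_fit_converges:
  assumes \<mu>: "real_distribution \<mu>" and m2: "integrable \<mu> (\<lambda>x. x\<^sup>2)"
    and f: "continuous_on UNIV f" and C: "\<And>x. \<bar>f x\<bar> \<le> C * (1 + \<bar>x\<bar>)"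
    and G: "continuous_on UNIV G" "mono G" "mono (\<lambda>x. G x - f x)"
  obtains X where "isotonic_projection \<mu> f X"
    "\<And>y z. y \<le> z \<Longrightarrow> 0 \<le> X z - X y \<and> X z - X y \<le> G z - G y"
    "(\<lambda>n. L2_dist \<mu> (\<lambda>y. step_fit \<mu> n f (grid_round n y)) X) \<longlonglongrightarrow> 0"
proof -
  interpret real_distribution \<mu> by fact
  have ps: "prob_space \<mu>" by unfold_locales
  define F where "F n = (\<lambda>y. f (grid_round n y))" for n
  define u where "u n = (\<lambda>y. step_fit \<mu> n f (grid_round n y))" for n
  have FL: "F n \<in> L2 \<mu>" for n
    unfolding F_def by (rule step_function_L2[OF \<mu> grid_round_mono grid_round_finite_range])
  have uL: "u n \<in> L2 \<mu>" for n
    unfolding u_def by (rule step_function_L2[OF \<mu> grid_round_mono grid_round_finite_range])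
  note fL = grid_round_L2_tendsto(1)[OF \<mu> m2 f C]
  have Ff: "(\<lambda>n. L2_dist \<mu> (F n) f) \<longlonglongrightarrow> 0"
    unfolding F_def by (rule grid_round_L2_tendsto(2)[OF \<mu> m2 f C])
  have proj: "isotonic_projection \<mu> (F n) (u n)" for n
    unfolding F_def u_def
    by (rule isotonic_fit_imp_projection[OF \<mu> grid_round_mono grid_round_finite_range step_fit])
  have "\<exists>N. \<forall>i\<ge>N. \<forall>j\<ge>N. L2_dist \<mu> (u i) (u j) < e" if "e > 0" for e
  proof -
    from order_tendstoD(2)[OF Ff, of "e / 2"] that
    obtain N where N: "\<And>n. n \<ge> N \<Longrightarrow> L2_dist \<mu> (F n) f < e / 2"
      by (auto simp: eventually_sequentially)
    have "L2_dist \<mu> (u i) (u j) < e" if "i \<ge> N" "j \<ge> N" for i j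
      using isotonic_projection_contraction[OF FL FL proj proj, of i j]
        L2_dist_triangle[OF FL fL FL, of i j] N[OF that(1)] N[OF that(2)]
        L2_dist_commute[of \<mu> f "F j"] by linarith
    then show ?thesis by blast
  qed
  from L2_complete[OF ps uL this] obtain X0 where
    X0: "X0 \<in> L2 \<mu>" "(\<lambda>n. L2_dist \<mu> (u n) X0) \<longlonglongrightarrow> 0" by blast
  obtain r where r: "strict_mono r" "AE y in \<mu>. (\<lambda>n. u (r n) y) \<longlonglongrightarrow> X0 y"
    using L2_convergent_AE_subseq[OF ps uL X0] by blast
  define E where "E = {y. (\<forall>n. grid_round n y \<in> cells \<mu> (grid_round n)) \<and> (\<lambda>n. u (r n) y) \<longlonglongrightarrow> X0 y}"
  have "AE y in \<mu>. \<forall>n. grid_round n y \<in> cells \<mu> (grid_round n)"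
    using AE_in_cells[OF \<mu> grid_round_mono grid_round_finite_range] by (simp add: AE_all_countable)
  with r(2) have E: "AE y in \<mu>. y \<in> E" unfolding E_def by eventually_elim auto
  have "E \<noteq> {}" using E by (auto simp: AE_False)
  have inc: "0 \<le> X0 z - X0 y \<and> X0 z - X0 y \<le> G z - G y" if yz: "y \<in> E" "z \<in> E" "y \<le> z" for y z
  proof
    have lim: "(\<lambda>n. u (r n) z - u (r n) y) \<longlonglongrightarrow> X0 z - X0 y"
      using yz by (intro tendsto_diff) (auto simp: E_def)
    have Glim: "(\<lambda>n. G (grid_round (r n) x)) \<longlonglongrightarrow> G x" for x
      by (rule continuous_on_tendsto_compose[OF G(1)
            LIMSEQ_subseq_LIMSEQ[OF grid_round_tendsto r(1), unfolded comp_def]]) auto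
    have "u (r n) y \<le> u (r n) z" for n
      using proj[of "r n"] yz(3) by (auto simp: isotonic_projection_def mono_def)
    then show "0 \<le> X0 z - X0 y" by (intro LIMSEQ_le_const[OF lim]) auto
    have "u (r n) z - u (r n) y \<le> G (grid_round (r n) z) - G (grid_round (r n) y)" for n
      unfolding u_def using yz
      by (intro step_fit_increment_le[OF G(3)] isotonic_fit_mono G(2)) (auto simp: E_def)
    then show "X0 z - X0 y \<le> G z - G y"
      by (intro LIMSEQ_le[OF lim tendsto_diff[OF Glim Glim]]) auto
  qed
  have inc': "0 \<le> X0 z - X0 y \<and> X0 z - X0 y \<le> G z - G y" if "y \<in> E" "z \<in> E" "G y \<le> G z" for y z
  proof (cases "y \<le> z")
    case False
    then have "G y = G z" using that(3) monoD[OF G(2), of z y] by simp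
    then show ?thesis using inc[OF that(2,1)] False by simp
  qed (use inc that in auto)
  obtain \<phi> where \<phi>: "\<And>x y. x \<le> y \<Longrightarrow> 0 \<le> \<phi> y - \<phi> x \<and> \<phi> y - \<phi> x \<le> y - x"
      "\<And>y. y \<in> E \<Longrightarrow> \<phi> (G y) = X0 y"
    using monotone_lipschitz_factor[of E G X0, OF \<open>E \<noteq> {}\<close> inc'] by blast
  define X where "X y = \<phi> (G y)" for y
  have X_inc: "0 \<le> X z - X y \<and> X z - X y \<le> G z - G y" if "y \<le> z" for y z
    unfolding X_def using \<phi>(1) monoD[OF G(2) that] by blast
  have "mono X" using X_inc by (auto simp: mono_def)
  have "X \<in> borel_measurable \<mu>" using borel_measurable_mono[OF \<open>mono X\<close>] by simp
  have eq: "AE y in \<mu>. X y = X0 y" using E by eventually_elim (simp add: X_def \<phi>)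
  have XL: "X \<in> L2 \<mu>"
    by (rule L2_bound[OF X0(1) \<open>X \<in> borel_measurable \<mu>\<close>]) (use eq in eventually_elim, simp)
  have "L2_dist \<mu> (u n) X = L2_dist \<mu> (u n) X0" for n
    unfolding L2_dist_def
    by (intro arg_cong[where f = sqrt] integral_cong_AE)
       (use eq uL[of n] X0(1) XL in \<open>auto dest!: L2_measurable elim: eventually_mono\<close>)
  with X0 have lim: "(\<lambda>n. L2_dist \<mu> (u n) X) \<longlonglongrightarrow> 0" by simp
  show ?thesis
  proof
    show "isotonic_projection \<mu> f X"
      by (rule isotonic_projection_limit[OF FL fL Ff proj lim \<open>mono X\<close> XL])
  qed (use X_inc lim in \<open>auto simp: u_def\<close>)
qed

text \<open>
  Almost everywhere convergence is only available along subsequences, so a common one is chosen for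
  both limits.
\<close>

lemma step_fit_limit_increment_le:
  assumes \<mu>: "real_distribution \<mu>" and fg: "mono (\<lambda>x. g x - f x)"
    and X: "X \<in> L2 \<mu>" "(\<lambda>n. L2_dist \<mu> (\<lambda>y. step_fit \<mu> n f (grid_round n y)) X) \<longlonglongrightarrow> 0"
    and Y: "Y \<in> L2 \<mu>" "(\<lambda>n. L2_dist \<mu> (\<lambda>y. step_fit \<mu> n g (grid_round n y)) Y) \<longlonglongrightarrow> 0"
  obtains E where "AE y in \<mu>. y \<in> E" "\<And>y z. y \<in> E \<Longrightarrow> z \<in> E \<Longrightarrow> y \<le> z \<Longrightarrow> X z - X y \<le> Y z - Y y"
proof -
  interpret real_distribution \<mu> by fact
  have ps: "prob_space \<mu>" by unfold_locales
  define u where "u n = (\<lambda>y. step_fit \<mu> n f (grid_round n y))" for n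
  define v where "v n = (\<lambda>y. step_fit \<mu> n g (grid_round n y))" for n
  have uL: "u n \<in> L2 \<mu>" for n
    unfolding u_def by (rule step_function_L2[OF \<mu> grid_round_mono grid_round_finite_range])
  have vL: "v n \<in> L2 \<mu>" for n
    unfolding v_def by (rule step_function_L2[OF \<mu> grid_round_mono grid_round_finite_range])
  obtain r where r: "strict_mono r" "AE y in \<mu>. (\<lambda>n. u (r n) y) \<longlonglongrightarrow> X y"
    using L2_convergent_AE_subseq[OF ps uL X[folded u_def]] by blast
  have "(\<lambda>n. L2_dist \<mu> (v (r n)) Y) \<longlonglongrightarrow> 0"
    using LIMSEQ_subseq_LIMSEQ[OF Y(2)[folded v_def] r(1)] by (simp add: comp_def)
  from L2_convergent_AE_subseq[OF ps vL Y(1) this]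
  obtain q where q: "strict_mono q" "AE y in \<mu>. (\<lambda>n. v (r (q n)) y) \<longlonglongrightarrow> Y y" by blast
  define E where "E = {y. (\<forall>n. grid_round n y \<in> cells \<mu> (grid_round n))
    \<and> (\<lambda>n. u (r n) y) \<longlonglongrightarrow> X y \<and> (\<lambda>n. v (r (q n)) y) \<longlonglongrightarrow> Y y}"
  show ?thesis
  proof
    have "AE y in \<mu>. \<forall>n. grid_round n y \<in> cells \<mu> (grid_round n)"
      using AE_in_cells[OF \<mu> grid_round_mono grid_round_finite_range] by (simp add: AE_all_countable)
    with r(2) q(2) show "AE y in \<mu>. y \<in> E" unfolding E_def by eventually_elim auto
  next
    fix y z assume yz: "y \<in> E" "z \<in> E" "y \<le> z"
    have ul: "(\<lambda>n. u (r (q n)) x) \<longlonglongrightarrow> X x" if "x \<in> E" for x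
      using that LIMSEQ_subseq_LIMSEQ[OF _ q(1), of "\<lambda>n. u (r n) x"] by (auto simp: E_def comp_def)
    have le: "u n z - u n y \<le> v n z - v n y" for n
      unfolding u_def v_def using yz
      by (intro step_fit_increment_le[OF fg] step_fit) (auto simp: E_def)
    show "X z - X y \<le> Y z - Y y"
    proof (rule LIMSEQ_le)
      show "(\<lambda>n. u (r (q n)) z - u (r (q n)) y) \<longlonglongrightarrow> X z - X y"
        using yz by (intro tendsto_diff ul)
      show "(\<lambda>n. v (r (q n)) z - v (r (q n)) y) \<longlonglongrightarrow> Y z - Y y"
        using yz by (intro tendsto_diff) (auto simp: E_def)
    qed (use le in blast)
  qed
qed

lemma supp_approximated_by_full_set:
  assumes \<mu>: "real_distribution \<mu>" and E: "AE y in \<mu>. y \<in> E" and x: "x \<in> supp \<mu>"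
  obtains y where "\<And>n. y n \<in> E" "y \<longlonglongrightarrow> x"
proof -
  interpret real_distribution \<mu> by fact
  have "\<exists>e\<in>E. \<bar>e - x\<bar> < 1 / real (Suc n)" for n
  proof (rule ccontr)
    assume no: "\<not> (\<exists>e\<in>E. \<bar>e - x\<bar> < 1 / real (Suc n))"
    have "AE y in \<mu>. y \<notin> {x - 1 / real (Suc n) <..< x + 1 / real (Suc n)}"
      using E by eventually_elim (use no in \<open>auto simp: abs_less_iff\<close>)
    then have "measure \<mu> {x - 1 / real (Suc n) <..< x + 1 / real (Suc n)} = 0"
      by (intro measure_eq_0_null_sets) (simp add: AE_iff_null_sets)
    then show False using x unfolding supp_def by (metis (mono_tags, lifting) less_irrefl mem_Collect_eq of_nat_0_less_iff zero_less_Suc zero_less_divide_1_iff)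
  qed
  then obtain y where y: "\<And>n. y n \<in> E" "\<And>n. \<bar>y n - x\<bar> < 1 / real (Suc n)" by metis
  have "(\<lambda>n. y n - x) \<longlonglongrightarrow> 0"
  proof (rule Lim_null_comparison)
    show "(\<lambda>n. 1 / real (Suc n)) \<longlonglongrightarrow> 0" using LIMSEQ_inverse_real_of_nat by (simp add: inverse_eq_divide)
  qed (use y(2) in \<open>auto intro!: always_eventually less_imp_le\<close>)
  then have "y \<longlonglongrightarrow> x" by (simp add: LIM_zero_iff)
  with y(1) that show ?thesis by blast
qed

section \<open>Conditional expectation given a Borel function\<close>

text \<open>
  A ramp \<open>r\<close> of slope \<open>c\<close> makes both \<open>r (X y)\<close> and \<open>c * X y - r (X y)\<close> nondecreasing, so that testing with
  them gives two opposite inequalities. Steep ramps approximate the indicators of \<open>{a<..}\<close>, and these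
  half-lines determine the image measures under \<open>X\<close> of the positive and the negative part of the residual.
\<close>

lemma isotonic_projection_orthogonal:
  assumes \<mu>: "real_distribution \<mu>" and f: "f \<in> L2 \<mu>" and X: "isotonic_projection \<mu> f X"
    and h: "h \<in> borel_measurable borel" "(\<lambda>y. h (X y)) \<in> L2 \<mu>"
  shows "(\<integral>y. (f y - X y) * h (X y) \<partial>\<mu>) = 0"
proof -
  interpret real_distribution \<mu> by fact
  have XL: "X \<in> L2 \<mu>" and mX: "mono X" using X by (auto simp: isotonic_projection_def)
  define g where "g y = f y - X y" for y
  have gL: "g \<in> L2 \<mu>" unfolding g_def by (intro L2_diff f XL)
  have gi: "integrable \<mu> g" by (rule L2_integrable[OF finite_measure_axioms gL])
  have [measurable]: "X \<in> borel_measurable borel" using borel_measurable_mono[OF mX] .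
  then have [measurable]: "X \<in> borel_measurable \<mu>" by simp
  have [measurable]: "g \<in> borel_measurable \<mu>" using gL by (rule L2_measurable)
  have gX: "(\<integral>y. g y * X y \<partial>\<mu>) = 0" and gw: "\<And>w. mono w \<Longrightarrow> w \<in> L2 \<mu> \<Longrightarrow> (\<integral>y. g y * w y \<partial>\<mu>) \<le> 0"
    using X by (auto simp: isotonic_projection_def g_def)
  have ramp: "(\<integral>y. g y * min 1 (max 0 (c * (X y - a))) \<partial>\<mu>) = 0" if c: "c \<ge> 1" for a c :: real
  proof -
    define r where "r x = min 1 (max 0 (c * (x - a)))" for x
    have rm: "mono r" unfolding r_def using c
      by (intro monoI min.mono max.mono mult_left_mono) auto
    have rl: "r y - r x \<le> c * (y - x)" if "x \<le> y" for x y
    proof -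
      have "0 \<le> c * (y - x)" using that c by simp
      then show ?thesis by (auto simp: r_def min_def max_def algebra_simps)
    qed
    have [measurable]: "r \<in> borel_measurable borel" by (rule borel_measurable_mono[OF rm])
    have rL: "(\<lambda>y. r (X y)) \<in> L2 \<mu>"
      by (rule L2_bound[OF L2_const[OF finite_measure_axioms, of 1]]) (auto simp: r_def)
    have "mono (\<lambda>y. r (X y))" using rm mX by (simp add: mono_def)
    from gw[OF this rL] have le: "(\<integral>y. g y * r (X y) \<partial>\<mu>) \<le> 0" .
    have "mono (\<lambda>y. c * X y - r (X y))"
    proof (rule monoI)
      fix x y :: real assume "x \<le> y"
      then have "X x \<le> X y" using mX by (rule monoD[rotated])
      from rl[OF this] show "c * X x - r (X x) \<le> c * X y - r (X y)" by (simp add: algebra_simps)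
    qed
    from gw[OF this L2_diff[OF L2_cmult[OF XL] rL]]
    have "(\<integral>y. g y * (c * X y - r (X y)) \<partial>\<mu>) \<le> 0" .
    also have "(\<lambda>y. g y * (c * X y - r (X y))) = (\<lambda>y. c * (g y * X y) - g y * r (X y))"
      by (auto simp: algebra_simps)
    also have "(\<integral>y. c * (g y * X y) - g y * r (X y) \<partial>\<mu>) = c * (\<integral>y. g y * X y \<partial>\<mu>) - (\<integral>y. g y * r (X y) \<partial>\<mu>)"
      using L2_mult_integrable[OF gL XL] L2_mult_integrable[OF gL rL] by simp
    finally have "0 \<le> (\<integral>y. g y * r (X y) \<partial>\<mu>)" by (simp add: gX)
    with le show ?thesis by (simp add: r_def)
  qed
  have half: "(\<integral>y. g y * indicator {a<..} (X y) \<partial>\<mu>) = 0" for a :: real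
  proof -
    have "(\<lambda>n. \<integral>y. g y * min 1 (max 0 (real (Suc n) * (X y - a))) \<partial>\<mu>)
        \<longlonglongrightarrow> (\<integral>y. g y * indicator {a<..} (X y) \<partial>\<mu>)"
    proof (rule integral_dominated_convergence)
      show "integrable \<mu> (\<lambda>y. \<bar>g y\<bar>)" using gi by simp
      show "AE y in \<mu>. norm (g y * min 1 (max 0 (real (Suc n) * (X y - a)))) \<le> \<bar>g y\<bar>" for n
        by (rule AE_I2) (auto simp: abs_mult intro!: mult_left_le)
      show "AE y in \<mu>. (\<lambda>n. g y * min 1 (max 0 (real (Suc n) * (X y - a)))) \<longlonglongrightarrow> g y * indicator {a<..} (X y)"
      proof (intro AE_I2 tendsto_mult tendsto_const)
        fix y
        show "(\<lambda>n. min 1 (max 0 (real (Suc n) * (X y - a)))) \<longlonglongrightarrow> indicator {a<..} (X y)"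
        proof (cases "a < X y")
          case True
          obtain N :: nat where N: "1 / (X y - a) \<le> real N" using real_arch_simple by blast
          have "min 1 (max 0 (real (Suc n) * (X y - a))) = 1" if "n \<ge> N" for n
          proof -
            have "1 / (X y - a) \<le> real (Suc n)" using N that by simp
            then have "1 \<le> real (Suc n) * (X y - a)" using True by (simp add: field_simps)
            then show ?thesis by simp
          qed
          then have "\<forall>\<^sub>F n in sequentially. min 1 (max 0 (real (Suc n) * (X y - a))) = 1"
            by (auto simp: eventually_sequentially simp del: of_nat_Suc)
          then show ?thesis using True by (simp add: tendsto_eventually del: of_nat_Suc)
        next
          case False
          then have "real (Suc n) * (X y - a) \<le> 0" for n
            by (intro mult_nonneg_nonpos) auto
          then have "max 0 (real (Suc n) * (X y - a)) = 0" for n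
            by (rule max_absorb1)
          then show ?thesis using False by simp
        qed
      qed
    qed measurable
    moreover have "(\<integral>y. g y * min 1 (max 0 (real (Suc n) * (X y - a))) \<partial>\<mu>) = 0" for n
      by (rule ramp) simp
    ultimately show ?thesis by (simp add: LIMSEQ_const_iff)
  qed
  define gp where "gp y = max 0 (g y)" for y
  define gm where "gm y = max 0 (- g y)" for y
  have gpm: "g y = gp y - gm y" for y by (auto simp: gp_def gm_def)
  have gpmL: "gp \<in> L2 \<mu>" "gm \<in> L2 \<mu>"
    by (rule L2_bound[OF gL]; auto simp: gp_def[abs_def] gm_def[abs_def])+
  have [measurable]: "gp \<in> borel_measurable \<mu>" "gm \<in> borel_measurable \<mu>"
    using gpmL by (auto dest: L2_measurable)
  have nn: "0 \<le> gp y" "0 \<le> gm y" for y by (auto simp: gp_def gm_def)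
  have indL: "(\<lambda>y. indicator {a<..} (X y)) \<in> L2 \<mu>" for a :: real
    by (rule L2_bound[OF L2_const[OF finite_measure_axioms, of 1]]) (auto simp: indicator_def)
  define M where "M = distr (density \<mu> gp) borel X"
  define N where "N = distr (density \<mu> gm) borel X"
  have em: "emeasure (distr (density \<mu> k) borel X) {a<..} = ennreal (\<integral>y. k y * indicator {a<..} (X y) \<partial>\<mu>)"
    if k: "k \<in> L2 \<mu>" "\<And>y. 0 \<le> k y" for k and a :: real
  proof -
    have [measurable]: "k \<in> borel_measurable \<mu>" using k by (auto dest: L2_measurable)
    have "emeasure (distr (density \<mu> k) borel X) {a<..} = (\<integral>\<^sup>+y. ennreal (k y) * indicator (X -` {a<..} \<inter> space (density \<mu> k)) y \<partial>\<mu>)"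
      by (subst emeasure_distr, simp, simp, subst emeasure_density) (auto intro!: measurable_sets[of X \<mu> borel, simplified])
    also have "\<dots> = (\<integral>\<^sup>+y. ennreal (k y * indicator {a<..} (X y)) \<partial>\<mu>)"
      by (intro nn_integral_cong) (auto simp: indicator_def)
    also have "\<dots> = ennreal (\<integral>y. k y * indicator {a<..} (X y) \<partial>\<mu>)"
      using k by (intro nn_integral_eq_integral L2_mult_integrable indL) auto
    finally show ?thesis .
  qed
  have "M = N"
  proof (rule measure_eqI_lessThan)
    show "emeasure M {x<..} < \<infinity>" for x unfolding M_def by (subst em) (use gpmL nn in auto)
    show "emeasure M {x<..} = emeasure N {x<..}" for x
    proof -
      have "(\<integral>y. g y * indicator {x<..} (X y) \<partial>\<mu>)
          = (\<integral>y. gp y * indicator {x<..} (X y) \<partial>\<mu>) - (\<integral>y. gm y * indicator {x<..} (X y) \<partial>\<mu>)"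
        unfolding gpm using L2_mult_integrable[OF _ indL] gpmL by (simp add: left_diff_distrib)
      then show ?thesis
        unfolding M_def N_def using half[of x] by (simp add: em gpmL nn)
    qed
  qed (simp_all add: M_def N_def)
  have hX: "(\<integral>y. k y * h (X y) \<partial>\<mu>) = (\<integral>x. h x \<partial>distr (density \<mu> k) borel X)"
    if k: "k \<in> L2 \<mu>" "\<And>y. 0 \<le> k y" for k
  proof -
    have [measurable]: "k \<in> borel_measurable \<mu>" using k by (auto dest: L2_measurable)
    have [measurable]: "h \<in> borel_measurable borel" by fact
    show ?thesis using k by (simp add: integral_distr integral_density)
  qed
  have "(\<integral>y. g y * h (X y) \<partial>\<mu>) = (\<integral>y. gp y * h (X y) \<partial>\<mu>) - (\<integral>y. gm y * h (X y) \<partial>\<mu>)"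
    unfolding gpm using L2_mult_integrable[OF _ h(2)] gpmL by (simp add: left_diff_distrib)
  also have "\<dots> = 0"
    using hX[OF gpmL(1) nn(1)] hX[OF gpmL(2) nn(2)] \<open>M = N\<close> by (simp add: M_def N_def)
  finally show ?thesis by (simp add: g_def)
qed

text \<open>
  The Doob-Dynkin lemma: the sublevel sets of \<open>u\<close> at rational levels are preimages of sets \<open>B q\<close>,
  and \<open>f\<close> is rebuilt from these sets as the infimum of the levels whose set contains the point.
\<close>

lemma measurable_vimage_algebra_factor:
  fixes u :: "'a \<Rightarrow> real" and Y :: "'a \<Rightarrow> 'b"
  assumes u: "u \<in> borel_measurable (vimage_algebra \<Omega> Y N)" and Y: "Y \<in> \<Omega> \<rightarrow> space N"
  obtains f where "f \<in> borel_measurable N" "\<And>y. y \<in> \<Omega> \<Longrightarrow> u y = f (Y y)"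
proof -
  have "\<exists>B\<in>sets N. {y \<in> \<Omega>. u y < real_of_rat q} = Y -` B \<inter> \<Omega>" for q
  proof -
    have "{y \<in> \<Omega>. u y < real_of_rat q} \<in> sets (vimage_algebra \<Omega> Y N)"
      using borel_measurable_less[OF u borel_measurable_const[of "real_of_rat q"]]
      unfolding pred_def by simp
    then show ?thesis using sets_vimage_algebra2[OF Y] by auto
  qed
  then obtain B where B: "\<And>q. B q \<in> sets N" "\<And>q. {y \<in> \<Omega>. u y < real_of_rat q} = Y -` B q \<inter> \<Omega>"
    by metis
  define f where "f x = (INF q. if x \<in> B q then ereal (real_of_rat q) else \<infinity>)" for x
  have [measurable]: "B q \<in> sets N" for q by (rule B)
  have fm[measurable]: "f \<in> borel_measurable N" unfolding f_def by measurable
  have "f (Y y) = ereal (u y)" if y: "y \<in> \<Omega>" for y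
  proof -
    have iff: "Y y \<in> B q \<longleftrightarrow> u y < real_of_rat q" for q using B(2)[of q] y by blast
    show ?thesis
    proof (rule antisym)
      show "ereal (u y) \<le> f (Y y)" unfolding f_def by (rule INF_greatest) (auto simp: iff)
      show "f (Y y) \<le> ereal (u y)"
      proof (rule dense_ge)
        fix e assume "ereal (u y) < e"
        then obtain q where q: "ereal (u y) < ereal (real_of_rat q)" "ereal (real_of_rat q) < e"
          by (metis (no_types, lifting) ereal_dense3 ereal_less_eq(3) less_ereal.simps(1) order_less_imp_le)
        have "f (Y y) \<le> (if Y y \<in> B q then ereal (real_of_rat q) else \<infinity>)"
          unfolding f_def by (rule INF_lower) simp
        also have "\<dots> \<le> e" using q by (simp add: iff)
        finally show "f (Y y) \<le> e" .
      qed
    qed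
  qed
  then have "u y = real_of_ereal (f (Y y))" if "y \<in> \<Omega>" for y using that by simp
  then show ?thesis using that[of "\<lambda>x. real_of_ereal (f x)"] by simp
qed

text \<open>
  The conditional expectation with respect to the \<open>\<sigma>\<close>-algebra generated by \<open>Y\<close> is square integrable by
  Jensen's inequality and factors through \<open>Y\<close> by the Doob-Dynkin lemma.
\<close>

lemma is_cond_exp_exists:
  assumes \<mu>: "real_distribution \<mu>" and Y: "Y \<in> borel_measurable borel" and g: "g \<in> L2 \<mu>"
  obtains u where "is_cond_exp \<mu> g Y u"
proof -
  interpret real_distribution \<mu> by fact
  let ?F = "vimage_algebra UNIV Y borel"
  have sub: "subalgebra \<mu> ?F"
    unfolding subalgebra_def using Y by (auto simp: sets_vimage_algebra2 measurable_def)
  interpret finite_measure_subalgebra \<mu> ?F by unfold_locales (rule sub)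
  define u where "u = real_cond_exp \<mu> ?F g"
  have [measurable]: "g \<in> borel_measurable \<mu>" using g by (rule L2_measurable)
  have gi: "integrable \<mu> g" by (rule L2_integrable[OF finite_measure_axioms g])
  have um: "u \<in> borel_measurable ?F" unfolding u_def by (rule borel_measurable_cond_exp)
  have "integrable \<mu> (\<lambda>y. (u y)\<^sup>2)"
    unfolding u_def
    by (rule integrable_convex_cond_exp[where I = UNIV and q = "\<lambda>x. x\<^sup>2"])
       (use gi L2_square_integrable[OF g] convex_power2 in \<open>auto simp: convex_on_def\<close>)
  moreover have "u \<in> borel_measurable \<mu>" unfolding u_def by measurable
  ultimately have uL: "u \<in> L2 \<mu>" by (simp add: L2_def)
  obtain f where f: "f \<in> borel_measurable borel" "\<And>y. u y = f (Y y)"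
    using measurable_vimage_algebra_factor[OF um] by (auto simp: Pi_def)
  have "is_cond_exp \<mu> g Y u"
    unfolding is_cond_exp_def
  proof (intro conjI bexI[of _ f] ballI impI)
    show "u \<in> L2 \<mu>" by fact
    show "integrable \<mu> (\<lambda>y. (f (Y y))\<^sup>2)" using L2_square_integrable[OF uL] by (simp add: f(2)[symmetric])
    show "AE y in \<mu>. u y = f (Y y)" by (simp add: f)
    fix h :: "real \<Rightarrow> real" assume h: "h \<in> borel_measurable borel" "integrable \<mu> (\<lambda>y. (h (Y y))\<^sup>2)"
    have hF: "(\<lambda>y. h (Y y)) \<in> borel_measurable ?F"
      by (rule measurable_compose[OF measurable_vimage_algebra1 h(1)]) simp
    have "(\<lambda>y. h (Y y)) \<in> L2 \<mu>"
      using h measurable_from_subalg[OF sub hF] by (simp add: L2_def)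
    from real_cond_exp_intg(2)[OF L2_mult_integrable[OF this g] hF]
    show "(\<integral>y. u y * h (Y y) \<partial>\<mu>) = (\<integral>y. g y * h (Y y) \<partial>\<mu>)"
      by (simp add: u_def mult.commute)
  qed (use f in auto)
  then show ?thesis by (rule that)
qed

section \<open>The sticky particle flow\<close>

text \<open>
  The closed subspace onto which conditional expectation given \<open>Y\<close> projects. Inclusions between these
  subspaces replace inclusions of \<open>\<sigma>\<close>-algebras up to null sets.
\<close>

definition L2_functions_of :: "real measure \<Rightarrow> (real \<Rightarrow> real) \<Rightarrow> (real \<Rightarrow> real) set" where
  "L2_functions_of \<mu> Y = {w \<in> L2 \<mu>. \<exists>h\<in>borel_measurable borel. AE y in \<mu>. w y = h (Y y)}"

lemma L2_functions_of_L2: "w \<in> L2_functions_of \<mu> Y \<Longrightarrow> w \<in> L2 \<mu>"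
  by (simp add: L2_functions_of_def)

lemma L2_functions_of_self: "Y \<in> L2 \<mu> \<Longrightarrow> Y \<in> L2_functions_of \<mu> Y"
  by (auto simp: L2_functions_of_def intro: bexI[of _ "\<lambda>x. x"])

lemma L2_functions_of_diff:
  assumes "u \<in> L2_functions_of \<mu> Y" "w \<in> L2_functions_of \<mu> Y"
  shows "(\<lambda>y. u y - w y) \<in> L2_functions_of \<mu> Y"
proof -
  from assms obtain g h where [measurable]: "g \<in> borel_measurable borel" "h \<in> borel_measurable borel"
    and ae: "AE y in \<mu>. u y = g (Y y)" "AE y in \<mu>. w y = h (Y y)"
    by (auto simp: L2_functions_of_def)
  have "AE y in \<mu>. u y - w y = g (Y y) - h (Y y)" using ae by eventually_elim simp
  then show ?thesis using assms
    by (auto simp: L2_functions_of_def intro!: L2_diff bexI[of _ "\<lambda>x. g x - h x"])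
qed

lemma L2_functions_of_cmult:
  assumes "u \<in> L2_functions_of \<mu> Y"
  shows "(\<lambda>y. c * u y) \<in> L2_functions_of \<mu> Y"
proof -
  from assms obtain g where [measurable]: "g \<in> borel_measurable borel"
    and ae: "AE y in \<mu>. u y = g (Y y)"
    by (auto simp: L2_functions_of_def)
  have "AE y in \<mu>. c * u y = c * g (Y y)" using ae by eventually_elim simp
  then show ?thesis using assms
    by (auto simp: L2_functions_of_def intro!: L2_cmult bexI[of _ "\<lambda>x. c * g x"])
qed

lemma L2_functions_of_antimono:
  assumes "AE y in \<mu>. Z y = \<phi> (Y y)" "\<phi> \<in> borel_measurable borel"
  shows "L2_functions_of \<mu> Z \<subseteq> L2_functions_of \<mu> Y"
proof
  fix w assume w: "w \<in> L2_functions_of \<mu> Z"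
  then obtain h where [measurable]: "h \<in> borel_measurable borel" and ae: "AE y in \<mu>. w y = h (Z y)"
    by (auto simp: L2_functions_of_def)
  have [measurable]: "\<phi> \<in> borel_measurable borel" by fact
  have "AE y in \<mu>. w y = h (\<phi> (Y y))" using ae assms(1) by eventually_elim simp
  then show "w \<in> L2_functions_of \<mu> Y" using w
    by (auto simp: L2_functions_of_def intro!: bexI[of _ "\<lambda>x. h (\<phi> x)"])
qed

lemma inner_AE_cong:
  assumes "f \<in> L2 \<mu>" "w \<in> L2 \<mu>" "w' \<in> borel_measurable \<mu>" "AE y in \<mu>. w y = w' y"
  shows "(\<integral>y. f y * w y \<partial>\<mu>) = (\<integral>y. f y * w' y \<partial>\<mu>)"
proof (rule integral_cong_AE)
  have [measurable]: "f \<in> borel_measurable \<mu>" "w \<in> borel_measurable \<mu>" "w' \<in> borel_measurable \<mu>"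
    using assms by (auto dest: L2_measurable)
  show "(\<lambda>y. f y * w y) \<in> borel_measurable \<mu>" "(\<lambda>y. f y * w' y) \<in> borel_measurable \<mu>" by measurable
  show "AE y in \<mu>. f y * w y = f y * w' y" using assms(4) by eventually_elim simp
qed

lemma isotonic_projection_inner:
  assumes \<mu>: "real_distribution \<mu>" and f: "f \<in> L2 \<mu>" and X: "isotonic_projection \<mu> f X"
    and w: "w \<in> L2_functions_of \<mu> X"
  shows "(\<integral>y. f y * w y \<partial>\<mu>) = (\<integral>y. X y * w y \<partial>\<mu>)"
proof -
  interpret real_distribution \<mu> by fact
  have XL: "X \<in> L2 \<mu>" using X by (simp add: isotonic_projection_def)
  then have [measurable]: "X \<in> borel_measurable \<mu>" by (rule L2_measurable)
  from w obtain h where h[measurable]: "h \<in> borel_measurable borel" and ae: "AE y in \<mu>. w y = h (X y)"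
    and wL: "w \<in> L2 \<mu>"
    by (auto simp: L2_functions_of_def)
  have hm: "(\<lambda>y. h (X y)) \<in> borel_measurable \<mu>" by measurable
  have hL: "(\<lambda>y. h (X y)) \<in> L2 \<mu>"
    by (rule L2_bound[OF wL hm]) (use ae in \<open>eventually_elim, simp\<close>)
  have "(\<integral>y. (f y - X y) * w y \<partial>\<mu>) = (\<integral>y. (f y - X y) * h (X y) \<partial>\<mu>)"
    by (rule inner_AE_cong[OF L2_diff[OF f XL] wL hm ae])
  also have "\<dots> = 0" by (rule isotonic_projection_orthogonal[OF \<mu> f X h hL])
  finally show ?thesis
    using L2_mult_integrable[OF f wL] L2_mult_integrable[OF XL wL] by (simp add: left_diff_distrib)
qed

lemma is_cond_exp_inner:
  assumes \<mu>: "real_distribution \<mu>" and g: "g \<in> L2 \<mu>" and Y: "Y \<in> borel_measurable borel"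
    and u: "is_cond_exp \<mu> g Y u" and w: "w \<in> L2_functions_of \<mu> Y"
  shows "(\<integral>y. u y * w y \<partial>\<mu>) = (\<integral>y. g y * w y \<partial>\<mu>)"
proof -
  interpret real_distribution \<mu> by fact
  have uL: "u \<in> L2 \<mu>" using u by (simp add: is_cond_exp_def)
  have [measurable]: "Y \<in> borel_measurable \<mu>" using Y by simp
  from w obtain h where h[measurable]: "h \<in> borel_measurable borel" and ae: "AE y in \<mu>. w y = h (Y y)"
    and wL: "w \<in> L2 \<mu>"
    by (auto simp: L2_functions_of_def)
  have hm: "(\<lambda>y. h (Y y)) \<in> borel_measurable \<mu>" by measurable
  have hL: "(\<lambda>y. h (Y y)) \<in> L2 \<mu>"
    by (rule L2_bound[OF wL hm]) (use ae in \<open>eventually_elim, simp\<close>)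
  have "(\<integral>y. u y * w y \<partial>\<mu>) = (\<integral>y. u y * h (Y y) \<partial>\<mu>)" by (rule inner_AE_cong[OF uL wL hm ae])
  also have "\<dots> = (\<integral>y. g y * h (Y y) \<partial>\<mu>)"
    using u h L2_square_integrable[OF hL] unfolding is_cond_exp_def by blast
  also have "\<dots> = (\<integral>y. g y * w y \<partial>\<mu>)" by (rule inner_AE_cong[OF g wL hm ae, symmetric])
  finally show ?thesis .
qed

lemma is_cond_exp_mem:
  "is_cond_exp \<mu> g Y u \<Longrightarrow> u \<in> L2_functions_of \<mu> Y"
  by (auto simp: is_cond_exp_def L2_functions_of_def)

lemma inner_diff_left:
  assumes "f \<in> L2 \<mu>" "g \<in> L2 \<mu>" "w \<in> L2 \<mu>"
  shows "(\<integral>y. (f y - g y) * w y \<partial>\<mu>) = (\<integral>y. f y * w y \<partial>\<mu>) - (\<integral>y. g y * w y \<partial>\<mu>)"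
  using L2_mult_integrable[OF assms(1,3)] L2_mult_integrable[OF assms(2,3)]
  by (simp add: left_diff_distrib)

lemma inner_diff_right:
  assumes "f \<in> L2 \<mu>" "g \<in> L2 \<mu>" "w \<in> L2 \<mu>"
  shows "(\<integral>y. w y * (f y - g y) \<partial>\<mu>) = (\<integral>y. w y * f y \<partial>\<mu>) - (\<integral>y. w y * g y \<partial>\<mu>)"
  using inner_diff_left[OF assms] by (simp add: mult.commute)

lemma inner_add_left:
  assumes "f \<in> L2 \<mu>" "g \<in> L2 \<mu>" "w \<in> L2 \<mu>"
  shows "(\<integral>y. (f y + g y) * w y \<partial>\<mu>) = (\<integral>y. f y * w y \<partial>\<mu>) + (\<integral>y. g y * w y \<partial>\<mu>)"
  using L2_mult_integrable[OF assms(1,3)] L2_mult_integrable[OF assms(2,3)]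
  by (simp add: distrib_right)

lemma inner_cmult_left: "(\<integral>y. (c * f y) * w y \<partial>\<mu>) = c * (\<integral>y. f y * (w y :: real) \<partial>\<mu>)"
  by (simp add: mult.assoc)

text \<open>
  Pythagoras: \<open>U - V\<close> is orthogonal to \<open>V\<close>, since \<open>V\<close> is a function of \<open>Z\<close> and hence also of \<open>Y\<close>.
\<close>

lemma cond_exp_tower_norm:
  assumes \<mu>: "real_distribution \<mu>" and v: "v \<in> L2 \<mu>"
    and Y: "Y \<in> borel_measurable borel" "Z \<in> borel_measurable borel"
    and U: "is_cond_exp \<mu> v Y U" and V: "is_cond_exp \<mu> v Z V"
    and sub: "L2_functions_of \<mu> Z \<subseteq> L2_functions_of \<mu> Y"
  shows "(L2_dist \<mu> U V)\<^sup>2 = (L2_norm \<mu> U)\<^sup>2 - (L2_norm \<mu> V)\<^sup>2"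
proof -
  have UL: "U \<in> L2 \<mu>" and VL: "V \<in> L2 \<mu>" using U V by (auto simp: is_cond_exp_def)
  have VZ: "V \<in> L2_functions_of \<mu> Z" by (rule is_cond_exp_mem[OF V])
  have "(\<integral>y. U y * V y \<partial>\<mu>) = (\<integral>y. v y * V y \<partial>\<mu>)"
    by (rule is_cond_exp_inner[OF \<mu> v Y(1) U]) (use VZ sub in blast)
  also have "\<dots> = (\<integral>y. V y * V y \<partial>\<mu>)"
    by (rule is_cond_exp_inner[OF \<mu> v Y(2) V VZ, symmetric])
  finally have UV: "(\<integral>y. U y * V y \<partial>\<mu>) = (\<integral>y. (V y)\<^sup>2 \<partial>\<mu>)" by (simp add: power2_eq_square)
  have "(L2_dist \<mu> U V)\<^sup>2 = (\<integral>y. (U y)\<^sup>2 + (V y)\<^sup>2 - 2 * (U y * V y) \<partial>\<mu>)"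
    unfolding L2_dist_eq_norm L2_norm_power2 by (simp add: power2_diff mult.assoc)
  also have "\<dots> = (\<integral>y. (U y)\<^sup>2 \<partial>\<mu>) + (\<integral>y. (V y)\<^sup>2 \<partial>\<mu>) - 2 * (\<integral>y. U y * V y \<partial>\<mu>)"
    using L2_mult_integrable[OF UL VL] L2_square_integrable[OF UL] L2_square_integrable[OF VL] by simp
  finally show ?thesis by (simp add: UV L2_norm_power2)
qed

text \<open>
  The conditional expectation of \<open>Xs\<close> given \<open>Xt\<close> is \<open>z = Xt - h * Vt\<close> with \<open>h = t - s\<close>, so \<open>R = Xs - z\<close> is
  orthogonal to \<open>z\<close> and \<open>\<parallel>R\<parallel>\<^sup>2 = \<langle>R, Xs\<rangle>\<close>. Testing the projection at time \<open>t\<close> with \<open>Xs\<close> bounds this by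
  \<open>- h * \<langle>Vs - Vt, Xs\<rangle>\<close>, which equals \<open>- h * \<langle>Vs - Vt, R\<rangle>\<close> because \<open>Vs - Vt\<close> is orthogonal to \<open>z\<close>.
\<close>

lemma sticky_increment_estimate:
  assumes \<mu>: "real_distribution \<mu>" and idL: "(\<lambda>y. y) \<in> L2 \<mu>" and v: "v \<in> L2 \<mu>"
    and st: "s < t"
    and Xs: "isotonic_projection \<mu> (\<lambda>y. y + s * v y) Xs" and Xt: "isotonic_projection \<mu> (\<lambda>y. y + t * v y) Xt"
    and Vs: "is_cond_exp \<mu> v Xs Vs" and Vt: "is_cond_exp \<mu> v Xt Vt"
    and sub: "L2_functions_of \<mu> Xt \<subseteq> L2_functions_of \<mu> Xs"
  shows "L2_norm \<mu> (\<lambda>y. Xs y - (Xt y - (t - s) * Vt y)) \<le> (t - s) * L2_dist \<mu> Vs Vt"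
proof -
  define h where "h = t - s"
  have h: "0 < h" using st by (simp add: h_def)
  define z where "z y = Xt y - h * Vt y" for y
  define R where "R y = Xs y - z y" for y
  have L: "Xs \<in> L2 \<mu>" "Xt \<in> L2 \<mu>" "Vs \<in> L2 \<mu>" "Vt \<in> L2 \<mu>"
    using Xs Xt Vs Vt by (auto simp: isotonic_projection_def is_cond_exp_def)
  have SL: "(\<lambda>y. y + c * v y) \<in> L2 \<mu>" for c by (intro L2_add idL L2_cmult v)
  have B: "Xs \<in> borel_measurable borel" "Xt \<in> borel_measurable borel"
    using Xs Xt by (auto simp: isotonic_projection_def intro: borel_measurable_mono)
  have zt: "z \<in> L2_functions_of \<mu> Xt"
    unfolding z_def by (intro L2_functions_of_diff L2_functions_of_cmult L2_functions_of_self L is_cond_exp_mem[OF Vt])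
  then have zs: "z \<in> L2_functions_of \<mu> Xs" using sub by blast
  have zL: "z \<in> L2 \<mu>" using zt by (rule L2_functions_of_L2)
  have RL: "R \<in> L2 \<mu>" unfolding R_def by (intro L2_diff L zL)
  have XsXs: "Xs \<in> L2_functions_of \<mu> Xs" by (rule L2_functions_of_self[OF L(1)])
  have S: "(\<integral>y. (y + t * v y) * w y \<partial>\<mu>) = (\<integral>y. (y + s * v y) * w y \<partial>\<mu>) + h * (\<integral>y. v y * w y \<partial>\<mu>)"
    if "w \<in> L2 \<mu>" for w
  proof -
    have "(\<lambda>y. (y + t * v y) * w y) = (\<lambda>y. ((y + s * v y) + h * v y) * w y)"
      by (auto simp: h_def algebra_simps)
    then show ?thesis
      using inner_add_left[OF SL[of s] L2_cmult[OF v, of h] that] by (simp add: inner_cmult_left)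
  qed
  \<comment> \<open>By orthogonality every inner product with \<open>z\<close> reduces to one with the data.\<close>
  have "(\<integral>y. R y * z y \<partial>\<mu>) = (\<integral>y. Xs y * z y \<partial>\<mu>) - ((\<integral>y. Xt y * z y \<partial>\<mu>) - h * (\<integral>y. Vt y * z y \<partial>\<mu>))"
    unfolding R_def inner_diff_left[OF L(1) zL zL]
    using inner_diff_left[OF L(2) L2_cmult[OF L(4), of h] zL] by (simp add: z_def[symmetric] inner_cmult_left)
  also have "\<dots> = (\<integral>y. (y + s * v y) * z y \<partial>\<mu>) - ((\<integral>y. (y + t * v y) * z y \<partial>\<mu>) - h * (\<integral>y. v y * z y \<partial>\<mu>))"
    by (simp add: isotonic_projection_inner[OF \<mu> SL Xs zs] isotonic_projection_inner[OF \<mu> SL Xt zt]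
          is_cond_exp_inner[OF \<mu> v B(2) Vt zt])
  also have "\<dots> = 0" by (simp add: S[OF zL])
  finally have Rz: "(\<integral>y. R y * z y \<partial>\<mu>) = 0" .
  have Vz: "(\<integral>y. (Vs y - Vt y) * z y \<partial>\<mu>) = 0"
    by (simp add: inner_diff_left[OF L(3,4) zL] is_cond_exp_inner[OF \<mu> v B(2) Vt zt] is_cond_exp_inner[OF \<mu> v B(1) Vs zs])
  \<comment> \<open>As \<open>Xs\<close> is nondecreasing, it is an admissible test function at time \<open>t\<close>.\<close>
  have "(\<integral>y. (y + t * v y - Xt y) * Xs y \<partial>\<mu>) \<le> 0"
    using Xt Xs L by (auto simp: isotonic_projection_def)
  then have "(\<integral>y. (y + s * v y) * Xs y \<partial>\<mu>) + h * (\<integral>y. v y * Xs y \<partial>\<mu>) - (\<integral>y. Xt y * Xs y \<partial>\<mu>) \<le> 0"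
    by (simp add: inner_diff_left[OF SL L(2,1)] S[OF L(1)])
  then have var: "(\<integral>y. Xs y * Xs y \<partial>\<mu>) + h * (\<integral>y. Vs y * Xs y \<partial>\<mu>) - (\<integral>y. Xt y * Xs y \<partial>\<mu>) \<le> 0"
    by (simp add: isotonic_projection_inner[OF \<mu> SL Xs XsXs] is_cond_exp_inner[OF \<mu> v B(1) Vs XsXs])
  have "(L2_norm \<mu> R)\<^sup>2 = (\<integral>y. R y * R y \<partial>\<mu>)" unfolding L2_norm_power2 by (simp add: power2_eq_square)
  also have "\<dots> = (\<integral>y. R y * Xs y \<partial>\<mu>) - (\<integral>y. R y * z y \<partial>\<mu>)"
    using inner_diff_right[OF L(1) zL RL] by (simp add: R_def)
  also have "\<dots> = (\<integral>y. R y * Xs y \<partial>\<mu>)" by (simp add: Rz)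
  also have "\<dots> = (\<integral>y. Xs y * Xs y \<partial>\<mu>) - ((\<integral>y. Xt y * Xs y \<partial>\<mu>) - h * (\<integral>y. Vt y * Xs y \<partial>\<mu>))"
  proof -
    have "(\<integral>y. z y * Xs y \<partial>\<mu>) = (\<integral>y. Xt y * Xs y \<partial>\<mu>) - h * (\<integral>y. Vt y * Xs y \<partial>\<mu>)"
      unfolding z_def using inner_diff_left[OF L(2) L2_cmult[OF L(4), of h] L(1)]
      by (simp add: inner_cmult_left)
    then show ?thesis unfolding R_def by (simp add: inner_diff_left[OF L(1) zL L(1)])
  qed
  also have "\<dots> \<le> - h * ((\<integral>y. Vs y * Xs y \<partial>\<mu>) - (\<integral>y. Vt y * Xs y \<partial>\<mu>))"
    using var by (simp add: algebra_simps)
  also have "(\<integral>y. Vs y * Xs y \<partial>\<mu>) - (\<integral>y. Vt y * Xs y \<partial>\<mu>) = (\<integral>y. (Vs y - Vt y) * Xs y \<partial>\<mu>)"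
    by (rule inner_diff_left[OF L(3,4,1), symmetric])
  also have "\<dots> = (\<integral>y. (Vs y - Vt y) * R y \<partial>\<mu>)"
    using inner_diff_right[OF L(1) zL L2_diff[OF L(3,4)]] Vz by (simp add: R_def)
  also have "- h * \<dots> \<le> h * (L2_dist \<mu> Vs Vt * L2_norm \<mu> R)"
  proof -
    have "- (\<integral>y. (Vs y - Vt y) * R y \<partial>\<mu>) \<le> L2_dist \<mu> Vs Vt * L2_norm \<mu> R"
      using L2_Cauchy_Schwarz[OF L2_diff[OF L(3,4)] RL] by (simp add: L2_dist_eq_norm)
    from mult_left_mono[OF this less_imp_le[OF h]] show ?thesis by simp
  qed
  finally have "L2_norm \<mu> R * L2_norm \<mu> R \<le> (h * L2_dist \<mu> Vs Vt) * L2_norm \<mu> R"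
    by (simp add: power2_eq_square mult.assoc)
  moreover have "0 \<le> h * L2_dist \<mu> Vs Vt" using h L2_dist_nonneg[of \<mu> Vs Vt] by simp
  ultimately have "L2_norm \<mu> R \<le> h * L2_dist \<mu> Vs Vt"
    using L2_norm_nonneg[of \<mu> R] by (cases "L2_norm \<mu> R = 0") auto
  then show ?thesis by (simp add: R_def[abs_def] z_def h_def)
qed

text \<open>
  The difference quotient over \<open>[s, t]\<close> differs from the velocity at the later end by at most
  \<open>\<parallel>V s - V t\<parallel>\<close>. For a right derivative the velocity at the later end has to be compared once more
  with \<open>V t\<close>, whence the factor 2.
\<close>

lemma has_L2_derivative_of_estimate:
  fixes X V :: "real \<Rightarrow> real \<Rightarrow> real"
  assumes L: "\<And>t. 0 \<le> t \<Longrightarrow> X t \<in> L2 \<mu>" "\<And>t. 0 \<le> t \<Longrightarrow> V t \<in> L2 \<mu>"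
    and est: "\<And>s t. 0 \<le> s \<Longrightarrow> s < t \<Longrightarrow>
        L2_norm \<mu> (\<lambda>y. X s y - (X t y - (t - s) * V t y)) \<le> (t - s) * L2_dist \<mu> (V s) (V t)"
    and tower: "\<And>s t. 0 \<le> s \<Longrightarrow> s \<le> t \<Longrightarrow> (L2_dist \<mu> (V s) (V t))\<^sup>2 = (L2_norm \<mu> (V s))\<^sup>2 - (L2_norm \<mu> (V t))\<^sup>2"
    and t: "0 \<le> t" and cont: "isCont (\<lambda>t. (L2_norm \<mu> (V (max 0 t)))\<^sup>2) t"
  shows "has_L2_derivative \<mu> X (V t) t {0..}"
proof -
  define N where "N t = (L2_norm \<mu> (V (max 0 t)))\<^sup>2" for t
  have dist: "L2_dist \<mu> (V s) (V t) = sqrt \<bar>N s - N t\<bar>" if "0 \<le> s" for s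
  proof -
    have "(L2_dist \<mu> (V s) (V t))\<^sup>2 = \<bar>N s - N t\<bar>"
    proof (cases "s \<le> t")
      case True
      then have "0 \<le> N s - N t" using tower[OF that True] t that zero_le_power2[of "L2_dist \<mu> (V s) (V t)"] by (simp add: N_def)
      then show ?thesis using tower[OF that True] t that by (simp add: N_def)
    next
      case False
      then have ts: "t \<le> s" by simp
      then have "0 \<le> N t - N s" using tower[OF t ts] t that zero_le_power2[of "L2_dist \<mu> (V t) (V s)"] by (simp add: N_def)
      then show ?thesis using tower[OF t ts] t that by (simp add: N_def L2_dist_commute)
    qed
    then show ?thesis using L2_dist_nonneg[of \<mu> "V s" "V t"] by (metis real_sqrt_unique)
  qed
  have bound: "L2_dist \<mu> (\<lambda>y. (X s y - X t y) / (s - t)) (V t) \<le> 2 * sqrt \<bar>N s - N t\<bar>"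
    if s: "0 \<le> s" "s \<noteq> t" for s
  proof (cases "s < t")
    case True
    have "L2_dist \<mu> (\<lambda>y. (X s y - X t y) / (s - t)) (V t)
        = L2_norm \<mu> (\<lambda>y. (1 / (s - t)) * (X s y - (X t y - (t - s) * V t y)))"
      unfolding L2_dist_eq_norm using True
      by (intro arg_cong[where f = "L2_norm \<mu>"] ext) (simp add: field_simps)
    also have "\<dots> = (1 / (t - s)) * L2_norm \<mu> (\<lambda>y. X s y - (X t y - (t - s) * V t y))"
      unfolding L2_norm_cmult using True by simp
    also have "\<dots> \<le> (1 / (t - s)) * ((t - s) * L2_dist \<mu> (V s) (V t))"
      using est[OF s(1) True] True by (intro mult_left_mono) auto
    also have "\<dots> = sqrt \<bar>N s - N t\<bar>" using True dist[OF s(1)] by simp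
    finally show ?thesis by (smt (verit) real_sqrt_ge_zero abs_ge_zero)
  next
    case False
    then have ts: "t < s" using s by simp
    have d: "(\<lambda>y. (1 / (t - s)) * (X t y - (X s y - (s - t) * V s y))) \<in> L2 \<mu>"
      by (intro L2_cmult L2_diff L s t)
    have "L2_dist \<mu> (\<lambda>y. (X s y - X t y) / (s - t)) (V t)
        = L2_norm \<mu> (\<lambda>y. (1 / (t - s)) * (X t y - (X s y - (s - t) * V s y)) + (V s y - V t y))"
      unfolding L2_dist_eq_norm using ts
      by (intro arg_cong[where f = "L2_norm \<mu>"] ext) (simp add: field_simps)
    also have "\<dots> \<le> L2_norm \<mu> (\<lambda>y. (1 / (t - s)) * (X t y - (X s y - (s - t) * V s y))) + L2_dist \<mu> (V s) (V t)"
      unfolding L2_dist_eq_norm using s t by (intro L2_norm_triangle d L2_diff L)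
    also have "L2_norm \<mu> (\<lambda>y. (1 / (t - s)) * (X t y - (X s y - (s - t) * V s y)))
        = (1 / (s - t)) * L2_norm \<mu> (\<lambda>y. X t y - (X s y - (s - t) * V s y))"
      unfolding L2_norm_cmult using ts by simp
    also have "\<dots> \<le> (1 / (s - t)) * ((s - t) * L2_dist \<mu> (V t) (V s))"
      using est[OF t ts] ts by (intro mult_left_mono) auto
    also have "\<dots> = L2_dist \<mu> (V s) (V t)" using ts by (simp add: L2_dist_commute)
    finally show ?thesis using dist[OF s(1)] by simp
  qed
  have "N \<midarrow>t\<rightarrow> N t" using cont by (simp add: isCont_def N_def[abs_def])
  then have "((\<lambda>s. 2 * sqrt \<bar>N s - N t\<bar>) \<longlongrightarrow> 2 * sqrt \<bar>N t - N t\<bar>) (at t within {0..})"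
    by (intro tendsto_intros) (rule tendsto_within_subset, auto)
  then have lim: "((\<lambda>s. 2 * sqrt \<bar>N s - N t\<bar>) \<longlongrightarrow> 0) (at t within {0..})" by simp
  have "((\<lambda>s. L2_dist \<mu> (\<lambda>y. (X s y - X t y) / (s - t)) (V t)) \<longlongrightarrow> 0) (at t within {0..})"
    by (rule tendsto_sandwich[OF _ _ tendsto_const lim])
       (auto simp: eventually_at_filter L2_dist_nonneg bound)
  then show ?thesis using L(2)[OF t] by (simp add: has_L2_derivative_def)
qed

text \<open>
  The construction uses the rescaled projections \<open>Y \<tau>\<close> of \<open>\<tau> * y + v y\<close> with \<open>\<tau> = 1 / t\<close>, because the data at
  two times then differ by a multiple of the identity: increments of \<open>Y\<close> are comparable in \<open>\<tau>\<close>.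
  Scaling back gives \<open>X t = t * Y (1 / t)\<close>.
\<close>

lemma sticky_flow_exists:
  fixes \<mu> :: "real measure" and v W :: "real \<Rightarrow> real"
  assumes \<mu>: "real_distribution \<mu>" and m2: "integrable \<mu> (\<lambda>x. x\<^sup>2)"
    and v: "continuous_on UNIV v" "\<And>x. \<bar>v x\<bar> \<le> C * (1 + \<bar>x\<bar>)"
    and W: "continuous_on UNIV W" "mono W" "mono (\<lambda>x. W x - v x)"
  obtains X where "X 0 = (\<lambda>y. y)"
    "\<And>t. 0 \<le> t \<Longrightarrow> isotonic_projection \<mu> (\<lambda>y. y + t * v y) (X t)"
    "\<And>t y z. 0 \<le> t \<Longrightarrow> y \<le> z \<Longrightarrow> 0 \<le> X t z - X t y \<and> X t z - X t y \<le> z - y + t * (W z - W y)"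
    "\<And>s t. 0 < s \<Longrightarrow> s \<le> t \<Longrightarrow> \<exists>E. (AE y in \<mu>. y \<in> E) \<and>
        (\<forall>y\<in>E. \<forall>z\<in>E. y \<le> z \<longrightarrow> X t z - X t y \<le> t / s * (X s z - X s y))"
proof -
  interpret real_distribution \<mu> by fact
  have C0: "0 \<le> C" using v(2)[of 0] by simp
  define f where "f \<tau> = (\<lambda>y. \<tau> * y + v y)" for \<tau> :: real
  define P where "P \<tau> Y \<longleftrightarrow> isotonic_projection \<mu> (f \<tau>) Y
    \<and> (\<forall>y z. y \<le> z \<longrightarrow> 0 \<le> Y z - Y y \<and> Y z - Y y \<le> \<tau> * (z - y) + (W z - W y))
    \<and> (\<lambda>n. L2_dist \<mu> (\<lambda>y. step_fit \<mu> n (f \<tau>) (grid_round n y)) Y) \<longlonglongrightarrow> 0" for \<tau> Y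
  have "\<exists>Y. P \<tau> Y" if \<tau>: "0 < \<tau>" for \<tau>
  proof -
    have c: "continuous_on UNIV (f \<tau>)" unfolding f_def by (intro continuous_intros v)
    have b: "\<bar>f \<tau> x\<bar> \<le> (\<tau> + C) * (1 + \<bar>x\<bar>)" for x
    proof -
      have "\<bar>f \<tau> x\<bar> \<le> \<tau> * \<bar>x\<bar> + C * (1 + \<bar>x\<bar>)"
        using v(2)[of x] \<tau> abs_triangle_ineq[of "\<tau> * x" "v x"] by (simp add: f_def abs_mult)
      also have "\<dots> \<le> (\<tau> + C) * (1 + \<bar>x\<bar>)" using \<tau> by (simp add: algebra_simps)
      finally show ?thesis .
    qed
    have G: "continuous_on UNIV (\<lambda>y. \<tau> * y + W y)" by (intro continuous_intros W)
    have mG: "mono (\<lambda>y. \<tau> * y + W y)"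
      using \<tau> monoD[OF W(2)] by (auto intro!: monoI add_mono)
    have mGf: "mono (\<lambda>y. (\<tau> * y + W y) - f \<tau> y)" using W(3) by (simp add: f_def)
    obtain Y where "isotonic_projection \<mu> (f \<tau>) Y"
      "\<And>y z. y \<le> z \<Longrightarrow> 0 \<le> Y z - Y y \<and> Y z - Y y \<le> (\<tau> * z + W z) - (\<tau> * y + W y)"
      "(\<lambda>n. L2_dist \<mu> (\<lambda>y. step_fit \<mu> n (f \<tau>) (grid_round n y)) Y) \<longlonglongrightarrow> 0"
      using step_fit_converges[OF \<mu> m2 c b G mG mGf] by blast
    then have "P \<tau> Y" unfolding P_def by (auto simp: algebra_simps)
    then show ?thesis by blast
  qed
  then obtain Y where Y: "\<And>\<tau>. 0 < \<tau> \<Longrightarrow> P \<tau> (Y \<tau>)" by metis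
  define X where "X t = (if t = 0 then (\<lambda>y. y) else (\<lambda>y. t * Y (1 / t) y))" for t :: real
  have idL: "(\<lambda>y. y) \<in> L2 \<mu>" using m2 by (simp add: L2_def)
  have YL: "Y \<tau> \<in> L2 \<mu>" if "0 < \<tau>" for \<tau>
    using Y[OF that] by (simp add: P_def isotonic_projection_def)
  show ?thesis
  proof
    show "X 0 = (\<lambda>y. y)" by (simp add: X_def)
  next
    fix t :: real assume t: "0 \<le> t"
    show "isotonic_projection \<mu> (\<lambda>y. y + t * v y) (X t)"
    proof (cases "t = 0")
      case True
      then show ?thesis using idL by (simp add: X_def isotonic_projection_def mono_def)
    next
      case False
      then have tp: "0 < t" using t by simp
      then have p: "isotonic_projection \<mu> (f (1 / t)) (Y (1 / t))" using Y by (simp add: P_def)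
      have e: "(y + t * v y - X t y) * w = t * ((f (1 / t) y - Y (1 / t) y) * w)" for y w
        using tp by (simp add: X_def f_def algebra_simps)
      have e2: "(y + t * v y - X t y) * X t y = t\<^sup>2 * ((f (1 / t) y - Y (1 / t) y) * Y (1 / t) y)" for y
        unfolding e using tp by (simp add: X_def power2_eq_square algebra_simps)
      show ?thesis
        unfolding isotonic_projection_def e2 unfolding e
        using p tp by (auto simp: isotonic_projection_def X_def mono_def mult_le_0_iff intro: L2_cmult)
    qed
  next
    fix t y z :: real assume t: "0 \<le> t" and yz: "y \<le> z"
    show "0 \<le> X t z - X t y \<and> X t z - X t y \<le> z - y + t * (W z - W y)"
    proof (cases "t = 0")
      case True
      then show ?thesis using yz by (simp add: X_def)
    next
      case False
      then have tp: "0 < t" using t by simp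
      then have "0 \<le> Y (1 / t) z - Y (1 / t) y \<and> Y (1 / t) z - Y (1 / t) y \<le> (1 / t) * (z - y) + (W z - W y)"
        using Y[of "1 / t"] yz by (simp add: P_def)
      then have "0 \<le> t * (Y (1 / t) z - Y (1 / t) y)
          \<and> t * (Y (1 / t) z - Y (1 / t) y) \<le> t * ((1 / t) * (z - y) + (W z - W y))"
        using tp by (simp add: mult_left_mono)
      moreover have "t * ((1 / t) * (z - y) + (W z - W y)) = z - y + t * (W z - W y)"
        using tp by (simp add: distrib_left)
      ultimately show ?thesis using tp by (simp add: X_def right_diff_distrib)
    qed
  next
    fix s t :: real assume st: "0 < s" "s \<le> t"
    then have t: "0 < t" and le: "1 / t \<le> 1 / s" by (auto simp: frac_le)
    have "mono (\<lambda>x. f (1 / s) x - f (1 / t) x)"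
    proof -
      have "(\<lambda>x. f (1 / s) x - f (1 / t) x) = (\<lambda>x. (1 / s - 1 / t) * x)"
        by (auto simp: f_def algebra_simps)
      then show ?thesis using le by (auto intro!: monoI mult_left_mono)
    qed
    from step_fit_limit_increment_le[OF \<mu> this YL _ YL, of "1 / t" "1 / s"] st t Y[of "1 / t"] Y[of "1 / s"]
    obtain E where E: "AE y in \<mu>. y \<in> E"
      "\<And>y z. y \<in> E \<Longrightarrow> z \<in> E \<Longrightarrow> y \<le> z \<Longrightarrow> Y (1 / t) z - Y (1 / t) y \<le> Y (1 / s) z - Y (1 / s) y"
      by (auto simp: P_def)
    have "X t z - X t y \<le> t / s * (X s z - X s y)" if "y \<in> E" "z \<in> E" "y \<le> z" for y z
    proof -
      have "t * (Y (1 / t) z - Y (1 / t) y) \<le> t * (Y (1 / s) z - Y (1 / s) y)"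
        using E(2)[OF that] t by (intro mult_left_mono) auto
      moreover have "X t z - X t y = t * (Y (1 / t) z - Y (1 / t) y)"
        using t by (simp add: X_def right_diff_distrib)
      moreover have "X s z - X s y = s * (Y (1 / s) z - Y (1 / s) y)"
        using st by (simp add: X_def right_diff_distrib)
      ultimately show ?thesis using st by simp
    qed
    with E(1) show "\<exists>E. (AE y in \<mu>. y \<in> E) \<and>
        (\<forall>y\<in>E. \<forall>z\<in>E. y \<le> z \<longrightarrow> X t z - X t y \<le> t / s * (X s z - X s y))"
      by blast
  qed
qed

text \<open>
  This is stickiness: particles with the same position at the earlier time share their later position.
\<close>

lemma later_position_factors:
  assumes \<mu>: "real_distribution \<mu>"
    and mono: "mono (Xs :: real \<Rightarrow> real)" "mono Xt" and c: "0 < c"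
    and E: "AE y in \<mu>. y \<in> E" "\<And>y z. y \<in> E \<Longrightarrow> z \<in> E \<Longrightarrow> y \<le> z \<Longrightarrow> Xt z - Xt y \<le> c * (Xs z - Xs y)"
  obtains \<phi> where "\<phi> \<in> borel_measurable borel" "AE y in \<mu>. Xt y = \<phi> (Xs y)"
proof -
  interpret real_distribution \<mu> by fact
  have "E \<noteq> {}" using E(1) by (auto simp: AE_False)
  have "0 \<le> Xt z - Xt y \<and> Xt z - Xt y \<le> c * Xs z - c * Xs y"
    if yz: "y \<in> E" "z \<in> E" "c * Xs y \<le> c * Xs z" for y z
  proof (cases "y \<le> z")
    case True
    then show ?thesis using E(2)[OF yz(1,2) True] monoD[OF mono(2) True] by (simp add: right_diff_distrib)
  next
    case False
    then have zy: "z \<le> y" by simp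
    have "Xs y = Xs z" using yz(3) c monoD[OF mono(1) zy] by simp
    then show ?thesis using E(2)[OF yz(2,1) zy] monoD[OF mono(2) zy] by simp
  qed
  from monotone_lipschitz_factor[of E "\<lambda>y. c * Xs y" Xt, OF \<open>E \<noteq> {}\<close> this]
  obtain \<psi> where \<psi>: "\<And>x y. x \<le> y \<Longrightarrow> 0 \<le> \<psi> y - \<psi> x \<and> \<psi> y - \<psi> x \<le> y - x" "\<And>y. y \<in> E \<Longrightarrow> \<psi> (c * Xs y) = Xt y"
    by blast
  show ?thesis
  proof
    have "mono (\<lambda>x. \<psi> (c * x))"
    proof (rule monoI)
      fix x y :: real assume "x \<le> y"
      then have "c * x \<le> c * y" using c by simp
      from \<psi>(1)[OF this] show "\<psi> (c * x) \<le> \<psi> (c * y)" by simp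
    qed
    then show "(\<lambda>x. \<psi> (c * x)) \<in> borel_measurable borel" by (rule borel_measurable_mono)
    show "AE y in \<mu>. Xt y = \<psi> (c * Xs y)" using E(1) by eventually_elim (simp add: \<psi>(2))
  qed
qed

lemma Lipschitz_imp_absolutely_continuous:
  assumes "\<And>a b. a \<in> I \<Longrightarrow> b \<in> I \<Longrightarrow> a < b \<Longrightarrow> d (F a) (F b) \<le> C * (b - a)"
  shows "absolutely_continuous_on d I F"
  unfolding absolutely_continuous_on_def
proof (intro allI impI)
  fix e :: real assume e: "e > 0"
  \<comment> \<open>A positive Lipschitz constant, so that one can divide by it.\<close>
  define K where "K = max C 0 + 1"
  have K: "0 < K" "C \<le> K" by (auto simp: K_def)
  show "\<exists>\<delta>>0. \<forall>P. finite P \<longrightarrow> (\<forall>(a, b)\<in>P. a < b \<and> a \<in> I \<and> b \<in> I) \<longrightarrow>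
      disjoint_family_on (\<lambda>(a, b). {a<..<b}) P \<longrightarrow> (\<Sum>(a, b)\<in>P. b - a) < \<delta> \<longrightarrow>
      (\<Sum>(a, b)\<in>P. d (F a) (F b)) < e"
  proof (intro exI[of _ "e / K"] conjI allI impI)
    fix P :: "(real \<times> real) set"
    assume P: "\<forall>(a, b)\<in>P. a < b \<and> a \<in> I \<and> b \<in> I" "(\<Sum>(a, b)\<in>P. b - a) < e / K"
    have "(\<Sum>(a, b)\<in>P. d (F a) (F b)) \<le> (\<Sum>(a, b)\<in>P. K * (b - a))"
    proof (rule sum_mono, clarify)
      fix a b assume "(a, b) \<in> P"
      then have "d (F a) (F b) \<le> C * (b - a)" "a < b" using P(1) assms by auto
      moreover have "C * (b - a) \<le> K * (b - a)" using K(2) \<open>a < b\<close> by (intro mult_right_mono) auto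
      ultimately show "d (F a) (F b) \<le> K * (b - a)" by linarith
    qed
    also have "\<dots> = K * (\<Sum>(a, b)\<in>P. b - a)" by (simp add: sum_distrib_left case_prod_unfold)
    also have "\<dots> < K * (e / K)" using P(2) K(1) by (rule mult_strict_left_mono)
    finally show "(\<Sum>(a, b)\<in>P. d (F a) (F b)) < e" using K(1) by simp
  qed (use e K in auto)
qed

lemma AE_continuity_point_of_decreasing:
  fixes f :: "real \<Rightarrow> real"
  assumes "\<And>s t. s \<le> t \<Longrightarrow> f t \<le> f s"
  shows "AE t in lebesgue. isCont f t"
proof -
  have "mono (\<lambda>t. - f t)" using assms by (auto intro: monoI)
  from mono_ctble_discont[OF this] have "countable {t. \<not> isCont f t}"
    by (simp add: isCont_def tendsto_minus_cancel_left)
  from countable_imp_null_set_lborel[OF this]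
  have "AE t in lborel. t \<notin> {t. \<not> isCont f t}" by (rule AE_not_in)
  then show ?thesis using AE_completion by fastforce
qed

theorem theorem1p2:
  fixes \<rho>\<^sub>0 :: "real measure" and v\<^sub>0 :: "real \<Rightarrow> real"
  assumes "real_distribution \<rho>\<^sub>0"
    and "integrable \<rho>\<^sub>0 (\<lambda>x. x\<^sup>2)"
    and "absolutely_continuous_on dist UNIV v\<^sub>0"
  shows "\<exists>X V :: real \<Rightarrow> real \<Rightarrow> real.
      (\<forall>t\<ge>0. X t \<in> borel_measurable borel \<and> X t \<in> L2 \<rho>\<^sub>0)
    \<and> absolutely_continuous_on (L2_dist \<rho>\<^sub>0) {0..} X
    \<and> (AE t in lebesgue. t \<ge> 0 \<longrightarrow>
          has_L2_derivative \<rho>\<^sub>0 X (V t) t {0..} \<and> is_cond_exp \<rho>\<^sub>0 v\<^sub>0 (X t) (V t))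
    \<and> (AE y in \<rho>\<^sub>0. X 0 y = y)
    \<and> (\<exists>N \<in> null_sets lebesgue. \<forall>s t. 0 \<le> s \<longrightarrow> s \<le> t \<longrightarrow> s \<notin> N \<longrightarrow> t \<notin> N \<longrightarrow>
          (\<integral>y. 1/2 * (V t y)\<^sup>2 \<partial>\<rho>\<^sub>0) \<le> (\<integral>y. 1/2 * (V s y)\<^sup>2 \<partial>\<rho>\<^sub>0)
        \<and> (\<integral>y. 1/2 * (V s y)\<^sup>2 \<partial>\<rho>\<^sub>0) \<le> (\<integral>y. 1/2 * (v\<^sub>0 y)\<^sup>2 \<partial>\<rho>\<^sub>0))
    \<and> (\<forall>t\<ge>0. \<forall>y\<in>supp \<rho>\<^sub>0. \<forall>z\<in>supp \<rho>\<^sub>0. y \<le> z \<longrightarrow>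
          0 \<le> X t z - X t y
        \<and> X t z - X t y \<le> z - y + t * (LINT x:{y..z}|lebesgue. \<bar>deriv v\<^sub>0 x\<bar>))
    \<and> (\<forall>s t. 0 < s \<longrightarrow> s \<le> t \<longrightarrow> (\<forall>y\<in>supp \<rho>\<^sub>0. \<forall>z\<in>supp \<rho>\<^sub>0.
          1 / t * \<bar>X t y - X t z\<bar> \<le> 1 / s * \<bar>X s y - X s z\<bar>))"
proof -
  note \<mu> = assms(1) and m2 = assms(2) and ac = assms(3)
  interpret real_distribution \<rho>\<^sub>0 by fact
  note cv = absolutely_continuous_on_imp_continuous[OF ac]
  obtain C where C: "\<And>x. \<bar>v\<^sub>0 x\<bar> \<le> C * (1 + \<bar>x\<bar>)"
    using absolutely_continuous_on_linear_growth[OF ac] by blast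
  obtain W where W: "continuous_on UNIV W" "mono W" "mono (\<lambda>x. W x - v\<^sub>0 x)"
    "\<And>y z. y \<le> z \<Longrightarrow> W z - W y = (LINT x:{y..z}|lebesgue. \<bar>deriv v\<^sub>0 x\<bar>)"
    using absolutely_continuous_variation_integral[OF ac] by blast
  have vL: "v\<^sub>0 \<in> L2 \<rho>\<^sub>0" by (rule grid_round_L2_tendsto(1)[OF \<mu> m2 cv C])
  have idL: "(\<lambda>y. y) \<in> L2 \<rho>\<^sub>0" using m2 by (simp add: L2_def)
  obtain X where X0: "X 0 = (\<lambda>y. y)"
    and proj: "\<And>t. 0 \<le> t \<Longrightarrow> isotonic_projection \<rho>\<^sub>0 (\<lambda>y. y + t * v\<^sub>0 y) (X t)"
    and inc: "\<And>t y z. 0 \<le> t \<Longrightarrow> y \<le> z \<Longrightarrow> 0 \<le> X t z - X t y \<and> X t z - X t y \<le> z - y + t * (W z - W y)"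
    and contr: "\<And>s t. 0 < s \<Longrightarrow> s \<le> t \<Longrightarrow> \<exists>E. (AE y in \<rho>\<^sub>0. y \<in> E) \<and>
        (\<forall>y\<in>E. \<forall>z\<in>E. y \<le> z \<longrightarrow> X t z - X t y \<le> t / s * (X s z - X s y))"
    using sticky_flow_exists[OF \<mu> m2 cv C W(1-3)] by blast
  have XL: "X t \<in> L2 \<rho>\<^sub>0" and Xm: "mono (X t)" if "0 \<le> t" for t
    using proj[OF that] by (auto simp: isotonic_projection_def)
  have Xb: "X t \<in> borel_measurable borel" if "0 \<le> t" for t
    by (rule borel_measurable_mono[OF Xm[OF that]])
  have "\<exists>u. 0 \<le> t \<longrightarrow> is_cond_exp \<rho>\<^sub>0 v\<^sub>0 (X t) u" for t
    using is_cond_exp_exists[OF \<mu> Xb vL] by blast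
  then obtain V where V: "\<And>t. 0 \<le> t \<Longrightarrow> is_cond_exp \<rho>\<^sub>0 v\<^sub>0 (X t) (V t)" by metis
  have VL: "V t \<in> L2 \<rho>\<^sub>0" if "0 \<le> t" for t using V[OF that] by (simp add: is_cond_exp_def)
  have sub: "L2_functions_of \<rho>\<^sub>0 (X t) \<subseteq> L2_functions_of \<rho>\<^sub>0 (X s)" if st: "0 \<le> s" "s \<le> t" for s t
  proof (cases "s = 0")
    case True
    \<comment> \<open>Initially the particles sit at their labels, and every position is a function of the label.\<close>
    show ?thesis by (rule L2_functions_of_antimono[where \<phi> = "X t"]) (use True X0 Xb st in auto)
  next
    case False
    then have s: "0 < s" using st by simp
    obtain E where "AE y in \<rho>\<^sub>0. y \<in> E"
      "\<And>y z. y \<in> E \<Longrightarrow> z \<in> E \<Longrightarrow> y \<le> z \<Longrightarrow> X t z - X t y \<le> t / s * (X s z - X s y)"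
      using contr[OF s st(2)] by blast
    then obtain \<phi> where "\<phi> \<in> borel_measurable borel" "AE y in \<rho>\<^sub>0. X t y = \<phi> (X s y)"
      using later_position_factors[OF \<mu> Xm[of s] Xm[of t], of "t / s" E] s st by auto
    then show ?thesis by (intro L2_functions_of_antimono)
  qed
  have tower: "(L2_dist \<rho>\<^sub>0 (V s) (V t))\<^sup>2 = (L2_norm \<rho>\<^sub>0 (V s))\<^sup>2 - (L2_norm \<rho>\<^sub>0 (V t))\<^sup>2"
    if st: "0 \<le> s" "s \<le> t" for s t
    by (rule cond_exp_tower_norm[OF \<mu> vL Xb Xb V V sub]) (use st in auto)
  have energy: "(\<integral>y. 1/2 * (V t y)\<^sup>2 \<partial>\<rho>\<^sub>0) \<le> (\<integral>y. 1/2 * (V s y)\<^sup>2 \<partial>\<rho>\<^sub>0)" if st: "0 \<le> s" "s \<le> t" for s t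
    using tower[OF st] zero_le_power2[of "L2_dist \<rho>\<^sub>0 (V s) (V t)"] by (simp add: L2_norm_power2)
  have energy0: "(\<integral>y. 1/2 * (V s y)\<^sup>2 \<partial>\<rho>\<^sub>0) \<le> (\<integral>y. 1/2 * (v\<^sub>0 y)\<^sup>2 \<partial>\<rho>\<^sub>0)" if s: "0 \<le> s" for s
  proof -
    have "is_cond_exp \<rho>\<^sub>0 v\<^sub>0 (\<lambda>y. y) v\<^sub>0"
      unfolding is_cond_exp_def
      by (intro conjI vL bexI[of _ v\<^sub>0] ballI impI L2_square_integrable[OF vL] AE_I2 refl
          borel_measurable_continuous_onI[OF cv])
    moreover have "L2_functions_of \<rho>\<^sub>0 (X s) \<subseteq> L2_functions_of \<rho>\<^sub>0 (\<lambda>y. y)"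
      using sub[OF _ s] by (simp add: X0)
    ultimately have "(L2_dist \<rho>\<^sub>0 v\<^sub>0 (V s))\<^sup>2 = (L2_norm \<rho>\<^sub>0 v\<^sub>0)\<^sup>2 - (L2_norm \<rho>\<^sub>0 (V s))\<^sup>2"
      by (intro cond_exp_tower_norm[OF \<mu> vL _ Xb[OF s] _ V[OF s]]) auto
    then show ?thesis
      using zero_le_power2[of "L2_dist \<rho>\<^sub>0 v\<^sub>0 (V s)"] by (simp add: L2_norm_power2)
  qed
  have Lip: "L2_dist \<rho>\<^sub>0 (X a) (X b) \<le> L2_norm \<rho>\<^sub>0 v\<^sub>0 * (b - a)" if ab: "0 \<le> a" "0 \<le> b" "a < b" for a b
  proof -
    have SL: "(\<lambda>y. y + c * v\<^sub>0 y) \<in> L2 \<rho>\<^sub>0" for c by (intro L2_add idL L2_cmult vL)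
    have "L2_dist \<rho>\<^sub>0 (X a) (X b) \<le> L2_dist \<rho>\<^sub>0 (\<lambda>y. y + a * v\<^sub>0 y) (\<lambda>y. y + b * v\<^sub>0 y)"
      by (rule isotonic_projection_contraction[OF SL SL proj[OF ab(1)] proj[OF ab(2)]])
    also have "\<dots> = L2_norm \<rho>\<^sub>0 (\<lambda>y. (a - b) * v\<^sub>0 y)"
      unfolding L2_dist_eq_norm by (simp add: algebra_simps)
    also have "\<dots> = L2_norm \<rho>\<^sub>0 v\<^sub>0 * (b - a)" using ab by (simp add: L2_norm_cmult)
    finally show ?thesis .
  qed
  define N where "N t = (L2_norm \<rho>\<^sub>0 (V (max 0 t)))\<^sup>2" for t
  have "AE t in lebesgue. isCont N t"
  proof (rule AE_continuity_point_of_decreasing)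
    fix s t :: real assume "s \<le> t"
    then have "max 0 s \<le> max 0 t" by simp
    from tower[OF _ this] zero_le_power2[of "L2_dist \<rho>\<^sub>0 (V (max 0 s)) (V (max 0 t))"]
    show "N t \<le> N s" by (simp add: N_def)
  qed
  then have deriv: "AE t in lebesgue. t \<ge> 0 \<longrightarrow> has_L2_derivative \<rho>\<^sub>0 X (V t) t {0..} \<and> is_cond_exp \<rho>\<^sub>0 v\<^sub>0 (X t) (V t)"
  proof eventually_elim
    fix t assume N: "isCont N t"
    show "t \<ge> 0 \<longrightarrow> has_L2_derivative \<rho>\<^sub>0 X (V t) t {0..} \<and> is_cond_exp \<rho>\<^sub>0 v\<^sub>0 (X t) (V t)"
    proof (intro impI conjI)
      assume t: "0 \<le> t"
      show "is_cond_exp \<rho>\<^sub>0 v\<^sub>0 (X t) (V t)" by (rule V[OF t])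
      show "has_L2_derivative \<rho>\<^sub>0 X (V t) t {0..}"
      proof (rule has_L2_derivative_of_estimate[OF XL VL _ tower t])
        fix s t :: real assume st: "0 \<le> s" "s < t"
        then have "0 \<le> t" "s \<le> t" by auto
        then show "L2_norm \<rho>\<^sub>0 (\<lambda>y. X s y - (X t y - (t - s) * V t y)) \<le> (t - s) * L2_dist \<rho>\<^sub>0 (V s) (V t)"
          using st by (intro sticky_increment_estimate[OF \<mu> idL vL] proj V sub)
      qed (use N in \<open>auto simp: N_def[abs_def]\<close>)
    qed
  qed
  have Xcont: "isCont (X t) y" if t: "0 \<le> t" for t y
  proof -
    define H where "H z = z + t * W z" for z
    have "isCont W y" using W(1) by (simp add: continuous_on_eq_continuous_at)
    then have "((\<lambda>z. \<bar>H z - H y\<bar>) \<longlongrightarrow> \<bar>H y - H y\<bar>) (at y)"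
      unfolding isCont_def H_def by (intro tendsto_intros)
    then have lim: "((\<lambda>z. \<bar>H z - H y\<bar>) \<longlongrightarrow> 0) (at y)" by simp
    have "\<bar>X t z - X t y\<bar> \<le> \<bar>H z - H y\<bar>" for z
      using inc[OF t, of y z] inc[OF t, of z y] by (cases "y \<le> z") (auto simp: H_def algebra_simps)
    then have "((\<lambda>z. X t z - X t y) \<longlongrightarrow> 0) (at y)"
      by (intro Lim_null_comparison[OF _ lim]) (auto intro: always_eventually)
    then show ?thesis by (simp add: isCont_def LIM_zero_iff)
  qed
  have contr_supp: "1 / t * \<bar>X t y - X t z\<bar> \<le> 1 / s * \<bar>X s y - X s z\<bar>"
    if st: "0 < s" "s \<le> t" and yz: "y \<in> supp \<rho>\<^sub>0" "z \<in> supp \<rho>\<^sub>0" for s t y z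
  proof -
    have nn: "0 \<le> s" "0 \<le> t" "0 < t" using st by auto
    obtain E where E: "AE y in \<rho>\<^sub>0. y \<in> E"
      "\<And>y z. y \<in> E \<Longrightarrow> z \<in> E \<Longrightarrow> y \<le> z \<Longrightarrow> X t z - X t y \<le> t / s * (X s z - X s y)"
      using contr[OF st] by blast
    have on_E: "1 / t * \<bar>X t a - X t b\<bar> \<le> 1 / s * \<bar>X s a - X s b\<bar>" if "a \<in> E" "b \<in> E" for a b
    proof -
      have "1 / t * \<bar>X t a - X t b\<bar> \<le> 1 / s * \<bar>X s a - X s b\<bar>"
        if ab: "a \<in> E" "b \<in> E" "a \<le> b" for a b
      proof -
        have "\<bar>X t a - X t b\<bar> = X t b - X t a" "\<bar>X s a - X s b\<bar> = X s b - X s a"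
          using monoD[OF Xm[OF nn(2)] ab(3)] monoD[OF Xm[OF nn(1)] ab(3)] by auto
        moreover have "1 / t * (X t b - X t a) \<le> 1 / t * (t / s * (X s b - X s a))"
          using E(2)[OF ab] nn by (intro mult_left_mono) auto
        ultimately show ?thesis using nn by simp
      qed
      from this[of a b] this[of b a] that show ?thesis
        by (cases "a \<le> b") (auto simp: abs_minus_commute)
    qed
    obtain a where a: "\<And>n. a n \<in> E" "a \<longlonglongrightarrow> y" using supp_approximated_by_full_set[OF \<mu> E(1) yz(1)] by blast
    obtain b where b: "\<And>n. b n \<in> E" "b \<longlonglongrightarrow> z" using supp_approximated_by_full_set[OF \<mu> E(1) yz(2)] by blast
    show ?thesis
    proof (rule LIMSEQ_le)
      show "(\<lambda>n. 1 / t * \<bar>X t (a n) - X t (b n)\<bar>) \<longlonglongrightarrow> 1 / t * \<bar>X t y - X t z\<bar>"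
        by (intro tendsto_intros isCont_tendsto_compose[OF Xcont[OF nn(2)]] a b)
      show "(\<lambda>n. 1 / s * \<bar>X s (a n) - X s (b n)\<bar>) \<longlonglongrightarrow> 1 / s * \<bar>X s y - X s z\<bar>"
        by (intro tendsto_intros isCont_tendsto_compose[OF Xcont[OF nn(1)]] a b)
    qed (use on_E a b in blast)
  qed
  show ?thesis
  proof (rule exI[of _ X], rule exI[of _ V], intro conjI)
    show "\<forall>t\<ge>0. X t \<in> borel_measurable borel \<and> X t \<in> L2 \<rho>\<^sub>0" using Xb XL by blast
    show "absolutely_continuous_on (L2_dist \<rho>\<^sub>0) {0..} X"
      by (rule Lipschitz_imp_absolutely_continuous[of _ _ _ "L2_norm \<rho>\<^sub>0 v\<^sub>0"]) (use Lip in auto)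
    show "AE y in \<rho>\<^sub>0. X 0 y = y" by (simp add: X0)
    show "\<exists>N \<in> null_sets lebesgue. \<forall>s t. 0 \<le> s \<longrightarrow> s \<le> t \<longrightarrow> s \<notin> N \<longrightarrow> t \<notin> N \<longrightarrow>
          (\<integral>y. 1/2 * (V t y)\<^sup>2 \<partial>\<rho>\<^sub>0) \<le> (\<integral>y. 1/2 * (V s y)\<^sup>2 \<partial>\<rho>\<^sub>0)
        \<and> (\<integral>y. 1/2 * (V s y)\<^sup>2 \<partial>\<rho>\<^sub>0) \<le> (\<integral>y. 1/2 * (v\<^sub>0 y)\<^sup>2 \<partial>\<rho>\<^sub>0)"
      using energy energy0 by (intro bexI[of _ "{}"]) auto
    show "\<forall>t\<ge>0. \<forall>y\<in>supp \<rho>\<^sub>0. \<forall>z\<in>supp \<rho>\<^sub>0. y \<le> z \<longrightarrow>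
          0 \<le> X t z - X t y \<and> X t z - X t y \<le> z - y + t * (LINT x:{y..z}|lebesgue. \<bar>deriv v\<^sub>0 x\<bar>)"
      using inc W(4) by simp
    show "\<forall>s t. 0 < s \<longrightarrow> s \<le> t \<longrightarrow> (\<forall>y\<in>supp \<rho>\<^sub>0. \<forall>z\<in>supp \<rho>\<^sub>0.
          1 / t * \<bar>X t y - X t z\<bar> \<le> 1 / s * \<bar>X s y - X s z\<bar>)"
      using contr_supp by blast
  qed (rule deriv)
qed

end
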